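(* Let $p$ be a prime and let $v\in\mathbb{R}^p$ have pairwise distinct coordinates that do not sum to $0$. Let $C$ be the elementary symmetric curve associated to $v$ and $C_1$ an irreducible component of $C$. If $\mathrm{stab}(C_1)$ is not isomorphic to the dihedral group $D_{2p}$ of order $2p$, then $\max_H|H\cap S_pv|=(p-1)!$, where $H$ ranges over hyperplanes of $\mathbb{R}^p$ through the origin.
   Context: For $v=(c_1,\dots,c_n)$, the elementary symmetric curve associated to $v$ is the complex algebraic variety $C$ (in $\mathbb{C}^n$, viewed inside $\mathbb{P}^n_{\mathbb{C}}$) cut out by $e_k(x_1,\dots,x_n)=e_k(c_1,\dots,c_n)$ for $k=1,\dots,n-1$, where $e_k$ is the $k$-th elementary symmetric polynomial. $S_p$ acts on $\mathbb{C}^p$ by permuting coordinates, hence on the set of irreducible components of $C$; $\mathrm{stab}(C_1)$ is the stabilizer of $C_1$ under this action. $S_pv$ is the orbit of $v$. *)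

theory Defs
  imports "HOL-Analysis.Analysis" "HOL-Algebra.Bij" "HOL-Computational_Algebra.Primes"
begin

inductive_set poly_fun :: "((complex^'n) \<Rightarrow> complex) set" where
  pf_const: "(\<lambda>x. c) \<in> poly_fun"
| pf_coord: "(\<lambda>x. x $ i) \<in> poly_fun"
| pf_add: "f \<in> poly_fun \<Longrightarrow> g \<in> poly_fun \<Longrightarrow> (\<lambda>x. f x + g x) \<in> poly_fun"
| pf_mult: "f \<in> poly_fun \<Longrightarrow> g \<in> poly_fun \<Longrightarrow> (\<lambda>x. f x * g x) \<in> poly_fun"

definition zariski_closed :: "(complex^'n) set \<Rightarrow> bool" where
  "zariski_closed Z \<longleftrightarrow> (\<exists>F \<subseteq> poly_fun. Z = {x. \<forall>f\<in>F. f x = 0})"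

definition zariski_irreducible :: "(complex^'n) set \<Rightarrow> bool" where
  "zariski_irreducible Z \<longleftrightarrow> Z \<noteq> {} \<and> zariski_closed Z \<and>
     (\<forall>A B. zariski_closed A \<and> zariski_closed B \<and> Z = A \<union> B \<longrightarrow> Z = A \<or> Z = B)"

definition irreducible_component :: "(complex^'n) set \<Rightarrow> (complex^'n) set \<Rightarrow> bool" where
  "irreducible_component C Z \<longleftrightarrow> Z \<subseteq> C \<and> zariski_irreducible Z \<and>
     (\<forall>W. zariski_irreducible W \<and> Z \<subseteq> W \<and> W \<subseteq> C \<longrightarrow> W = Z)"

definition esym :: "nat \<Rightarrow> ('a::comm_ring_1)^'n \<Rightarrow> 'a" where
  "esym k x = (\<Sum>S\<in>{S::'n set. card S = k}. \<Prod>i\<in>S. x $ i)"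

text \<open>The elementary symmetric curve associated to v (affine part, in C^n).\<close>
definition esym_curve :: "real^'n \<Rightarrow> (complex^'n) set" where
  "esym_curve v = {x. \<forall>k\<in>{1..CARD('n) - 1}.
       esym k x = esym k (\<chi> i. complex_of_real (v $ i))}"

definition perm_act :: "('n \<Rightarrow> 'n) \<Rightarrow> 'a^'n \<Rightarrow> 'a^'n" where
  "perm_act \<sigma> x = (\<chi> i. x $ (inv_into UNIV \<sigma> i))"

definition sym_grp :: "('n \<Rightarrow> 'n) monoid" where
  "sym_grp = BijGroup (UNIV :: 'n set)"

definition stab :: "(complex^'n) set \<Rightarrow> ('n \<Rightarrow> 'n) monoid" where
  "stab Z = sym_grp \<lparr>carrier := {\<sigma> \<in> carrier sym_grp. perm_act \<sigma> ` Z = Z}\<rparr>"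

text \<open>Dihedral group of order 2n: element (a,s) is the map x \<mapsto> a + (if s then -x else x) on Z/nZ.\<close>
definition dihedral_group :: "nat \<Rightarrow> (nat \<times> bool) monoid" where
  "dihedral_group n = \<lparr> carrier = {0..<n} \<times> UNIV,
      mult = (\<lambda>(a,s) (b,t). ((a + (if s then n - b else b)) mod n, s \<noteq> t)),
      one = (0, False) \<rparr>"

definition perm_orbit :: "real^'n \<Rightarrow> (real^'n) set" where
  "perm_orbit v = {perm_act \<sigma> v | \<sigma>. \<sigma> permutes (UNIV :: 'n set)}"

end

theory Submission
  imports Defs "HOL-Number_Theory.Cong" "HOL-Complex_Analysis.Complex_Analysis"
    "HOL-Computational_Algebra.Fundamental_Theorem_Algebra"
begin

text \<open>
  Let F be the polynomial whose roots are the coordinates of v. The points of the curve are the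
  enumerations of the roots of F = t. For a linear form a, the product of a over all p! enumerations is a
  polynomial in t of degree at most (p - 1)!, and every permutation of v on the hyperplane a = 0
  contributes a factor vanishing at t = 0. Hence more than (p - 1)! such points force a linear relation
  between the roots of F = t, valid for all t in the upper half plane.

  All roots and critical points of F are real and simple. Therefore the roots of F = t can be numbered
  by the branches of arg F, and the monodromy around a critical value is an explicit product of
  disjoint transpositions. If two maxima or two minima of F have different values, a short argument with
  polynomials modulo p, in the spirit of Mueller's proof of Burnside's theorem, shows that the projection
  to the space of relations is a combination of the identity and the all-one matrix, and then there are
  no relations. Otherwise F is a Chebyshev polynomial up to affine substitutions, the components of the
  curve are conics parametrized by cosines, and their stabilizers are dihedral.
\<close>

text \<open>No paths or loops are needed. All critical values of F are real, so over the upper half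
  plane every root of F = t is one holomorphic function of t, and monodromy is read off by
  continuing through a real critical value with t = cv + s^2 and comparing s with -s. The flips at
  all positive critical values together act on labels as l \<mapsto> - l, and those at all negative
  ones as l \<mapsto> - l - 1, modulo p. Hence any flip-invariant matrix depends only on l - m up to
  sign; this dihedral symmetry is always there. If two critical values of one sign differ, there is
  a flip that negates some nonzero residues and fixes others, and this rigid situation forces all
  off-diagonal entries to agree. Primality enters here: residues modulo p form a field, where a
  polynomial of low degree has few roots. The sum of the roots of F = t does not depend on t, so a
  zero coordinate sum would make the all-one form a relation for every t; this is what the
  hypothesis on the sum prevents. The bound is p! / p. It is attained by a hyperplane that meets the
  orbit exactly in the points with one prescribed coordinate.\<close>

section \<open>Polynomials modulo a prime\<close>

text \<open>Lagrange's bound on the number of roots over the field with \<open>p\<close> elements.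
  Integer polynomials stand in for that field: divisibility by \<open>[:int p:]\<close> means that
  the reduction is zero.\<close>

lemma const_dvd_poly_if_many_roots:
  fixes f :: "int poly" and p :: nat
  assumes "prime p" "A \<subseteq> {0..<int p}" "card A > degree f" "\<And>a. a \<in> A \<Longrightarrow> int p dvd poly f a"
  shows "[:int p:] dvd f"
  using assms(2-)
proof (induction "degree f" arbitrary: f A)
  case 0
  then obtain a where a: "a \<in> A" by fastforce
  from 0 obtain c where c: "f = [:c:]" by (metis degree_eq_zeroE)
  show ?case using 0(4)[OF a] c by (simp add: const_poly_dvd_const_poly_iff)
next
  case (Suc n)
  then obtain a where a: "a \<in> A" by fastforce
  define g where "g = synthetic_div f a"
  have fg: "f = [:-a,1:] * g + [:poly f a:]"
    unfolding g_def by (simp only: synthetic_div_correct')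
  have dg: "degree g = n" using Suc(2) by (simp add: g_def degree_synthetic_div)
  have finA: "finite A" using Suc.prems(1) finite_subset by blast
  have "[:int p:] dvd g"
  proof (rule Suc.hyps(1)[of g "A - {a}"])
    show "n = degree g" "A - {a} \<subseteq> {0..<int p}" using dg Suc by auto
    show "degree g < card (A - {a})" using Suc dg finA a by simp
    fix b assume b: "b \<in> A - {a}"
    have "poly f b = (b - a) * poly g b + poly f a"
      by (subst fg) (simp add: algebra_simps)
    then have "int p dvd (b - a) * poly g b"
      using Suc.prems(3)[of b] Suc.prems(3)[OF a] b by (metis DiffD1 add_diff_cancel_right' dvd_diff)
    moreover have "\<not> int p dvd (b - a)"
    proof
      assume "int p dvd b - a"
      moreover have "b \<in> {0..<int p}" "a \<in> {0..<int p}" using b a Suc.prems(1) by auto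
      then have "\<bar>b - a\<bar> < int p" by auto
      ultimately show False using b by (metis DiffE dvd_imp_le_int insertI1 abs_of_nat eq_iff_diff_eq_0 not_less)
    qed
    ultimately show "int p dvd poly g b" using assms(1) by (simp add: prime_dvd_mult_iff)
  qed
  moreover have "[:int p:] dvd [:poly f a:]" using Suc.prems(3)[OF a] by (simp add: const_poly_dvd_const_poly_iff)
  ultimately show ?case by (subst fg) (intro dvd_add dvd_mult)
qed

lemma cong_poly_int:
  fixes F :: "int poly"
  assumes "[x = y] (mod n)"
  shows "[poly F x = poly F y] (mod n)"
  by (induction F) (auto intro!: cong_add cong_mult assms)

text \<open>Newton interpolation: a new node is corrected by a multiple of the product vanishing at
  the old nodes, whose value at the new node is invertible modulo \<open>p\<close>.\<close>

lemma int_poly_interpolation: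
  fixes g :: "int \<Rightarrow> int"
  assumes "prime p" and "A \<subseteq> {0..<int p}"
  shows "\<exists>F. degree F \<le> card A - 1 \<and> (\<forall>a\<in>A. [poly F a = g a] (mod int p))"
proof -
  have "finite A" using assms(2) finite_subset by blast
  then show ?thesis using assms(2)
  proof (induction A)
    case empty
    show ?case by (intro exI[of _ 0]) auto
  next
    case (insert a A)
    then obtain F where F: "degree F \<le> card A - 1" "\<And>b. b \<in> A \<Longrightarrow> [poly F b = g b] (mod int p)"
      by auto
    define P :: "int poly" where "P = (\<Prod>b\<in>A. [:-b,1:])"
    have degP: "degree P \<le> card A"
      using degree_prod_sum_le[OF insert.hyps(1), of "\<lambda>b. [:-b,1:]"] by (simp add: P_def)
    have "\<not> int p dvd a - b" if "b \<in> A" for b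
    proof
      assume "int p dvd a - b"
      moreover have "a \<in> {0..<int p}" "b \<in> {0..<int p}" using that insert.prems by auto
      then have "\<bar>a - b\<bar> < int p" by auto
      ultimately have "a = b" by (metis dvd_imp_le_int abs_of_nat eq_iff_diff_eq_0 not_less)
      then show False using that insert.hyps by auto
    qed
    then have "\<not> int p dvd poly P a"
      using assms(1) insert.hyps(1) by (simp add: P_def poly_prod prime_dvd_prod_iff)
    then have "coprime (poly P a) (int p)"
      using assms(1) by (meson coprime_commute prime_imp_coprime prime_nat_int_transfer)
    then obtain u where u: "[poly P a * u = 1] (mod int p)"
      using cong_solve_coprime_int by blast
    define G where "G = F + smult ((g a - poly F a) * u) P"
    have "degree G \<le> card A" unfolding G_def
      using F(1) degP by (intro degree_add_le order.trans[OF degree_smult_le]) auto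
    moreover have "[poly G a = g a] (mod int p)"
    proof -
      have "[poly F a + (g a - poly F a) * (poly P a * u) = poly F a + (g a - poly F a) * 1] (mod int p)"
        by (intro cong_add cong_mult cong_refl u)
      then show ?thesis by (simp add: G_def mult_ac)
    qed
    moreover have "[poly G b = g b] (mod int p)" if "b \<in> A" for b
    proof -
      have "poly P b = 0" using that insert.hyps(1) by (auto simp: P_def poly_prod)
      then show ?thesis using F(2)[OF that] by (simp add: G_def)
    qed
    ultimately show ?case using insert.hyps by (intro exI[of _ G]) auto
  qed
qed

lemma coeff_pcompose_shift:
  fixes F :: "int poly"
  shows "coeff (pcompose F [:d,1:]) j = (\<Sum>i\<in>{j..degree F}. coeff F i * int (i choose j) * d ^ (i - j))"
proof -
  have "pcompose F [:d,1:] = (\<Sum>i\<le>degree F. smult (coeff F i) ([:d,1:] ^ i))"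
    by (simp add: pcompose_altdef poly_altdef coeff_map_poly degree_map_poly)
  then have "coeff (pcompose F [:d,1:]) j = (\<Sum>i\<le>degree F. coeff F i * coeff ([:d,1:] ^ i) j)"
    by (simp add: coeff_sum)
  also have "\<dots> = (\<Sum>i\<in>{j..degree F}. coeff F i * coeff ([:d,1:] ^ i) j)"
  proof (rule sum.mono_neutral_right)
    show "\<forall>i\<in>{..degree F} - {j..degree F}. coeff F i * coeff ([:d, 1:] ^ i) j = 0"
    proof
      fix i assume "i \<in> {..degree F} - {j..degree F}"
      then have "degree ([:d,1:] ^ i) < j" by (auto simp: degree_linear_power)
      then show "coeff F i * coeff ([:d, 1:] ^ i) j = 0" by (simp add: coeff_eq_0)
    qed
  qed auto
  also have "\<dots> = (\<Sum>i\<in>{j..degree F}. coeff F i * int (i choose j) * d ^ (i - j))"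
    by (intro sum.cong) (auto simp: coeff_linear_poly_power)
  finally show ?thesis .
qed

text \<open>A Vandermonde argument. If these power sums all vanished modulo \<open>p\<close>, so
  would the sum over \<open>D\<close> of any polynomial of degree at most \<open>card D\<close>
  without constant term; one such polynomial singles out a single element of
  \<open>D\<close>.\<close>

lemma power_sum_not_dvd:
  assumes "prime p" and D: "D \<subseteq> {1..<int p}" "D \<noteq> {}"
  obtains n where "n \<in> {1..card D}" "\<not> int p dvd (\<Sum>d\<in>D. d ^ n)"
proof (rule ccontr)
  assume "\<not> thesis"
  with that have dv: "\<And>n. n \<in> {1..card D} \<Longrightarrow> int p dvd (\<Sum>d\<in>D. d ^ n)" by blast
  have fin: "finite D" using D finite_subset by blast
  obtain d0 where d0: "d0 \<in> D" using D by blast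
  \<comment> \<open>Vanishes on \<open>D\<close> except at \<open>d0\<close>. The factor x removes
    the constant term, because the power sum with exponent 0 is not among the controlled
    ones.\<close>
  define W :: "int poly" where "W = [:0,1:] * (\<Prod>d\<in>D-{d0}. [:-d,1:])"
  have "degree (\<Prod>d\<in>D-{d0}. [:-d,1::int:]) \<le> card D - 1"
    using degree_prod_sum_le[of "D-{d0}" "\<lambda>b. [:-b,1::int:]"] fin d0 by simp
  moreover have "card D > 0" using fin D(2) by (simp add: card_gt_0_iff)
  ultimately have deg: "degree W \<le> card D"
    unfolding W_def by (intro order.trans[OF degree_mult_le]) simp
  have W0: "coeff W 0 = 0" by (simp add: W_def coeff_mult_0)
  have "(\<Sum>d\<in>D. poly W d) = poly W d0"
    using fin d0 by (subst sum.remove[of _ d0]) (auto simp: W_def poly_prod intro!: sum.neutral)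
  moreover have "\<not> int p dvd poly W d0"
  proof -
    have "\<not> int p dvd d0 - b" if "b \<in> D - {d0}" for b
    proof
      assume "int p dvd d0 - b"
      moreover have "d0 \<in> {1..<int p}" "b \<in> {1..<int p}" using that D d0 by auto
      then have "\<bar>d0 - b\<bar> < int p" by auto
      ultimately have "d0 = b" by (metis dvd_imp_le_int abs_of_nat eq_iff_diff_eq_0 not_less)
      then show False using that by auto
    qed
    moreover have "\<not> int p dvd d0" using d0 D(1) by (intro zdvd_not_zless) auto
    ultimately show ?thesis
      using assms(1) fin by (simp add: W_def poly_prod prime_dvd_prod_iff prime_dvd_mult_iff)
  qed
  moreover have "(\<Sum>d\<in>D. poly W d) = (\<Sum>n\<le>card D. coeff W n * (\<Sum>d\<in>D. d ^ n))"
  proof -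
    have "poly W d = (\<Sum>n\<le>card D. coeff W n * d ^ n)" for d
      by (simp add: poly_altdef, rule sum.mono_neutral_left) (use deg in \<open>auto simp: coeff_eq_0\<close>)
    then show ?thesis by (simp add: sum_distrib_left) (rule sum.swap)
  qed
  moreover have "int p dvd (\<Sum>n\<le>card D. coeff W n * (\<Sum>d\<in>D. d ^ n))"
  proof (rule dvd_sum)
    fix n assume "n \<in> {..card D}"
    then show "int p dvd coeff W n * (\<Sum>d\<in>D. d ^ n)"
      using dv[of n] W0 by (cases "n = 0") auto
  qed
  ultimately show False by simp
qed

text \<open>Let \<open>n0\<close> be the least positive exponent whose power sum over
  \<open>D\<close> is nonzero modulo \<open>p\<close>. On polynomials of degree q with
  \<open>n0\<close> \<le> q < \<open>p\<close>, summing f(x + d) - f(x) over \<open>D\<close> lowers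
  the degree by exactly \<open>n0\<close>, so nothing in that range is annihilated; and
  \<open>n0\<close> is at most \<open>card D\<close>.\<close>

lemma shift_eigenfunction_low_degree:
  fixes g :: "int \<Rightarrow> int"
  assumes p: "prime p" and D: "D \<subseteq> {1..<int p}" "D \<noteq> {}"
    and g: "\<And>i j. [i = j] (mod int p) \<Longrightarrow> [g i = g j] (mod int p)"
    and eig: "\<And>i. [(\<Sum>d\<in>D. g (i + d)) = int (card D) * g i] (mod int p)"
  shows "\<exists>F. degree F < card D \<and> (\<forall>i. [poly F i = g i] (mod int p))"
proof -
  have p1: "p > 1" using p prime_gt_1_nat by blast
  have fin: "finite D" using D finite_subset by blast
  define rep where "rep F \<longleftrightarrow> (\<forall>i. [poly F i = g i] (mod int p))" for F
  have "\<exists>F. rep F \<and> degree F < p"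
  proof -
    obtain F where F: "degree F \<le> card {0..<int p} - 1" "\<forall>a\<in>{0..<int p}. [poly F a = g a] (mod int p)"
      using int_poly_interpolation[OF p order.refl] by blast
    have "[poly F i = g i] (mod int p)" for i
    proof -
      have "[poly F i = poly F (i mod int p)] (mod int p)" by (rule cong_poly_int) simp
      moreover have "[poly F (i mod int p) = g (i mod int p)] (mod int p)"
        using F(2) p1 by auto
      moreover have "[g (i mod int p) = g i] (mod int p)" by (rule g) simp
      ultimately show ?thesis using cong_trans by blast
    qed
    moreover have "degree F < p" using F(1) p1 by simp
      ultimately show ?thesis unfolding rep_def by blast
  qed
  then obtain F0 where F0: "rep F0" "degree F0 < p" by blast
  \<comment> \<open>Minimality of the degree makes the leading coefficient nonzero modulo
    \<open>p\<close>: otherwise the leading term could be dropped.\<close>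
  obtain F where F: "rep F" "\<And>G. rep G \<Longrightarrow> degree F \<le> degree G"
    using exists_least_iff[of "\<lambda>n. \<exists>G. rep G \<and> degree G = n"] F0(1) by (metis not_less)
  define q where "q = degree F"
  have qp: "q < p" using F(2)[OF F0(1)] F0(2) q_def by simp
  have "q < card D"
  proof (rule ccontr)
    assume "\<not> q < card D"
    then have q: "card D \<le> q" by simp
    have cD: "card D \<ge> 1" using fin D by (simp add: card_gt_0_iff Suc_le_eq)
    have lc: "\<not> int p dvd coeff F q"
    proof
      assume dv: "int p dvd coeff F q"
      define G where "G = F - monom (coeff F q) q"
      have "rep G" unfolding rep_def
      proof
        fix i
        have "[poly F i - coeff F q * i ^ q = g i - 0] (mod int p)"
          using F(1) dv by (intro cong_diff) (auto simp: rep_def cong_0_iff)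
        then show "[poly G i = g i] (mod int p)" by (simp add: G_def poly_monom)
      qed
      moreover have "degree G < q"
        using q cD by (intro degree_lessI) (auto simp: G_def q_def coeff_eq_0 le_less)
      ultimately show False using F(2) q_def by fastforce
    qed
    define s where "s n = (\<Sum>d\<in>D. d ^ n)" for n
    define n0 where "n0 = (LEAST n. n \<ge> 1 \<and> \<not> int p dvd s n)"
    obtain n where n: "n \<in> {1..card D}" "\<not> int p dvd s n"
      unfolding s_def by (rule power_sum_not_dvd[OF p D])
    have n0: "n0 \<ge> 1" "\<not> int p dvd s n0" "n0 \<le> card D"
      using LeastI[of "\<lambda>n. n \<ge> 1 \<and> \<not> int p dvd s n" n] Least_le[of "\<lambda>n. n \<ge> 1 \<and> \<not> int p dvd s n" n] n
      unfolding n0_def by auto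
    have small: "int p dvd s n" if "1 \<le> n" "n < n0" for n
      using not_less_Least[of n "\<lambda>n. n \<ge> 1 \<and> \<not> int p dvd s n"] that unfolding n0_def by auto
    define H where "H = (\<Sum>d\<in>D. pcompose F [:d,1:] - F)"
    \<comment> \<open>\<open>H\<close> vanishes at all \<open>p\<close> residues while its degree is
      below \<open>p\<close>, so every coefficient is divisible by \<open>p\<close>; the one at
      \<open>q - n0\<close> gives the contradiction.\<close>
    have "[:int p:] dvd H"
    proof (rule const_dvd_poly_if_many_roots[OF p order.refl])
      have "degree H \<le> q" unfolding H_def q_def
        by (intro degree_sum_le fin degree_diff_le) (simp_all add: degree_pcompose)
      then show "degree H < card {0..<int p}" using qp by simp
      fix i
      have "poly H i = (\<Sum>d\<in>D. poly F (i + d)) - int (card D) * poly F i"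
        by (simp add: H_def poly_sum poly_pcompose sum_subtractf add.commute)
      moreover have "[(\<Sum>d\<in>D. poly F (i + d)) - int (card D) * poly F i = (\<Sum>d\<in>D. g (i + d)) - int (card D) * g i] (mod int p)"
        using F(1) by (intro cong_diff cong_sum cong_mult cong_refl) (auto simp: rep_def)
      moreover have "[(\<Sum>d\<in>D. g (i + d)) - int (card D) * g i = 0] (mod int p)"
        using eig[of i] by (simp add: cong_iff_dvd_diff)
      ultimately show "int p dvd poly H i" by (metis cong_0_iff cong_trans)
    qed
    then have dvH: "int p dvd coeff H (q - n0)" by (simp add: const_poly_dvd_iff)
    define j where "j = q - n0"
    have j: "j < q" "q - j = n0" "j \<le> q" using n0 q cD by (auto simp: j_def)
    have "coeff H j = (\<Sum>d\<in>D. (\<Sum>i\<in>{j..q}. coeff F i * int (i choose j) * d ^ (i - j)) - coeff F j)"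
      by (simp add: H_def coeff_sum coeff_pcompose_shift q_def)
    also have "\<dots> = (\<Sum>d\<in>D. (\<Sum>i\<in>{Suc j..q}. coeff F i * int (i choose j) * d ^ (i - j)))"
      using j by (intro sum.cong refl) (simp add: sum.atLeast_Suc_atMost)
    also have "\<dots> = (\<Sum>i\<in>{Suc j..q}. coeff F i * int (i choose j) * s (i - j))"
      by (subst sum.swap) (simp add: s_def sum_distrib_left)
    \<comment> \<open>Only the top term survives modulo \<open>p\<close>, since the others contain
      power sums with exponents strictly between 0 and \<open>n0\<close>.\<close>
    also have "\<dots> = coeff F q * int (q choose j) * s n0 + (\<Sum>i\<in>{Suc j..q}-{q}. coeff F i * int (i choose j) * s (i - j))"
      using j by (subst sum.remove[of _ q]) auto
    finally have eqH: "coeff H j = \<dots>" .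
    have dvR: "int p dvd (\<Sum>i\<in>{Suc j..q}-{q}. coeff F i * int (i choose j) * s (i - j))"
      using j by (intro dvd_sum dvd_mult small) auto
    have "int p dvd coeff F q * int (q choose j) * s n0"
      using dvH unfolding j_def[symmetric] eqH dvd_add_left_iff[OF dvR] .
    moreover have "\<not> p dvd (q choose j)"
    proof
      assume "p dvd (q choose j)"
      then have "p dvd fact j * fact (q - j) * (q choose j)" by (rule dvd_mult)
      then have "p dvd fact q" unfolding binomial_fact_lemma[OF j(3)] .
      then show False using qp p prime_dvd_fact_iff by (metis not_less)
    qed
    ultimately show False using p lc n0(2) by (simp add: prime_dvd_mult_iff)
  qed
  then show ?thesis using F(1) unfolding rep_def q_def by blast
qed

text \<open>The partial reflection \<open>\<pi>\<close> that negates \<open>U\<close> and fixes the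
  rest preserves \<open>e\<close> on differences, so it is an automorphism of the Cayley graph whose
  connection set \<open>D\<close> is a level set of \<open>e\<close>. Summing over neighbours makes
  \<open>\<pi>\<close> an eigenfunction, hence a polynomial modulo \<open>p\<close> of degree below
  \<open>card D\<close>. But \<open>\<pi>\<close> agrees with x or with -x on more than half of the
  residues, so it would have to be that function everywhere, against \<open>w\<close> or
  \<open>u\<close>.\<close>

lemma flip_rigidity:
  fixes e :: "int \<Rightarrow> 'b"
  assumes p: "prime p" "odd p"
    and per: "\<And>i j. [i = j] (mod int p) \<Longrightarrow> e i = e j" and even: "\<And>i. e (- i) = e i"
    and U: "\<And>i j. [i = j] (mod int p) \<Longrightarrow> i \<in> U \<Longrightarrow> j \<in> U" "\<And>i. i \<in> U \<Longrightarrow> - i \<in> U" "0 \<notin> U"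
    and inv: "\<And>i j. i \<in> U \<Longrightarrow> j \<notin> U \<Longrightarrow> e (i + j) = e (i - j)"
    and u: "u \<in> U" and w: "w \<notin> U" "\<not> int p dvd w"
    and d: "\<not> int p dvd d"
  shows "e d = e 1"
proof (rule ccontr)
  assume ne: "e d \<noteq> e 1"
  have p1: "p > 2" using p(2) prime_ge_2_nat[OF p(1)] by (cases "p = 2") auto
  have notU: "\<not> int p dvd i" if "i \<in> U" for i
    using U(1)[of i 0] U(3) that by (auto simp: cong_0_iff)
  define D0 where "D0 = {d \<in> {1..<int p}. e d = e 1}"
  define D1 where "D1 = {d \<in> {1..<int p}. e d \<noteq> e 1}"
  have "1 \<in> D0" using p1 by (auto simp: D0_def)
  moreover have "d mod int p \<in> D1"
  proof -
    have "d mod int p \<noteq> 0" using d by (simp add: dvd_eq_mod_eq_0)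
    moreover have "0 \<le> d mod int p" "d mod int p < int p" using p1 by auto
    moreover have "e (d mod int p) = e d" by (rule per) simp
    ultimately show ?thesis using ne by (auto simp: D1_def)
  qed
  moreover have "card D0 + card D1 = p - 1"
  proof -
    have "finite D0" "finite D1"
      by (rule finite_subset[of _ "{1..<int p}"]; auto simp: D0_def D1_def)+
    then have "card D0 + card D1 = card (D0 \<union> D1)"
      by (intro card_Un_disjoint[symmetric]) (auto simp: D0_def D1_def)
    also have "D0 \<union> D1 = {1..<int p}" by (auto simp: D0_def D1_def)
    finally show ?thesis by simp
  qed
  ultimately have D01: "D0 \<noteq> {}" "D1 \<noteq> {}" "2 * card D0 \<le> p - 1 \<or> 2 * card D1 \<le> p - 1" by auto
  \<comment> \<open>A level set may be replaced by its complement in the nonzero residues. The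
    smaller of the two gives a degree below half of \<open>p\<close>.\<close>
  obtain P where P: "{d \<in> {1..<int p}. P (e d)} \<noteq> {}" "2 * card {d \<in> {1..<int p}. P (e d)} \<le> p - 1"
  proof (cases "2 * card D0 \<le> p - 1")
    case True
    then show ?thesis using that[of "\<lambda>x. x = e 1"] D01(1) unfolding D0_def by blast
  next
    case False
    then show ?thesis using that[of "\<lambda>x. x \<noteq> e 1"] D01 unfolding D1_def by blast
  qed
  define D where "D = {d \<in> {1..<int p}. P (e d)}"
  have D: "D \<subseteq> {1..<int p}" "D \<noteq> {}" "2 * card D \<le> p - 1" using P by (auto simp: D_def)
  have fin: "finite D" using D(1) finite_subset by blast
  have inD: "i mod int p \<in> D \<longleftrightarrow> \<not> int p dvd i \<and> P (e i)" for i
  proof -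
    have "e (i mod int p) = e i" by (rule per) simp
    moreover have "0 \<le> i mod int p" "i mod int p < int p" using p1 by auto
    ultimately show ?thesis by (auto simp: D_def dvd_eq_mod_eq_0)
  qed
  define \<pi> where "\<pi> i = (if i \<in> U then - i else i)" for i
  have \<pi>e: "e (\<pi> i - \<pi> j) = e (i - j)" for i j
    using inv[of i j] inv[of j i] even[of "i - j"] even[of "j + i"] even[of "j - i"] by (auto simp: \<pi>_def algebra_simps)
  have \<pi>cong: "[\<pi> i = \<pi> j] (mod int p)" if "[i = j] (mod int p)" for i j
    using U(1)[of i j] U(1)[of j i] that by (auto simp: \<pi>_def cong_sym_eq cong_minus_minus_iff)
  have \<pi>\<pi>: "\<pi> (\<pi> i) = i" for i using U(2)[of i] by (auto simp: \<pi>_def)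
  have \<pi>inj: "[i = j] (mod int p)" if "[\<pi> i = \<pi> j] (mod int p)" for i j
    using \<pi>cong[OF that] by (simp add: \<pi>\<pi>)
  have eig: "[(\<Sum>d\<in>D. \<pi> (i + d)) = int (card D) * \<pi> i] (mod int p)" for i
  proof -
    define \<phi> where "\<phi> d = (\<pi> (i + d) - \<pi> i) mod int p" for d
    have inj: "inj_on \<phi> D"
    proof (rule inj_onI)
      fix x y assume xy: "x \<in> D" "y \<in> D" "\<phi> x = \<phi> y"
      then have "[\<pi> (i + x) - \<pi> i = \<pi> (i + y) - \<pi> i] (mod int p)" by (simp add: \<phi>_def cong_def)
      then have "[\<pi> (i + x) = \<pi> (i + y)] (mod int p)"
        using cong_add[OF _ cong_refl[of "\<pi> i"], of "\<pi> (i + x) - \<pi> i" "\<pi> (i + y) - \<pi> i"] by simp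
      then have "[i + x = i + y] (mod int p)" by (rule \<pi>inj)
      then have "[x = y] (mod int p)" by (simp add: cong_add_lcancel)
      moreover have "x \<in> {1..<int p}" "y \<in> {1..<int p}" using xy D(1) by auto
      ultimately show "x = y" by (simp add: cong_def)
    qed
    have "\<phi> x \<in> D" if x: "x \<in> D" for x
    proof -
      have "\<not> int p dvd (\<pi> (i + x) - \<pi> i)"
      proof
        assume "int p dvd (\<pi> (i + x) - \<pi> i)"
        then have "[\<pi> (i + x) = \<pi> i] (mod int p)" by (simp add: cong_iff_dvd_diff)
        then have "[i + x = i] (mod int p)" by (rule \<pi>inj)
        then have "int p dvd x" by (simp add: cong_iff_dvd_diff)
        moreover have "x \<in> {1..<int p}" using x D(1) by auto
        ultimately show False using zdvd_not_zless[of x "int p"] by simp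
      qed
      moreover have "e (\<pi> (i + x) - \<pi> i) = e x" by (simp add: \<pi>e)
      moreover have "P (e x)" using x by (simp add: D_def)
      ultimately show ?thesis unfolding \<phi>_def inD by simp
    qed
    then have "\<phi> ` D \<subseteq> D" by blast
    then have img: "\<phi> ` D = D" by (rule endo_inj_surj[OF fin _ inj])
    \<comment> \<open>\<open>D\<close> is symmetric because \<open>e\<close> is even, so its
      elements cancel in pairs modulo \<open>p\<close>; this removes the additive constant from the
      eigenvalue equation.\<close>
    have "int p dvd (\<Sum>d\<in>D. d)"
    proof -
      have refl: "int p - a \<in> D" if a: "a \<in> D" for a
      proof -
        have "e (int p - a) = e (- a)" by (rule per) (simp add: cong_iff_dvd_diff)
        then show "int p - a \<in> D" using a by (auto simp: D_def even)
      qed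
      have "(\<Sum>d\<in>D. d) = (\<Sum>d\<in>D. int p - d)"
        by (rule sum.reindex_bij_witness[of _ "\<lambda>d. int p - d" "\<lambda>d. int p - d"]) (auto simp: refl)
      then have "2 * (\<Sum>d\<in>D. d) = int p * int (card D)" by (simp add: sum_subtractf)
      then have "int p dvd 2 * (\<Sum>d\<in>D. d)" by simp
      then have "int p dvd 2 \<or> int p dvd (\<Sum>d\<in>D. d)" using p(1) by (simp add: prime_dvd_mult_iff)
      moreover have "\<not> int p dvd 2" using p1 zdvd_not_zless[of 2 "int p"] by simp
      ultimately show ?thesis by blast
    qed
    moreover have "(\<Sum>d\<in>D. \<phi> d) = (\<Sum>d\<in>D. d)"
      using sum.reindex[OF inj, of "\<lambda>x. x"] img by simp
    ultimately have "[(\<Sum>d\<in>D. \<phi> d) = 0] (mod int p)" by (simp add: cong_0_iff)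
    moreover have "[(\<Sum>d\<in>D. \<phi> d) = (\<Sum>d\<in>D. \<pi> (i + d) - \<pi> i)] (mod int p)"
      by (intro cong_sum) (simp add: \<phi>_def)
    ultimately have "[(\<Sum>d\<in>D. \<pi> (i + d) - \<pi> i) = 0] (mod int p)" using cong_sym cong_trans by blast
    then show ?thesis by (simp add: sum_subtractf cong_iff_dvd_diff)
  qed
  obtain F where F: "degree F < card D" "\<And>i. [poly F i = \<pi> i] (mod int p)"
    using shift_eigenfunction_low_degree[OF p(1) D(1,2) \<pi>cong eig] by blast
  have dF: "2 * degree F + 2 \<le> p - 1" using F(1) D(3) by simp
  \<comment> \<open>The residue 0 belongs to both sets, as negation fixes it. The sizes therefore
    add up to \<open>p + 1\<close>, and one of them exceeds \<open>p / 2\<close>.\<close>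
  define A where "A = {a \<in> {0..<int p}. a \<in> U \<or> a = 0}"
  define B where "B = {a \<in> {0..<int p}. a \<notin> U}"
  have zero: "[poly F i = c * i] (mod int p)"
    if "c \<in> {1, -1}" "S \<subseteq> {0..<int p}" "card S * 2 > p" "\<And>a. a \<in> S \<Longrightarrow> \<pi> a = c * a" for c S i
  proof -
    have "[:int p:] dvd F - [:0,c:]"
    proof (rule const_dvd_poly_if_many_roots[OF p(1) that(2)])
      have "degree (F - [:0,c:]) \<le> max (degree F) 1"
        by (rule order.trans[OF degree_diff_le_max]) auto
      also have "\<dots> < card S" using dF that(3) p1 by simp
      finally show "degree (F - [:0,c:]) < card S" .
      fix a assume "a \<in> S"
      then have "[poly F a = c * a] (mod int p)" using F(2)[of a] that(4)[of a] by simp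
      then show "int p dvd poly (F - [:0,c:]) a" by (simp add: cong_iff_dvd_diff mult.commute)
    qed
    then obtain G where "F - [:0,c:] = [:int p:] * G" by blast
    then have "poly (F - [:0,c:]) i = int p * poly G i" by simp
    then show ?thesis by (simp add: cong_iff_dvd_diff mult.commute)
  qed
  have "card A + card B = p + 1"
  proof -
    have "finite A" "finite B"
      by (rule finite_subset[of _ "{0..<int p}"]; auto simp: A_def B_def)+
    then have "card A + card B = card (A \<union> B) + card (A \<inter> B)" by (rule card_Un_Int)
    also have "A \<union> B = {0..<int p}" by (auto simp: A_def B_def)
    also have "A \<inter> B = {0}" using U(3) p1 by (auto simp: A_def B_def)
    finally show ?thesis by simp
  qed
  then consider "card A * 2 > p" | "card B * 2 > p" by linarith
  then show False
  proof cases
    case 1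
    have "[poly F w = -1 * w] (mod int p)"
      by (rule zero[OF _ _ 1]) (auto simp: A_def \<pi>_def)
    moreover have "[poly F w = w] (mod int p)" using F(2)[of w] w by (simp add: \<pi>_def)
    ultimately have "[w = -1 * w] (mod int p)" using cong_sym cong_trans by blast
    then have "int p dvd 2 * w" by (simp add: cong_iff_dvd_diff)
    then show False using w(2) p(1) p1 zdvd_not_zless[of 2 "int p"] by (simp add: prime_dvd_mult_iff)
  next
    case 2
    have "[poly F u = 1 * u] (mod int p)"
      by (rule zero[OF _ _ 2]) (auto simp: B_def \<pi>_def)
    then have "[u = poly F u] (mod int p)" by (simp add: cong_sym)
    moreover have "[poly F u = - u] (mod int p)" using F(2)[of u] u by (simp add: \<pi>_def)
    ultimately have "[u = - u] (mod int p)" by (rule cong_trans)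
    then have "int p dvd 2 * u" by (simp add: cong_iff_dvd_diff)
    then show False using notU[OF u] p(1) p1 zdvd_not_zless[of 2 "int p"] by (simp add: prime_dvd_mult_iff)
  qed
qed

section \<open>Local inverses and fibres of complex polynomials\<close>

text \<open>The radius \<open>e\<close> confines the values of the inverse, so that different
  branches stay apart; the clause with \<open>\<eta>\<close> is the other direction and allows a
  given root near \<open>z0\<close> to be recognized as a value of \<open>h\<close>.\<close>

lemma holomorphic_local_inverse:
  assumes holf: "f holomorphic_on S" and S: "open S" "z0 \<in> S"
    and d: "deriv f z0 \<noteq> 0" and e: "e > 0"
  obtains \<delta> \<eta> h where "\<delta> > 0" "h holomorphic_on ball (f z0) \<delta>" "h (f z0) = z0"
    "\<And>t. t \<in> ball (f z0) \<delta> \<Longrightarrow> h t \<in> S \<inter> ball z0 e \<and> f (h t) = t"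
    "\<eta> > 0" "\<And>z. z \<in> ball z0 \<eta> \<Longrightarrow> f z \<in> ball (f z0) \<delta> \<and> h (f z) = z"
proof -
  have holf': "f holomorphic_on (S \<inter> ball z0 e)" using holf holomorphic_on_subset by blast
  obtain r where r: "r > 0" "ball z0 r \<subseteq> S \<inter> ball z0 e" "open (f ` ball z0 r)" "inj_on f (ball z0 r)"
    by (rule has_complex_derivative_locally_invertible[OF holf' _ _ d]) (use S e in auto)
  have holr: "f holomorphic_on ball z0 r" using holf' r(2) holomorphic_on_subset by blast
  obtain h where h: "h holomorphic_on f ` ball z0 r" "\<And>z. z \<in> ball z0 r \<Longrightarrow> h (f z) = z"
    using holomorphic_has_inverse[OF holr open_ball r(4)] by metis
  have "f z0 \<in> f ` ball z0 r" using r(1) by auto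
  then obtain \<delta> where \<delta>: "\<delta> > 0" "ball (f z0) \<delta> \<subseteq> f ` ball z0 r"
    using r(3) openE by blast
  have "continuous_on S f" using holf by (rule holomorphic_on_imp_continuous_on)
  then have "isCont f z0" using S continuous_on_eq_continuous_at by blast
  then obtain \<eta> where \<eta>: "\<eta> > 0" "\<And>z. dist z z0 < \<eta> \<Longrightarrow> dist (f z) (f z0) < \<delta>"
    unfolding continuous_at_eps_delta using \<delta>(1) by blast
  show thesis
  proof (rule that[of \<delta> h "min \<eta> r"])
    show "h holomorphic_on ball (f z0) \<delta>" using h(1) \<delta>(2) holomorphic_on_subset by blast
    show "h (f z0) = z0" using h(2) r(1) by auto
    fix t assume "t \<in> ball (f z0) \<delta>"
    then obtain z where "z \<in> ball z0 r" "t = f z" using \<delta>(2) by blast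
    then show "h t \<in> S \<inter> ball z0 e \<and> f (h t) = t" using h(2) r(2) by auto
  next
    fix z assume z: "z \<in> ball z0 (min \<eta> r)"
    then have "dist z z0 < \<eta>" by (auto simp: dist_commute)
    from \<eta>(2)[OF this] have "f z \<in> ball (f z0) \<delta>" by (simp add: dist_commute)
    moreover have "h (f z) = z" using h(2) z by auto
    ultimately show "f z \<in> ball (f z0) \<delta> \<and> h (f z) = z" ..
  qed (use \<delta> \<eta> r in auto)
qed

lemma card_roots_separable:
  fixes q :: "complex poly"
  assumes "q \<noteq> 0" and "\<And>z. poly q z = 0 \<Longrightarrow> poly (pderiv q) z \<noteq> 0"
  shows "card {z. poly q z = 0} = degree q"
proof -
  have "rsquarefree q" using assms(2) by (auto simp: rsquarefree_roots)
  then have "smult (lead_coeff q) (\<Prod>z|poly q z = 0. [:-z, 1:]) = q"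
    by (rule complex_poly_decompose_rsquarefree)
  then have "degree q = degree (\<Prod>z|poly q z = 0. [:-z, 1:])"
    using assms(1) by (metis degree_smult_eq leading_coeff_0_iff)
  also have "\<dots> = card {z. poly q z = 0}"
    by (subst degree_prod_sum_eq) auto
  finally show ?thesis ..
qed

lemma constant_on_if_integer_valued:
  fixes g :: "'a::topological_space \<Rightarrow> real"
  assumes "connected S" "continuous_on S g" "\<And>x. x \<in> S \<Longrightarrow> g x \<in> \<int>"
  shows "g constant_on S"
proof (rule continuous_discrete_range_constant[OF assms(1,2)])
  fix x assume x: "x \<in> S"
  have "1 \<le> norm (g y - g x)" if y: "y \<in> S" "g y \<noteq> g x" for y
  proof -
    obtain k l where "g x = of_int k" "g y = of_int l" using assms(3) x y(1) by (metis Ints_cases)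
    then show ?thesis using y(2) by (auto simp flip: of_int_diff of_int_abs)
  qed
  then show "\<exists>e>0. \<forall>y. y \<in> S \<and> g y \<noteq> g x \<longrightarrow> e \<le> norm (g y - g x)"
    by (intro exI[of _ 1]) auto
qed

section \<open>Labels for the roots of F = t in the upper half plane\<close>

locale real_rooted =
  fixes p :: nat and c :: "nat \<Rightarrow> real"
  assumes odd_p: "odd p" and p_ge: "p \<ge> 3"
    and dec: "\<And>i j. i < j \<Longrightarrow> j < p \<Longrightarrow> c j < c i"
begin

definition F :: "complex poly" where "F = (\<Prod>j<p. [:- of_real (c j), 1:])"
definition Fr :: "real poly" where "Fr = (\<Prod>j<p. [:- c j, 1:])"

lemma poly_F: "poly F z = (\<Prod>j<p. z - of_real (c j))"
  by (simp add: F_def poly_prod)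

lemma poly_Fr: "poly Fr x = (\<Prod>j<p. x - c j)"
  by (simp add: Fr_def poly_prod)

lemma poly_F_of_real: "poly F (of_real x) = of_real (poly Fr x)"
  by (simp add: poly_F poly_Fr)

lemma poly_F_cnj: "poly F (cnj z) = cnj (poly F z)"
  by (simp add: poly_F)

lemma degree_F: "degree F = p"
  unfolding F_def by (subst degree_prod_sum_eq) auto

lemma lead_coeff_F: "lead_coeff F = 1"
  unfolding F_def by (simp add: lead_coeff_prod)

lemma poly_pderiv_F: "poly (pderiv F) z = (\<Sum>j<p. \<Prod>i\<in>{..<p}-{j}. z - of_real (c i))"
  by (simp add: F_def pderiv_prod poly_sum poly_prod pderiv_pCons)

lemma poly_pderiv_Fr: "poly (pderiv Fr) x = (\<Sum>j<p. \<Prod>i\<in>{..<p}-{j}. x - c i)"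
  by (simp add: Fr_def pderiv_prod poly_sum poly_prod pderiv_pCons)

lemma poly_pderiv_F_of_real: "poly (pderiv F) (of_real x) = of_real (poly (pderiv Fr) x)"
  by (simp add: poly_pderiv_F poly_pderiv_Fr)

lemma p_pos: "0 < p" "{..<p} \<noteq> {}"
  using p_ge by (auto simp: lessThan_empty_iff)

lemma poly_F_nonreal: assumes "Im z \<noteq> 0" shows "poly F z \<noteq> 0"
proof
  assume "poly F z = 0"
  then obtain j where "z = of_real (c j)" by (auto simp: poly_F)
  then show False using assms by simp
qed

lemma nonreal_if_F_nonreal: "Im (poly F z) \<noteq> 0 \<Longrightarrow> Im z \<noteq> 0"
  using poly_F_of_real[of "Re z"] by (metis Im_complex_of_real complex_is_Real_iff of_real_Re)

lemma pderiv_F_log_deriv: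
  assumes "\<And>j. j < p \<Longrightarrow> z \<noteq> of_real (c j)"
  shows "poly (pderiv F) z = poly F z * (\<Sum>j<p. 1 / (z - of_real (c j)))"
proof -
  have "(\<Prod>i\<in>{..<p}-{j}. z - of_real (c i)) = poly F z * (1 / (z - of_real (c j)))" if "j < p" for j
    using assms[OF that] that by (simp add: poly_F prod.remove[of "{..<p}" j] field_simps)
  then show ?thesis by (simp add: poly_pderiv_F sum_distrib_left)
qed

text \<open>Each 1 / (z - c) with real c lies in the lower half plane. This yields both that F has
  no critical point off the real line (Gauss-Lucas) and that log F is injective above it.\<close>

lemma Im_log_deriv_neg:
  assumes "Im z > 0" shows "Im (\<Sum>j<p. 1 / (z - of_real (c j))) < 0"
proof -
  have "Im (1 / (z - of_real (c j))) < 0" for j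
  proof -
    have "z - of_real (c j) \<noteq> 0" using assms by (auto simp: complex_eq_iff)
    then have "(Re z - c j)\<^sup>2 + (Im z)\<^sup>2 > 0" using assms by (simp add: sum_power2_gt_zero_iff)
    then show ?thesis using assms by (simp add: Im_divide power2_eq_square divide_neg_pos)
  qed
  then have "(\<Sum>j<p. Im (1 / (z - of_real (c j)))) < (\<Sum>j<p. 0)"
    using p_pos by (intro sum_strict_mono) auto
  then show ?thesis by simp
qed

lemma pderiv_F_nonreal: assumes "Im z \<noteq> 0" shows "poly (pderiv F) z \<noteq> 0"
proof -
  have main: "poly (pderiv F) z \<noteq> 0" if "Im z > 0" for z
  proof -
    have "z \<noteq> of_real (c j)" for j using that by (auto simp: complex_eq_iff)
    then have "poly (pderiv F) z = poly F z * (\<Sum>j<p. 1 / (z - of_real (c j)))"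
      by (intro pderiv_F_log_deriv)
    moreover have "(\<Sum>j<p. 1 / (z - of_real (c j))) \<noteq> 0" using Im_log_deriv_neg[OF that] by (metis less_irrefl zero_complex.simps(2))
    moreover have "poly F z \<noteq> 0" using that by (intro poly_F_nonreal) simp
    ultimately show ?thesis by (metis mult_eq_0_iff)
  qed
  have "poly (pderiv F) (cnj z) = cnj (poly (pderiv F) z)" by (simp add: poly_pderiv_F)
  then show ?thesis using main[of z] main[of "cnj z"] assms by (cases "Im z > 0") auto
qed

text \<open>A branch of log F on the upper half plane. Its imaginary part \<open>AS\<close> is an
  argument of F not reduced modulo 2 pi: it ranges over (0, p pi), and this extra information
  separates the roots.\<close>

definition L :: "complex \<Rightarrow> complex" where "L z = (\<Sum>j<p. Ln (z - of_real (c j)))"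

definition AS :: "complex \<Rightarrow> real" where "AS z = (\<Sum>j<p. Arg (z - of_real (c j)))"

lemma exp_L: "Im z > 0 \<Longrightarrow> exp (L z) = poly F z"
proof -
  assume "Im z > 0"
  then have "exp (Ln (z - of_real (c j))) = z - of_real (c j)" for j
    by (intro exp_Ln) (auto simp: complex_eq_iff)
  then show ?thesis by (simp add: L_def exp_sum poly_F)
qed

lemma Im_L: "Im z > 0 \<Longrightarrow> Im (L z) = AS z"
proof -
  assume "Im z > 0"
  then have "Arg (z - of_real (c j)) = Im (Ln (z - of_real (c j)))" for j
    by (intro Arg_eq_Im_Ln) (auto simp: complex_eq_iff)
  then show ?thesis by (simp add: L_def AS_def)
qed

lemma AS_bounds: assumes "Im z > 0" shows "0 < AS z" "AS z < p * pi"
proof -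
  have A: "0 < Arg (z - of_real (c j)) \<and> Arg (z - of_real (c j)) < pi" for j
    using assms by (subst Arg_lt_pi) simp
  have "(\<Sum>j<p. 0) < AS z" unfolding AS_def by (rule sum_strict_mono) (use A p_pos in auto)
  moreover have "AS z < (\<Sum>j<p. pi)" unfolding AS_def by (rule sum_strict_mono) (use A p_pos in auto)
  ultimately show "0 < AS z" "AS z < p * pi" by auto
qed

lemma DERIV_L:
  assumes "Im z > 0"
  shows "(L has_field_derivative (\<Sum>j<p. 1 / (z - of_real (c j)))) (at z)"
proof -
  have "z - of_real (c j) \<notin> \<real>\<^sub>\<le>\<^sub>0" for j
    using assms by (auto simp: complex_nonpos_Reals_iff)
  then have "((\<lambda>z. Ln (z - of_real (c j))) has_field_derivative 1 / (z - of_real (c j))) (at z)" for j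
    by (auto intro!: derivative_eq_intros simp: divide_simps)
  then show ?thesis unfolding L_def[abs_def] by (intro DERIV_sum)
qed

text \<open>The derivative of L has negative imaginary part on the convex upper half plane,
  so L is injective there (the Noshiro--Warschawski argument).\<close>

lemma L_inj:
  assumes z: "Im z1 > 0" "Im z2 > 0" and eq: "L z1 = L z2"
  shows "z1 = z2"
proof (rule ccontr)
  assume ne: "z1 \<noteq> z2"
  define w where "w = z1 - z2"
  have w: "w \<noteq> 0" using ne by (simp add: w_def)
  define \<gamma> where "\<gamma> u = z2 + of_real u * w" for u :: real
  define \<phi> where "\<phi> u = Im (L (\<gamma> u) / w)" for u
  have "\<phi> 1 < \<phi> 0"
  proof (rule DERIV_neg_imp_decreasing[of 0 1 \<phi>])
    fix u :: real assume u: "0 \<le> u" "u \<le> 1"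
    have "Im (\<gamma> u) = (1 - u) * Im z2 + u * Im z1" by (simp add: \<gamma>_def w_def algebra_simps)
    moreover have "\<dots> > 0"
    proof (cases "u = 0")
      case False
      then have "u * Im z1 > 0" "(1 - u) * Im z2 \<ge> 0" using u z by auto
      then show ?thesis by linarith
    qed (use z in simp)
    ultimately have Im: "Im (\<gamma> u) > 0" by simp
    define D where "D = (\<Sum>j<p. 1 / (\<gamma> u - of_real (c j)))"
    have "(\<gamma> has_vector_derivative w) (at u)"
      unfolding \<gamma>_def[abs_def] by (auto intro!: derivative_eq_intros)
    from field_vector_diff_chain_at[OF this DERIV_L[OF Im]]
    have "((\<lambda>u. L (\<gamma> u)) has_vector_derivative w * D) (at u)" by (simp add: o_def D_def)
    then have "((\<lambda>u. L (\<gamma> u) / w) has_vector_derivative w * D / w) (at u)"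
      by (rule has_vector_derivative_divide)
    then have "(\<phi> has_vector_derivative Im (w * D / w)) (at u)"
      unfolding \<phi>_def[abs_def] by (rule bounded_linear.has_vector_derivative[OF bounded_linear_Im])
    then have "(\<phi> has_real_derivative Im D) (at u)"
      using w by (simp add: has_real_derivative_iff_has_vector_derivative)
    moreover have "Im D < 0" unfolding D_def by (rule Im_log_deriv_neg[OF Im])
    ultimately show "\<exists>y. (\<phi> has_real_derivative y) (at u) \<and> y < 0" by blast
  qed simp
  moreover have "\<phi> 1 = \<phi> 0" using eq by (simp add: \<phi>_def \<gamma>_def w_def)
  ultimately show False by simp
qed

lemma F_AS_inj:
  assumes z: "Im z1 > 0" "Im z2 > 0" and eq: "poly F z1 = poly F z2" "AS z1 = AS z2"
  shows "z1 = z2"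
proof (rule L_inj[OF z])
  have "exp (L z1) = exp (L z2)" using eq z by (simp add: exp_L)
  then obtain n :: int where n: "L z1 = L z2 + (of_int (2 * n) * pi) * \<i>" by (auto simp: exp_eq)
  then have "Im (L z1) = Im (L z2) + of_int (2 * n) * pi" by simp
  then have "n = 0" using eq z by (simp add: Im_L)
  then show "L z1 = L z2" using n by simp
qed

lemma AS_int:
  assumes "Im z > 0"
  obtains m :: int where "AS z = Arg (poly F z) + 2 * pi * m"
proof -
  have nz: "poly F z \<noteq> 0" using assms by (intro poly_F_nonreal) simp
  then have "exp (L z) = exp (Ln (poly F z))" using assms by (simp add: exp_L)
  then obtain n :: int where n: "L z = Ln (poly F z) + (of_int (2 * n) * pi) * \<i>" by (auto simp: exp_eq)
  then have "Im (L z) = Im (Ln (poly F z)) + of_int (2 * n) * pi" by simp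
  then show thesis using that[of n] assms nz by (simp add: Im_L Arg_eq_Im_Ln)
qed

text \<open>For t in the upper half plane, lab t z numbers the roots z of F = t by the branch of the
  argument of F that they lie on. Roots in the lower half plane are treated through their conjugates
  and receive the negative labels.\<close>

definition lab :: "complex \<Rightarrow> complex \<Rightarrow> real" where
  "lab t z = (if Im z > 0 then (AS z - Arg t) / (2 * pi) else - (AS (cnj z) + Arg t) / (2 * pi))"

definition h :: int where "h = (int p - 1) div 2"

lemma p_eq: "int p = 2 * h + 1" using odd_p by (auto simp: h_def elim: oddE)

text \<open>Above the axis, \<open>AS z = Arg t + 2 * pi * m\<close> with \<open>AS z\<close>
  between 0 and p pi leaves 0 \<le> m \<le> h. Below it,
  \<open>AS (cnj z) = - Arg t + 2 * pi * m\<close> leaves 1 \<le> m \<le> h. So the sign of the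
  label records the half plane, and there are p labels in all.\<close>

lemma lab_int:
  assumes t: "Im t > 0" and z: "poly F z = t"
  obtains l where "l \<in> {-h..h}" "lab t z = of_int l" "l \<ge> 0 \<longleftrightarrow> Im z > 0"
proof -
  have A: "0 < Arg t" "Arg t < pi" using t Arg_lt_pi by auto
  have nz: "Im z \<noteq> 0" using nonreal_if_F_nonreal[of z] t z by auto
  show thesis
  proof (cases "Im z > 0")
    case True
    obtain m where m: "AS z = Arg t + 2 * pi * of_int m" by (rule AS_int[OF True, unfolded z])
    have "2 * pi * of_int m > - pi" using AS_bounds(1)[OF True] m A by linarith
    then have "pi * (- 1) < pi * (2 * of_int m)" by simp
    then have "- 1 < (2 * of_int m :: real)" using pi_gt_zero mult_less_cancel_left_pos by blast
    then have m0: "m \<ge> 0" by linarith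
    have "2 * pi * of_int m < p * pi" using AS_bounds(2)[OF True] m A by linarith
    then have "pi * of_int (2 * m) < pi * of_int (int p)" by (simp add: mult_ac)
    then have "of_int (2 * m) < (of_int (int p) :: real)" using pi_gt_zero mult_less_cancel_left_pos by blast
    then have "2 * m < int p" by linarith
    then have "m \<le> h" using p_eq by linarith
    moreover have "lab t z = of_int m" using True m by (simp add: lab_def)
    ultimately show thesis using m0 True by (intro that[of m]) auto
  next
    case False
    then have neg: "Im (cnj z) > 0" using nz by simp
    have "Arg (cnj t) = - Arg t" using t by (auto simp: Arg_cnj complex_is_Real_iff)
    then obtain m where m: "AS (cnj z) = - Arg t + 2 * pi * of_int m"
      using AS_int[OF neg, unfolded poly_F_cnj z] by auto
    have "2 * pi * of_int m > 0" using AS_bounds(1)[OF neg] m A by linarith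
    then have m0: "m > 0" by (simp add: zero_less_mult_iff)
    have "2 * pi * of_int m < (p + 1) * pi" using AS_bounds(2)[OF neg] m A by (simp add: algebra_simps)
    then have "pi * of_int (2 * m) < pi * of_int (int p + 1)" by (simp add: mult_ac)
    then have "of_int (2 * m) < (of_int (int p + 1) :: real)" using pi_gt_zero mult_less_cancel_left_pos by blast
    then have "2 * m < int p + 1" by linarith
    then have "m \<le> h" using p_eq by linarith
    moreover have "lab t z = of_int (-m)" using False m by (simp add: lab_def)
    ultimately show thesis using m0 False by (intro that[of "-m"]) auto
  qed
qed

lemma lab_inj:
  assumes t: "Im t > 0" and z: "poly F z1 = t" "poly F z2 = t" and eq: "lab t z1 = lab t z2"
  shows "z1 = z2"
proof -
  obtain l1 where l1: "lab t z1 = of_int l1" "l1 \<ge> 0 \<longleftrightarrow> Im z1 > 0" by (rule lab_int[OF t z(1)])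
  obtain l2 where l2: "lab t z2 = of_int l2" "l2 \<ge> 0 \<longleftrightarrow> Im z2 > 0" by (rule lab_int[OF t z(2)])
  have s: "Im z1 > 0 \<longleftrightarrow> Im z2 > 0" using l1 l2 eq by auto
  show ?thesis
  proof (cases "Im z1 > 0")
    case True
    have "AS z1 = AS z2" using True eq s by (simp add: lab_def)
    show ?thesis by (rule F_AS_inj) (use True s z \<open>AS z1 = AS z2\<close> in simp_all)
  next
    case False
    have "Im z1 \<noteq> 0" "Im z2 \<noteq> 0" by (rule nonreal_if_F_nonreal; use t z in simp)+
    note nz = this
    have "AS (cnj z1) = AS (cnj z2)" using eq s False by (simp add: lab_def)
    then have "cnj z1 = cnj z2"
      by (rule F_AS_inj[rotated 3]) (use nz False s z in \<open>simp_all add: poly_F_cnj\<close>)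
    then show ?thesis by simp
  qed
qed

lemma degree_F_minus_const: "degree (F - [:t:]) = p"
proof -
  have "degree (F + - [:t:]) = degree F" using degree_F p_pos by (intro degree_add_eq_left) simp
  then show ?thesis by (simp only: degree_F diff_conv_add_uminus)
qed

lemma card_fibre:
  assumes "\<And>z. poly F z = t \<Longrightarrow> poly (pderiv F) z \<noteq> 0"
  shows "card {z. poly F z = t} = p"
proof -
  define q where "q = F - [:t:]"
  have dq: "degree q = p" by (simp add: q_def degree_F_minus_const)
  have "card {z. poly q z = 0} = degree q"
  proof (rule card_roots_separable)
    show "q \<noteq> 0" using dq p_ge by auto
    show "poly (pderiv q) z \<noteq> 0" if "poly q z = 0" for z
      using assms[of z] that by (simp add: q_def pderiv_diff pderiv_pCons)
  qed
  then show ?thesis unfolding dq by (simp add: q_def)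
qed

lemma finite_fibre: "finite {z. poly F z = t}"
proof -
  have "degree (F - [:t:]) = p" by (rule degree_F_minus_const)
  then have "F - [:t:] \<noteq> 0" using p_ge by auto
  from poly_roots_finite[OF this] show ?thesis by simp
qed

text \<open>A count: the critical points are real, so F = t has p distinct roots, and they are
  mapped injectively into p labels.\<close>

lemma ex_root:
  assumes t: "Im t > 0" and l: "l \<in> {-h..h}"
  shows "\<exists>!z. poly F z = t \<and> lab t z = of_int l"
proof -
  have "card (lab t ` {z. poly F z = t}) = card {z. poly F z = t}"
  proof (rule card_image, rule inj_onI)
    fix x y assume "x \<in> {z. poly F z = t}" "y \<in> {z. poly F z = t}" "lab t x = lab t y"
    then show "x = y" by (intro lab_inj[OF t, of x y]) simp_all
  qed
  also have "\<dots> = p"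
  proof (rule card_fibre)
    fix z assume "poly F z = t"
    then have "Im z \<noteq> 0" using nonreal_if_F_nonreal[of z] t by auto
    then show "poly (pderiv F) z \<noteq> 0" by (rule pderiv_F_nonreal)
  qed
  also have "p = card (of_int ` {-h..h} :: real set)"
    using p_eq by (subst card_image) (auto simp: inj_on_def)
  finally have card: "card (lab t ` {z. poly F z = t}) = card (of_int ` {-h..h} :: real set)" .
  have "lab t ` {z. poly F z = t} \<subseteq> of_int ` {-h..h}"
  proof
    fix y assume "y \<in> lab t ` {z. poly F z = t}"
    then obtain z where z: "poly F z = t" "y = lab t z" by auto
    obtain l where "l \<in> {-h..h}" "lab t z = of_int l" by (rule lab_int[OF t z(1)])
    then show "y \<in> of_int ` {-h..h}" unfolding z(2) by (metis imageI)
  qed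
  then have "lab t ` {z. poly F z = t} = of_int ` {-h..h}"
    using card by (intro card_subset_eq) auto
  then have "of_int l \<in> lab t ` {z. poly F z = t}" using l by auto
  then obtain z where "poly F z = t" "lab t z = of_int l" by auto
  moreover have "z' = z" if "poly F z' = t \<and> lab t z' = of_int l" for z'
    by (rule lab_inj[OF t]) (simp_all add: that \<open>poly F z = t\<close> \<open>lab t z = of_int l\<close>)
  ultimately show ?thesis by blast
qed

definition X :: "complex \<Rightarrow> int \<Rightarrow> complex" where
  "X t l = (THE z. poly F z = t \<and> lab t z = of_int l)"

lemma X: assumes "Im t > 0" "l \<in> {-h..h}" shows "poly F (X t l) = t" "lab t (X t l) = of_int l"
  using theI'[OF ex_root[OF assms]] unfolding X_def by blast+

lemma X_eqI: "Im t > 0 \<Longrightarrow> l \<in> {-h..h} \<Longrightarrow> poly F z = t \<Longrightarrow> lab t z = of_int l \<Longrightarrow> X t l = z"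
  by (rule lab_inj[of t]) (simp_all only: X)

lemma X_inj: "Im t > 0 \<Longrightarrow> l \<in> {-h..h} \<Longrightarrow> m \<in> {-h..h} \<Longrightarrow> X t l = X t m \<Longrightarrow> l = m"
  using X(2)[of t l] X(2)[of t m] by (metis of_int_eq_iff)

text \<open>This takes the place of continuation along paths. A root that depends continuously on
  the parameter cannot cross the real axis while t is not real, and its label is then a continuous
  function with integer values.\<close>

lemma label_constant:
  fixes T Z :: "complex \<Rightarrow> complex"
  assumes S: "connected S" "S \<noteq> {}" and cont: "continuous_on S T" "continuous_on S Z"
    and TZ: "\<And>s. s \<in> S \<Longrightarrow> Im (T s) > 0 \<and> poly F (Z s) = T s"
  obtains l where "l \<in> {-h..h}" "\<And>s. s \<in> S \<Longrightarrow> Z s = X (T s) l"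
proof -
  have nz: "Im (Z s) \<noteq> 0" if "s \<in> S" for s using nonreal_if_F_nonreal[of "Z s"] TZ[OF that] by auto
  have "connected ((\<lambda>s. Im (Z s)) ` S)"
    by (intro connected_continuous_image S continuous_intros cont)
  then have conn: "0 \<in> (\<lambda>s. Im (Z s)) ` S" if "s1 \<in> S" "s2 \<in> S" "Im (Z s1) \<le> 0" "0 \<le> Im (Z s2)" for s1 s2
    by (rule connectedD_interval[OF _ imageI[OF that(1)] imageI[OF that(2)] that(3,4)])
  have sides: "(\<forall>s\<in>S. Im (Z s) > 0) \<or> (\<forall>s\<in>S. Im (Z s) < 0)"
  proof (rule ccontr)
    assume "\<not> ?thesis"
    then obtain s1 s2 where "s1 \<in> S" "s2 \<in> S" "Im (Z s1) \<le> 0" "0 \<le> Im (Z s2)"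
      by (auto simp: not_less)
    from conn[OF this] show False using nz by force
  qed
  have notneg: "z \<notin> \<real>\<^sub>\<le>\<^sub>0" if "Im z > 0" for z using that by (auto simp: complex_nonpos_Reals_iff)
  have "continuous_on S (\<lambda>s. lab (T s) (Z s))"
  proof (cases "\<forall>s\<in>S. Im (Z s) > 0")
    case True
    then have "continuous_on S (\<lambda>s. (AS (Z s) - Arg (T s)) / (2 * pi))" unfolding AS_def
      by (intro continuous_intros cont notneg) (use TZ in auto)
    then show ?thesis by (rule continuous_on_eq) (use True in \<open>simp add: lab_def\<close>)
  next
    case False
    then have neg: "\<And>s. s \<in> S \<Longrightarrow> Im (Z s) < 0" using sides by blast
    have nn: "\<not> Im (Z s) > 0" if "s \<in> S" for s using neg[OF that] by simp
    have "continuous_on S (\<lambda>s. - (AS (cnj (Z s)) + Arg (T s)) / (2 * pi))" unfolding AS_def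
      by (intro continuous_intros cont notneg) (use neg TZ in auto)
    then show ?thesis by (rule continuous_on_eq) (simp add: lab_def nn)
  qed
  then have "(\<lambda>s. lab (T s) (Z s)) constant_on S"
  proof (rule constant_on_if_integer_valued[OF S(1)])
    fix s assume "s \<in> S"
    then obtain l where "lab (T s) (Z s) = of_int l" using lab_int[of "T s" "Z s"] TZ[of s] by metis
    then show "lab (T s) (Z s) \<in> \<int>" by simp
  qed
  then obtain y where y: "\<And>s. s \<in> S \<Longrightarrow> lab (T s) (Z s) = y" unfolding constant_on_def by blast
  obtain s0 where s0: "s0 \<in> S" using S(2) by blast
  obtain l where l: "l \<in> {-h..h}" "lab (T s0) (Z s0) = of_int l"
    using lab_int[of "T s0" "Z s0"] TZ[OF s0] by metis
  show thesis
  proof (rule that[OF l(1)])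
    fix s assume "s \<in> S"
    then have "lab (T s) (Z s) = of_int l" using y[of s] y[OF s0] l(2) by simp
    with X_eqI[of "T s" l "Z s"] TZ[OF \<open>s \<in> S\<close>] l(1) show "Z s = X (T s) l" by simp
  qed
qed

lemma deriv_poly: "deriv (poly q) z = poly (pderiv q) z" for q :: "complex poly"
  by (rule DERIV_imp_deriv) (rule poly_DERIV)

lemma holomorphic_poly: "poly q holomorphic_on S" for q :: "complex poly"
  by (intro holomorphic_intros)

lemma X_holomorphic:
  assumes l: "l \<in> {-h..h}"
  shows "(\<lambda>t. X t l) holomorphic_on {t. Im t > 0}"
proof -
  have "(\<lambda>t. X t l) analytic_on {t. Im t > 0}" unfolding analytic_on_def
  proof
    fix t0 assume "t0 \<in> {t. Im t > 0}"
    then have t0: "Im t0 > 0" by simp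
    define z0 where "z0 = X t0 l"
    have z0: "poly F z0 = t0" using X(1)[OF t0 l] by (simp add: z0_def)
    then have "Im z0 \<noteq> 0" using nonreal_if_F_nonreal[of z0] t0 by auto
    then have "deriv (poly F) z0 \<noteq> 0" by (simp add: deriv_poly pderiv_F_nonreal)
    from holomorphic_local_inverse[OF holomorphic_poly open_UNIV UNIV_I this zero_less_one]
    obtain \<delta> g where g: "\<delta> > 0" "g holomorphic_on ball t0 \<delta>" "g t0 = z0"
      "\<And>t. t \<in> ball t0 \<delta> \<Longrightarrow> poly F (g t) = t" unfolding z0 by metis
    have "open {t. Im t > 0}" by (simp add: open_halfspace_Im_gt)
    then obtain r where r: "r > 0" "ball t0 r \<subseteq> {t. Im t > 0}" using t0 openE by blast
    define B where "B = ball t0 (min \<delta> r)"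
    have BH: "B \<subseteq> {t. Im t > 0}" "B \<subseteq> ball t0 \<delta>" using r(2) by (auto simp: B_def)
    have t0B: "t0 \<in> B" using g(1) r(1) by (simp add: B_def)
    have gB: "g holomorphic_on B" using g(2) BH(2) holomorphic_on_subset by blast
    obtain m where m: "m \<in> {-h..h}" "\<And>t. t \<in> B \<Longrightarrow> g t = X t m"
    proof (rule label_constant[of B "\<lambda>t. t" g])
      show "connected B" by (simp add: B_def)
      show "continuous_on B g" using gB by (rule holomorphic_on_imp_continuous_on)
    qed (use t0B BH g(4) in auto)
    have "m = l" by (rule X_inj[OF t0 m(1) l]) (use m(2)[OF t0B] g(3) in \<open>simp add: z0_def\<close>)
    have "(\<lambda>t. X t l) holomorphic_on B"
      by (rule holomorphic_transform[OF gB]) (use m(2) \<open>m = l\<close> in simp)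
    moreover have "min \<delta> r > 0" using g(1) r(1) by simp
    ultimately show "\<exists>e>0. (\<lambda>t. X t l) holomorphic_on ball t0 e" unfolding B_def by blast
  qed
  then show ?thesis by (rule analytic_imp_holomorphic)
qed

end

section \<open>Critical points and the labels near them\<close>

lemma Arg_near_real:
  fixes r e :: real
  assumes "r \<noteq> 0" "e > 0"
  shows "eventually (\<lambda>w. Im w > 0 \<longrightarrow> \<bar>Arg w - (if r < 0 then pi else 0)\<bar> < e) (nhds (of_real r))"
proof -
  have pos: "eventually (\<lambda>w. \<bar>Arg w\<bar> < e) (nhds (of_real x))" if "x > 0" for x
  proof -
    have "of_real x \<notin> \<real>\<^sub>\<le>\<^sub>0" using that by simp
    then have "isCont Arg (of_real x)" by (rule continuous_at_Arg)
    then have "(Arg \<longlongrightarrow> Arg (of_real x)) (nhds (of_real x))"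
      unfolding continuous_at tendsto_at_iff_tendsto_nhds .
    from tendstoD[OF this assms(2)] show ?thesis using that by (simp add: dist_real_def)
  qed
  show ?thesis
  proof (cases "r < 0")
    case False
    then have "eventually (\<lambda>w. \<bar>Arg w\<bar> < e) (nhds (of_real r))" using assms by (intro pos) simp
    then show ?thesis by (rule eventually_mono) (use False in simp)
  next
    case True
    \<comment> \<open>\<open>Arg\<close> jumps across the negative axis. The point
      \<open>- w\<close> approaches the positive axis from below, where \<open>Arg\<close> is
      continuous, and differs from \<open>w\<close> by the argument pi.\<close>
    have "((\<lambda>w. - w) \<longlongrightarrow> - of_real r) (nhds (of_real r :: complex))"
      by (intro tendsto_intros filterlim_ident)
    moreover have "eventually (\<lambda>w. \<bar>Arg w\<bar> < e) (nhds (- of_real r))"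
      using pos[of "- r"] True by simp
    ultimately have "eventually (\<lambda>w. \<bar>Arg (- w)\<bar> < e) (nhds (of_real r :: complex))"
      by (rule eventually_compose_filterlim[rotated])
    then show ?thesis
    proof (rule eventually_mono, intro impI)
      fix w :: complex assume w: "\<bar>Arg (- w)\<bar> < e" "Im w > 0"
      then have "Arg (- w) < 0" by (simp add: Arg_neg_iff)
      then have "Arg w = Arg (- w) + pi" using Arg_minus[of "- w"] w by fastforce
      then show "\<bar>Arg w - (if r < 0 then pi else 0)\<bar> < e" using w True by simp
    qed
  qed
qed

lemma pderiv_linear_mult: "pderiv ([:-x,1:] * q) = q + [:-x,1:] * pderiv q" for q :: "'a::idom poly"
  by (subst pderiv_mult) (simp add: pderiv_pCons)

context real_rooted
begin

lemma c_mono: "i \<le> j \<Longrightarrow> j < p \<Longrightarrow> c j \<le> c i"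
  using dec[of i j] by (cases "i = j") auto

text \<open>The roots \<open>c\<close> decrease, so exactly k of them lie to the right of
  \<open>\<xi> k\<close>. This makes k the number of the branch: the argument of F, continued
  through the upper half plane, is k pi there.\<close>

definition \<xi> :: "nat \<Rightarrow> real" where
  "\<xi> k = (SOME x. c k < x \<and> x < c (k - 1) \<and> poly (pderiv Fr) x = 0)"

lemma xi:
  assumes "k \<in> {1..<p}"
  shows "c k < \<xi> k" "\<xi> k < c (k - 1)" "poly (pderiv Fr) (\<xi> k) = 0"
proof -
  have lt: "c k < c (k - 1)" using assms by (intro dec) auto
  have "poly Fr (c k) = 0" "poly Fr (c (k - 1)) = 0" using assms by (auto simp: poly_Fr)
  then have "\<exists>x. c k < x \<and> x < c (k - 1) \<and> poly (pderiv Fr) x = 0"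
    using poly_MVT[OF lt, of Fr] lt by auto
  from someI_ex[OF this] show "c k < \<xi> k" "\<xi> k < c (k - 1)" "poly (pderiv Fr) (\<xi> k) = 0"
    unfolding \<xi>_def by auto
qed

lemma xi_dec: assumes "1 \<le> i" "i < j" "j < p" shows "\<xi> j < \<xi> i"
proof -
  have "\<xi> j < c (j - 1)" using assms by (intro xi) auto
  also have "\<dots> \<le> c i" using assms by (intro c_mono) auto
  also have "\<dots> < \<xi> i" using assms by (intro xi) auto
  finally show ?thesis .
qed

lemma inj_xi: "inj_on \<xi> {1..<p}"
proof (rule inj_onI)
  fix i j assume "i \<in> {1..<p}" "j \<in> {1..<p}" "\<xi> i = \<xi> j"
  then show "i = j" using xi_dec[of i j] xi_dec[of j i] by (cases i j rule: linorder_cases) auto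
qed

text \<open>Rolle's theorem supplies one zero in each gap, which is already as many as the degree of
  the derivative; so these are all critical points and they are simple.\<close>

lemma pderiv_F_eq: "pderiv F = smult (of_nat p) (\<Prod>k\<in>{1..<p}. [:- of_real (\<xi> k), 1:])"
proof -
  define Q where "Q = (\<Prod>k\<in>{1..<p}. [:- of_real (\<xi> k), 1::complex:])"
  have dQ: "degree Q = p - 1" unfolding Q_def by (subst degree_prod_sum_eq) auto
  have "pderiv F = smult (of_nat p) Q"
  proof (rule poly_eqI_degree_lead_coeff[where n = "p - 1" and A = "(\<lambda>k. of_real (\<xi> k)) ` {1..<p}"])
    have "lead_coeff Q = 1" unfolding Q_def by (simp add: lead_coeff_prod)
    then have "poly.coeff (smult (of_nat p) Q) (p - 1) = of_nat p" by (simp add: dQ)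
    moreover have "poly.coeff (pderiv F) (p - 1) = of_nat p"
      using lead_coeff_F p_pos by (simp add: coeff_pderiv degree_F)
    ultimately show "poly.coeff (pderiv F) (p - 1) = poly.coeff (smult (of_nat p) Q) (p - 1)" by simp
    show "degree (smult (of_nat p) Q) \<le> p - 1" using dQ by (metis degree_smult_le)
    have "inj_on (\<lambda>k. complex_of_real (\<xi> k)) {1..<p}" using inj_xi by (auto simp: inj_on_def)
    then show "p - 1 \<le> card ((\<lambda>k. complex_of_real (\<xi> k)) ` {1..<p})" by (simp add: card_image)
    show "degree (pderiv F) \<le> p - 1" by (simp add: degree_pderiv degree_F)
    fix z assume "z \<in> (\<lambda>k. complex_of_real (\<xi> k)) ` {1..<p}"
    then obtain k where k: "k \<in> {1..<p}" "z = of_real (\<xi> k)" by blast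
    then have "poly (pderiv F) z = 0" by (simp add: poly_pderiv_F_of_real xi(3))
    moreover have "poly Q z = 0" unfolding Q_def poly_prod using k by (intro prod_zero bexI[of _ k]) auto
    ultimately show "poly (pderiv F) z = poly (smult (of_nat p) Q) z" by simp
  qed
  then show ?thesis by (simp add: Q_def)
qed

lemma critical_iff: "poly (pderiv F) z = 0 \<longleftrightarrow> (\<exists>k\<in>{1..<p}. z = of_real (\<xi> k))"
  using p_pos by (auto simp: pderiv_F_eq poly_prod)

definition cv :: "nat \<Rightarrow> real" where "cv k = poly Fr (\<xi> k)"

lemma cv_sgn:
  assumes "k \<in> {1..<p}"
  shows "even k \<Longrightarrow> cv k > 0" "odd k \<Longrightarrow> cv k < 0"
proof -
  have "{..<p} = {..<k} \<union> {k..<p}" using assms by auto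
  then have "cv k = (\<Prod>j<k. \<xi> k - c j) * (\<Prod>j\<in>{k..<p}. \<xi> k - c j)"
    unfolding cv_def poly_Fr by (simp add: prod.union_disjoint ivl_disj_int)
  also have "(\<Prod>j<k. \<xi> k - c j) = (\<Prod>j<k. (-1) * (c j - \<xi> k))" by simp
  also have "\<dots> = (-1) ^ k * (\<Prod>j<k. c j - \<xi> k)" by (simp only: prod.distrib) simp
  finally have eq: "cv k = (-1) ^ k * ((\<Prod>j<k. c j - \<xi> k) * (\<Prod>j\<in>{k..<p}. \<xi> k - c j))" by simp
  have "(\<Prod>j<k. c j - \<xi> k) > 0"
  proof (rule prod_pos)
    fix j assume "j \<in> {..<k}"
    then have "c (k - 1) \<le> c j" using assms by (intro c_mono) auto
    then show "0 < c j - \<xi> k" using xi(2)[OF assms] by simp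
  qed
  moreover have "(\<Prod>j\<in>{k..<p}. \<xi> k - c j) > 0"
  proof (rule prod_pos)
    fix j assume "j \<in> {k..<p}"
    then have "c j \<le> c k" by (intro c_mono) auto
    then show "0 < \<xi> k - c j" using xi(1)[OF assms] by simp
  qed
  ultimately have "(\<Prod>j<k. c j - \<xi> k) * (\<Prod>j\<in>{k..<p}. \<xi> k - c j) > 0" by simp
  then show "even k \<Longrightarrow> cv k > 0" "odd k \<Longrightarrow> cv k < 0" by (simp_all add: eq)
qed

text \<open>Of the p summands, the k belonging to roots on the right are near pi and the others near
  0; each is allowed an error of 1 / p.\<close>

lemma AS_near:
  assumes k: "k \<in> {1..<p}"
  shows "eventually (\<lambda>z. Im z > 0 \<longrightarrow> \<bar>AS z - k * pi\<bar> < 1) (nhds (of_real (\<xi> k)))"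
proof -
  have "eventually (\<lambda>z. Im z > 0 \<longrightarrow> \<bar>Arg (z - of_real (c j)) - (if j < k then pi else 0)\<bar> < 1 / p) (nhds (of_real (\<xi> k)))"
    if j: "j < p" for j
  proof -
    have sg: "\<xi> k - c j \<noteq> 0 \<and> (\<xi> k - c j < 0 \<longleftrightarrow> j < k)"
    proof (cases "j < k")
      case True
      then have "c (k - 1) \<le> c j" using k by (intro c_mono) auto
      then show ?thesis using True xi(2)[OF k] by simp
    next
      case False
      then have "c j \<le> c k" using j by (intro c_mono) auto
      then show ?thesis using False xi(1)[OF k] by simp
    qed
    have "((\<lambda>z. z - of_real (c j)) \<longlongrightarrow> of_real (\<xi> k) - of_real (c j)) (nhds (of_real (\<xi> k) :: complex))"
      by (intro tendsto_intros filterlim_ident)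
    then have "((\<lambda>z. z - of_real (c j)) \<longlongrightarrow> of_real (\<xi> k - c j)) (nhds (of_real (\<xi> k) :: complex))" by simp
    from eventually_compose_filterlim[OF Arg_near_real[of "\<xi> k - c j" "1 / p"] this]
    show ?thesis using sg p_pos by simp
  qed
  then have "eventually (\<lambda>z. \<forall>j\<in>{..<p}. Im z > 0 \<longrightarrow> \<bar>Arg (z - of_real (c j)) - (if j < k then pi else 0)\<bar> < 1 / p) (nhds (of_real (\<xi> k)))"
    by (intro eventually_ball_finite) auto
  then show ?thesis
  proof (rule eventually_mono, intro impI)
    fix z assume z: "\<forall>j\<in>{..<p}. Im z > 0 \<longrightarrow> \<bar>Arg (z - of_real (c j)) - (if j < k then pi else 0)\<bar> < 1 / p" "Im z > 0"
    have "(\<Sum>j<p. (if j < k then pi else 0)) = (\<Sum>j<k. pi)"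
      using k by (intro sum.mono_neutral_cong_right) auto
    then have "AS z - k * pi = (\<Sum>j<p. Arg (z - of_real (c j)) - (if j < k then pi else 0))"
      by (simp add: AS_def sum_subtractf)
    then have "\<bar>AS z - k * pi\<bar> \<le> (\<Sum>j<p. \<bar>Arg (z - of_real (c j)) - (if j < k then pi else 0)\<bar>)"
      by (simp only: sum_abs)
    also have "\<dots> < (\<Sum>j<p. 1 / p)" using z p_pos by (intro sum_strict_mono) auto
    also have "\<dots> = 1" using p_pos by simp
    finally show "\<bar>AS z - k * pi\<bar> < 1" .
  qed
qed

text \<open>\<open>AS\<close> is near k pi, and \<open>Arg (poly F z)\<close> is near 0 or pi with
  the sign of \<open>cv k\<close>, that is near \<open>(k mod 2) * pi\<close>. Hence
  \<open>2 * l = k - k mod 2\<close> above the axis. Below it \<open>lab\<close> adds the two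
  arguments and changes the sign, so that \<open>2 * l = - k - k mod 2\<close>.\<close>

lemma lab_near:
  assumes k: "k \<in> {1..<p}"
  shows "\<exists>\<epsilon>>0. \<forall>z l. z \<in> ball (of_real (\<xi> k)) \<epsilon> \<longrightarrow> Im (poly F z) > 0 \<longrightarrow> lab (poly F z) z = of_int l \<longrightarrow>
    2 * l + int (k mod 2) = (if Im z > 0 then int k else - int k)"
proof -
  define x where "x = complex_of_real (\<xi> k)"
  have "cv k \<noteq> 0" "cv k < 0 \<longleftrightarrow> odd k" using cv_sgn[OF k] by (cases "even k"; auto)+
  then have \<kappa>: "(if cv k < 0 then pi else 0) = (k mod 2) * pi" by (auto simp: odd_iff_mod_2_eq_one)
  have "(poly F \<longlongrightarrow> poly F x) (nhds x)"
    by (subst tendsto_at_iff_tendsto_nhds[symmetric], subst isCont_def[symmetric]) simp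
  moreover have "poly F x = of_real (cv k)" by (simp add: x_def poly_F_of_real cv_def)
  ultimately have "eventually (\<lambda>z. Im (poly F z) > 0 \<longrightarrow> \<bar>Arg (poly F z) - (k mod 2) * pi\<bar> < 1) (nhds x)"
    using eventually_compose_filterlim[OF Arg_near_real[OF \<open>cv k \<noteq> 0\<close> zero_less_one], of "poly F" "nhds x"]
    by (simp add: \<kappa>)
  moreover note AS_near[OF k, folded x_def]
  moreover have "eventually (\<lambda>z. Im (cnj z) > 0 \<longrightarrow> \<bar>AS (cnj z) - k * pi\<bar> < 1) (nhds x)"
  proof -
    have "(cnj \<longlongrightarrow> cnj x) (nhds x)" by (intro tendsto_intros filterlim_ident)
    then have "(cnj \<longlongrightarrow> x) (nhds x)" by (simp add: x_def)
    from eventually_compose_filterlim[OF AS_near[OF k, folded x_def] this] show ?thesis .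
  qed
  ultimately have "eventually (\<lambda>z. (Im (poly F z) > 0 \<longrightarrow> \<bar>Arg (poly F z) - (k mod 2) * pi\<bar> < 1) \<and>
      (Im z > 0 \<longrightarrow> \<bar>AS z - k * pi\<bar> < 1) \<and> (Im (cnj z) > 0 \<longrightarrow> \<bar>AS (cnj z) - k * pi\<bar> < 1)) (nhds x)"
    by (intro eventually_conj)
  then obtain \<epsilon> where \<epsilon>: "\<epsilon> > 0" "\<And>z. dist z x < \<epsilon> \<Longrightarrow> (Im (poly F z) > 0 \<longrightarrow> \<bar>Arg (poly F z) - (k mod 2) * pi\<bar> < 1) \<and>
      (Im z > 0 \<longrightarrow> \<bar>AS z - k * pi\<bar> < 1) \<and> (Im (cnj z) > 0 \<longrightarrow> \<bar>AS (cnj z) - k * pi\<bar> < 1)"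
    unfolding eventually_nhds_metric by blast
  \<comment> \<open>Two errors below 1 add up to less than 2, and no nonzero integer multiple of pi
    is that small.\<close>
  have int0: "n = 0" if "\<bar>of_int n * pi\<bar> < 2" for n :: int
  proof (rule ccontr)
    assume "n \<noteq> 0"
    then have "1 \<le> \<bar>of_int n :: real\<bar>" by linarith
    then have "pi \<le> \<bar>of_int n * pi\<bar>" by (simp add: abs_mult)
    then show False using that pi_gt3 by linarith
  qed
  have "2 * l + int (k mod 2) = (if Im z > 0 then int k else - int k)"
    if z: "z \<in> ball x \<epsilon>" "Im (poly F z) > 0" "lab (poly F z) z = of_int l" for z l
  proof -
    have d: "dist z x < \<epsilon>" using z(1) by (simp add: dist_commute)
    have A: "\<bar>Arg (poly F z) - (k mod 2) * pi\<bar> < 1" using \<epsilon>(2)[OF d] z(2) by blast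
    have nz: "Im z \<noteq> 0" using nonreal_if_F_nonreal[of z] z(2) by simp
    show ?thesis
    proof (cases "Im z > 0")
      case True
      then have "\<bar>AS z - k * pi\<bar> < 1" using \<epsilon>(2)[OF d] by blast
      moreover have "AS z - Arg (poly F z) = 2 * pi * of_int l"
        using z(3) True by (simp add: lab_def field_simps)
      moreover have "of_int (2 * l + int (k mod 2) - int k) * pi = 2 * pi * of_int l + (k mod 2) * pi - k * pi"
        by (simp add: algebra_simps)
      ultimately have "\<bar>of_int (2 * l + int (k mod 2) - int k) * pi\<bar> < 2" using A by linarith
      from int0[OF this] True show ?thesis by simp
    next
      case False
      then have "\<bar>AS (cnj z) - k * pi\<bar> < 1" using \<epsilon>(2)[OF d] nz by force
      moreover have "- (AS (cnj z) + Arg (poly F z)) = 2 * pi * of_int l"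
        using z(3) False by (simp add: lab_def field_simps)
      moreover have "of_int (2 * l + int (k mod 2) + int k) * pi = 2 * pi * of_int l + (k mod 2) * pi + k * pi"
        by (simp add: algebra_simps)
      ultimately have "\<bar>of_int (2 * l + int (k mod 2) + int k) * pi\<bar> < 2" using A by linarith
      from int0[OF this] False show ?thesis by simp
    qed
  qed
  then show ?thesis using \<epsilon>(1) unfolding x_def by blast
qed

text \<open>F - cv has a zero of order exactly two at \<open>\<xi> k\<close>, so it has a
  holomorphic square root there. That square root is a local coordinate, and \<open>g\<close> is its
  inverse.\<close>

lemma double_root_param:
  assumes k: "k \<in> {1..<p}" and e: "e > 0"
  obtains \<delta> g where "\<delta> > 0" "g holomorphic_on ball 0 \<delta>"
    "\<And>s. s \<in> ball 0 \<delta> \<Longrightarrow> g s \<in> ball (of_real (\<xi> k)) e \<and> poly F (g s) = of_real (cv k) + s\<^sup>2"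
    "inj_on g (ball 0 \<delta>)"
proof -
  define x where "x = complex_of_real (\<xi> k)"
  define v where "v = complex_of_real (cv k)"
  have "poly (F - [:v:]) x = 0" by (simp add: x_def v_def poly_F_of_real cv_def)
  then obtain q1 where q1: "F - [:v:] = [:-x,1:] * q1" unfolding poly_eq_0_iff_dvd by (elim dvdE)
  have "pderiv F = pderiv (F - [:v:])" by (simp add: pderiv_diff pderiv_pCons)
  also note q1
  finally have "pderiv F = pderiv ([:-x,1:] * q1)" .
  then have "poly (pderiv F) x = poly q1 x" by (simp only: pderiv_linear_mult) simp
  moreover have "poly (pderiv F) x = 0" using critical_iff[of x] k x_def by blast
  ultimately obtain q where q: "q1 = [:-x,1:] * q" by (metis poly_eq_0_iff_dvd dvdE)
  have Feq: "poly F z = v + (z - x)\<^sup>2 * poly q z" for z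
  proof -
    have "poly (F - [:v:]) z = (z - x) * ((z - x) * poly q z)" by (simp only: q1 q) (simp add: algebra_simps)
    then show ?thesis by (simp add: algebra_simps power2_eq_square)
  qed
  have "poly q x \<noteq> 0"
  proof -
    have "pderiv F = pderiv ([:-x,1:] * ([:-x,1:] * q))"
      using \<open>pderiv F = pderiv ([:-x,1:] * q1)\<close> unfolding q .
    also have "\<dots> = [:-x,1:] * (smult 2 q + [:-x,1:] * pderiv q)"
    proof -
      have "smult 2 q = q + q" by (metis smult_add_left one_add_one smult_1_left)
      then show ?thesis by (simp only: pderiv_linear_mult distrib_left add.assoc)
    qed
    finally have 1: "pderiv F = [:-x,1:] * (smult 2 q + [:-x,1:] * pderiv q)" .
    \<comment> \<open>The cofactor of z - x in F'. It is nonzero at x because the critical points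
      are distinct, and comparing the two factorizations at x gives 2 q(x) = R(x).\<close>
    define R where "R = smult (of_nat p) (\<Prod>j\<in>{1..<p}-{k}. [:- of_real (\<xi> j), 1::complex:])"
    have "pderiv F = [:-x,1:] * R"
      unfolding pderiv_F_eq R_def using k by (subst prod.remove[of _ k]) (auto simp: x_def)
    with 1 have "[:-x,1:] * (smult 2 q + [:-x,1:] * pderiv q) = [:-x,1:] * R" by simp
    then have "smult 2 q + [:-x,1:] * pderiv q = R" by (subst (asm) mult_left_cancel) auto
    then have "poly (smult 2 q + [:-x,1:] * pderiv q) x = poly R x" by simp
    moreover have "poly R x \<noteq> 0"
      using k inj_xi p_pos by (auto simp: R_def poly_prod x_def inj_on_def)
    ultimately show ?thesis by auto
  qed
  then have "eventually (\<lambda>z. poly q z \<noteq> 0) (nhds x)"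
  proof -
    assume "poly q x \<noteq> 0"
    moreover have "(poly q \<longlongrightarrow> poly q x) (nhds x)"
      by (subst tendsto_at_iff_tendsto_nhds[symmetric], subst isCont_def[symmetric]) simp
    ultimately show ?thesis by (intro tendsto_imp_eventually_ne)
  qed
  then obtain r where r: "r > 0" "\<And>z. dist z x < r \<Longrightarrow> poly q z \<noteq> 0"
    unfolding eventually_nhds_metric by blast
  obtain w where w: "w holomorphic_on ball x r" "\<And>z. z \<in> ball x r \<Longrightarrow> poly q z = (w z)\<^sup>2"
    by (rule contractible_imp_holomorphic_sqrt[of "poly q" "ball x r"])
       (use r(2) in \<open>auto simp: holomorphic_poly dist_commute convex_imp_contractible\<close>)
  \<comment> \<open>The square root of F - v: its square is (z - x)^2 q(z), and its derivative at x
    is w(x).\<close>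
  define \<phi> where "\<phi> z = (z - x) * w z" for z
  have hol: "\<phi> holomorphic_on ball x r" unfolding \<phi>_def[abs_def] by (intro holomorphic_intros w)
  have wx: "w x \<noteq> 0" using w(2)[of x] \<open>poly q x \<noteq> 0\<close> r(1) by auto
  have "(w has_field_derivative deriv w x) (at x)"
    using w(1) r(1) by (intro holomorphic_derivI[of _ "ball x r"]) auto
  then have "(\<phi> has_field_derivative w x) (at x)"
    unfolding \<phi>_def[abs_def] by (auto intro!: derivative_eq_intros)
  then have "deriv \<phi> x \<noteq> 0" using wx by (simp add: DERIV_imp_deriv)
  from holomorphic_local_inverse[OF hol open_ball _ this e] r(1)
  obtain \<delta> g where g: "\<delta> > 0" "g holomorphic_on ball (\<phi> x) \<delta>"
    "\<And>t. t \<in> ball (\<phi> x) \<delta> \<Longrightarrow> g t \<in> ball x r \<inter> ball x e \<and> \<phi> (g t) = t"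
    by (metis centre_in_ball)
  have x0: "\<phi> x = 0" by (simp add: \<phi>_def)
  show thesis
  proof (rule that[OF g(1)])
    show "g holomorphic_on ball 0 \<delta>" using g(2) x0 by simp
    fix s :: complex assume s: "s \<in> ball 0 \<delta>"
    then have 1: "g s \<in> ball x r" "g s \<in> ball x e" "\<phi> (g s) = s" using g(3)[of s] x0 by auto
    have "(g s - x)\<^sup>2 * poly q (g s) = s\<^sup>2"
      using w(2)[OF 1(1)] 1(3) by (simp add: \<phi>_def flip: power_mult_distrib)
    then show "g s \<in> ball (of_real (\<xi> k)) e \<and> poly F (g s) = of_real (cv k) + s\<^sup>2"
      using 1(2) Feq[of "g s"] by (simp add: x_def v_def)
  next
    show "inj_on g (ball 0 \<delta>)" using g(3) x0 by (intro inj_on_inverseI[of _ \<phi>]) auto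
  qed
qed

lemma root_bound:
  assumes "cmod (poly F z) \<le> M"
  shows "cmod z \<le> (\<Sum>j<p. \<bar>c j\<bar>) + M + 1"
proof (rule ccontr)
  assume a: "\<not> ?thesis"
  have M: "M \<ge> 0" using assms norm_ge_zero order_trans by blast
  have "M + 1 \<le> cmod (z - of_real (c j))" if "j < p" for j
  proof -
    have "\<bar>c j\<bar> \<le> (\<Sum>j<p. \<bar>c j\<bar>)" using that by (intro member_le_sum) auto
    moreover have "cmod z - \<bar>c j\<bar> \<le> cmod (z - of_real (c j))" by (metis norm_of_real norm_triangle_ineq2)
    ultimately show ?thesis using a by simp
  qed
  then have "(\<Prod>j<p. M + 1) \<le> (\<Prod>j<p. cmod (z - of_real (c j)))"
    using M by (intro prod_mono) auto
  then have "(M + 1) ^ p \<le> cmod (poly F z)" by (simp add: poly_F prod_norm)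
  moreover have "M + 1 \<le> (M + 1) ^ p" using M p_pos by (intro self_le_power) auto
  ultimately show False using assms by simp
qed

end

text \<open>The monodromy around a critical value (\<kappa> = 0 if it is positive, \<kappa> = 1 if it is negative)
  in terms of labels; K is the set of indices of the critical points on that level.\<close>

definition flip :: "int \<Rightarrow> nat set \<Rightarrow> int \<Rightarrow> int" where
  "flip \<kappa> K l = (if nat \<bar>2 * l + \<kappa>\<bar> \<in> K then - l - \<kappa> else l)"

section \<open>Monodromy around a critical value\<close>

context real_rooted
begin

definition same_cv :: "nat \<Rightarrow> nat set" where "same_cv k = {j \<in> {1..<p}. cv j = cv k}"

lemma same_cv_parity:
  assumes "k \<in> {1..<p}" "j \<in> same_cv k"
  shows "j \<in> {1..<p}" "cv j = cv k" "j mod 2 = k mod 2"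
proof -
  show *: "j \<in> {1..<p}" "cv j = cv k" using assms(2) by (auto simp: same_cv_def)
  have "even j \<longleftrightarrow> even k"
    using cv_sgn[OF assms(1)] cv_sgn[OF *(1)] *(2) by (cases "even j"; cases "even k"; force)
  then show "j mod 2 = k mod 2" by (auto simp: even_iff_mod_2_eq_zero odd_iff_mod_2_eq_one)
qed

lemma flip_range:
  assumes "\<kappa> \<in> {0,1}" "K \<subseteq> {..<p}" "l \<in> {-h..h}"
  shows "flip \<kappa> K l \<in> {-h..h}"
proof (cases "nat \<bar>2 * l + \<kappa>\<bar> \<in> K")
  case True
  then have "nat \<bar>2 * l + \<kappa>\<bar> < p" using assms(2) by blast
  then have "\<bar>2 * l + \<kappa>\<bar> < 2 * h + 1" using p_eq by linarith
  then show ?thesis using True assms(1) by (auto simp: flip_def)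
qed (use assms in \<open>simp add: flip_def\<close>)

text \<open>For real r, s \<mapsto> r + s^2 maps the open first quadrant onto the upper half plane
  bijectively, so this small piece is where labels are available; the opposite quadrant is its image
  under s \<mapsto> - s.\<close>

lemma quadrant:
  fixes \<delta> :: real
  assumes "\<delta> > 0"
  defines "Q \<equiv> {s \<in> ball 0 \<delta>. Re s > 0 \<and> Im s > 0}"
  shows "connected Q" "Q \<noteq> {}" "open Q"
proof -
  have Q: "Q = ball 0 \<delta> \<inter> {s. Re s > 0} \<inter> {s. Im s > 0}" by (auto simp: Q_def)
  show "connected Q" unfolding Q
    by (intro convex_connected convex_Int convex_ball convex_halfspace_Re_gt convex_halfspace_Im_gt)
  show "open Q" unfolding Q
    by (intro open_Int open_ball open_halfspace_Re_gt open_halfspace_Im_gt)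
  have "cmod (Complex (\<delta> / 4) (\<delta> / 4)) \<le> \<delta> / 4 + \<delta> / 4"
    using assms(1) cmod_le[of "Complex (\<delta> / 4) (\<delta> / 4)"] by simp
  then have "Complex (\<delta> / 4) (\<delta> / 4) \<in> Q" using assms(1) by (simp add: Q_def)
  then show "Q \<noteq> {}" by blast
qed

lemma Im_real_plus_square: "Im (of_real r + s\<^sup>2) = 2 * Re s * Im s"
  by (simp add: power2_eq_square)

text \<open>With t = cv k + s^2 all roots become holomorphic functions of s near 0, also those that collide
  at the critical value, and s \<mapsto> - s exchanges each colliding pair.\<close>

lemma local_continuation:
  assumes k: "k \<in> {1..<p}" and l: "l \<in> {-h..h}"
  shows "\<exists>\<delta>>0. \<exists>G. G holomorphic_on ball 0 \<delta> \<and> (\<forall>s\<in>ball 0 \<delta>. Re s > 0 \<longrightarrow> Im s > 0 \<longrightarrow>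
    X (of_real (cv k) + s\<^sup>2) l = G s \<and>
    X (of_real (cv k) + s\<^sup>2) (flip (int (k mod 2)) (same_cv k) l) = G (- s))"
proof -
  define \<kappa> where "\<kappa> = int (k mod 2)"
  define T where "T s = of_real (cv k) + s\<^sup>2" for s :: complex
  have ImT: "Im (T s) > 0" if "Re s > 0" "Im s > 0" for s
    using that by (simp add: T_def Im_real_plus_square del: plus_complex.simps)
  have contT: "continuous_on A T" for A unfolding T_def[abs_def] by (intro continuous_intros)
  show ?thesis
  proof (cases "nat \<bar>2 * l + \<kappa>\<bar> \<in> same_cv k")
    case True
    define j where "j = nat \<bar>2 * l + \<kappa>\<bar>"
    have j: "j \<in> {1..<p}" "cv j = cv k" "j mod 2 = k mod 2"
      using same_cv_parity[OF k] True by (auto simp: j_def)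
    obtain \<epsilon> where \<epsilon>: "\<epsilon> > 0" "\<And>z l. z \<in> ball (of_real (\<xi> j)) \<epsilon> \<Longrightarrow> Im (poly F z) > 0 \<Longrightarrow> lab (poly F z) z = of_int l \<Longrightarrow>
        2 * l + \<kappa> = (if Im z > 0 then int j else - int j)"
      using lab_near[OF j(1)] unfolding \<kappa>_def j(3) by blast
    obtain \<delta> g where \<delta>: "\<delta> > 0" and g: "g holomorphic_on ball 0 \<delta>"
      "\<And>s. s \<in> ball 0 \<delta> \<Longrightarrow> g s \<in> ball (of_real (\<xi> j)) \<epsilon> \<and> poly F (g s) = of_real (cv j) + s\<^sup>2"
      "inj_on g (ball 0 \<delta>)"
      using double_root_param[OF j(1) \<epsilon>(1)] by blast
    have gF: "poly F (g s) = T s" if "s \<in> ball 0 \<delta>" for s using g(2)[OF that] by (simp add: T_def j)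
    have TT: "T (- s) = T s" for s by (simp add: T_def)
    define Q where "Q = {s \<in> ball 0 \<delta>. Re s > 0 \<and> Im s > 0}"
    note Qp = quadrant[OF \<delta>, folded Q_def]
    have contg: "continuous_on (ball 0 \<delta>) g" using g(1) by (rule holomorphic_on_imp_continuous_on)
    have A1: "continuous_on Q g" by (rule continuous_on_subset[OF contg]) (auto simp: Q_def)
    have A2: "Im (T s) > 0 \<and> poly F (g s) = T s" if "s \<in> Q" for s
      using that ImT[of s] gF[of s] by (simp add: Q_def)
    obtain l1 where l1: "l1 \<in> {-h..h}" "\<And>s. s \<in> Q \<Longrightarrow> g s = X (T s) l1"
      using label_constant[OF Qp(1,2) contT A1 A2] by blast
    have B1: "continuous_on Q (\<lambda>s. g (- s))"
      by (rule continuous_on_compose2[OF contg]) (auto simp: Q_def intro!: continuous_intros)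
    have B2: "Im (T s) > 0 \<and> poly F (g (- s)) = T s" if "s \<in> Q" for s
      using that ImT[of s] gF[of "- s"] by (simp add: Q_def TT)
    obtain l2 where l2: "l2 \<in> {-h..h}" "\<And>s. s \<in> Q \<Longrightarrow> g (- s) = X (T s) l2"
      using label_constant[OF Qp(1,2) contT B1 B2] by blast
    obtain s0 where s0: "s0 \<in> Q" using Qp(2) by blast
    have s0': "s0 \<in> ball 0 \<delta>" "- s0 \<in> ball 0 \<delta>" "Im (T s0) > 0" "s0 \<noteq> - s0"
      using s0 ImT[of s0] by (auto simp: Q_def complex_eq_iff)
    have "g s0 \<noteq> g (- s0)" using inj_onD[OF g(3) _ s0'(1,2)] s0'(4) by blast
    then have "l1 \<noteq> l2" using l1(2)[OF s0] l2(2)[OF s0] by auto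
    have "2 * l1 + \<kappa> = int j \<or> 2 * l1 + \<kappa> = - int j"
      using \<epsilon>(2)[of "g s0" l1] g(2)[OF s0'(1)] gF[OF s0'(1)] s0'(3) X(2)[OF s0'(3) l1(1)] l1(2)[OF s0] by auto
    moreover have "2 * l2 + \<kappa> = int j \<or> 2 * l2 + \<kappa> = - int j"
      using \<epsilon>(2)[of "g (- s0)" l2] g(2)[OF s0'(2)] gF[OF s0'(2)] s0'(3) X(2)[OF s0'(3) l2(1)] l2(2)[OF s0] TT by auto
    moreover have "2 * l + \<kappa> = int j \<or> 2 * l + \<kappa> = - int j" by (auto simp: j_def)
    moreover have fl: "flip \<kappa> (same_cv k) l = - l - \<kappa>" using True by (simp add: flip_def)
    \<comment> \<open>\<open>2 * l + \<kappa> = int j\<close> and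
      \<open>2 * l + \<kappa> = - int j\<close> have one solution each, and \<open>l1\<close> and
      \<open>l2\<close> are different solutions. So they are \<open>l\<close> and its flip, in one
      of the two orders.\<close>
    ultimately consider "l = l1" "flip \<kappa> (same_cv k) l = l2" | "l = l2" "flip \<kappa> (same_cv k) l = l1"
      using \<open>l1 \<noteq> l2\<close> by fastforce
    then show ?thesis
    proof cases
      case 1
      have "X (T s) l = g s \<and> X (T s) (flip \<kappa> (same_cv k) l) = g (- s)"
        if "s \<in> ball 0 \<delta>" "Re s > 0" "Im s > 0" for s
        using that 1 l1(2)[of s] l2(2)[of s] by (simp add: Q_def)
      then show ?thesis using \<delta> g(1) unfolding T_def \<kappa>_def by blast
    next
      case 2
      have "X (T s) l = g (- s) \<and> X (T s) (flip \<kappa> (same_cv k) l) = g (- (- s))"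
        if "s \<in> ball 0 \<delta>" "Re s > 0" "Im s > 0" for s
        using that 2 l1(2)[of s] l2(2)[of s] by (simp add: Q_def)
      moreover have "(\<lambda>s. g (- s)) holomorphic_on ball 0 \<delta>"
        by (rule holomorphic_on_compose_gen[OF _ g(1), of uminus, unfolded o_def]) (auto intro!: holomorphic_intros)
      ultimately show ?thesis using \<delta> unfolding T_def \<kappa>_def by (intro exI[of _ \<delta>] conjI exI[of _ "\<lambda>s. g (- s)"]) auto
    qed
  next
    case False
    then have fl: "flip \<kappa> (same_cv k) l = l" by (simp add: flip_def)
    \<comment> \<open>A sequence in the first quadrant tending to 0. It locates the point over the
      critical value to which the root with label \<open>l\<close> converges, at least along a
      subsequence.\<close>
    define s :: "nat \<Rightarrow> complex" where "s n = of_real (inverse (real (Suc n))) * (1 + \<i>)" for n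
    have spos: "Re (s n) > 0" "Im (s n) > 0" for n by (simp_all add: s_def)
    have "s \<longlonglongrightarrow> of_real 0 * (1 + \<i>)" unfolding s_def[abs_def]
      by (intro tendsto_intros LIMSEQ_inverse_real_of_nat)
    then have s0: "s \<longlonglongrightarrow> 0" by simp
    have T0: "(\<lambda>n. T (s n)) \<longlonglongrightarrow> of_real (cv k)"
    proof -
      have "(\<lambda>n. T (s n)) \<longlonglongrightarrow> of_real (cv k) + 0\<^sup>2" unfolding T_def by (intro tendsto_intros s0)
      then show ?thesis by simp
    qed
    define z where "z n = X (T (s n)) l" for n
    have z: "poly F (z n) = T (s n)" "lab (T (s n)) (z n) = of_int l" "Im (T (s n)) > 0" for n
      using X[OF ImT[OF spos] l] ImT[OF spos] by (auto simp: z_def)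
    obtain M where M: "\<And>n. cmod (T (s n)) \<le> M"
      using T0 by (metis Bseq_def convergent_def convergent_imp_Bseq)
    have "z n \<in> cball 0 ((\<Sum>j<p. \<bar>c j\<bar>) + M + 1)" for n
      using root_bound[of "z n" M] M[of n] z(1)[of n] by simp
    then obtain \<rho> r where r: "strict_mono r" "(z \<circ> r) \<longlonglongrightarrow> \<rho>"
      using compact_cball[unfolded compact_def, of 0 "(\<Sum>j<p. \<bar>c j\<bar>) + M + 1"] by blast
    have "(\<lambda>n. poly F ((z \<circ> r) n)) \<longlonglongrightarrow> poly F \<rho>" by (intro tendsto_intros r)
    moreover have "(\<lambda>n. poly F ((z \<circ> r) n)) \<longlonglongrightarrow> of_real (cv k)"
      using LIMSEQ_subseq_LIMSEQ[OF T0 r(1)] by (simp add: z o_def)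
    ultimately have F\<rho>: "poly F \<rho> = of_real (cv k)" by (rule LIMSEQ_unique)
    have ev: "\<exists>n. z n \<in> ball \<rho> \<epsilon>" if "\<epsilon> > 0" for \<epsilon>
    proof -
      have "eventually (\<lambda>n. dist ((z \<circ> r) n) \<rho> < \<epsilon>) sequentially" using r(2) that by (rule tendstoD)
      then obtain n where "dist ((z \<circ> r) n) \<rho> < \<epsilon>" by (auto simp: eventually_sequentially)
      then show ?thesis by (auto simp: dist_commute)
    qed
    \<comment> \<open>A critical limit would be some \<open>\<xi> j\<close> on the same level. Then
      \<open>lab_near\<close> would give \<open>\<bar>2 * l + \<kappa>\<bar> = j\<close> with
      \<open>j\<close> in \<open>same_cv k\<close>, against the case assumption.\<close>
    have "poly (pderiv F) \<rho> \<noteq> 0"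
    proof
      assume "poly (pderiv F) \<rho> = 0"
      then obtain j where j: "j \<in> {1..<p}" "\<rho> = of_real (\<xi> j)" by (auto simp: critical_iff)
      then have "cv j = cv k" using F\<rho> by (simp add: poly_F_of_real cv_def)
      then have jk: "j \<in> same_cv k" using j by (simp add: same_cv_def)
      obtain \<epsilon> where \<epsilon>: "\<epsilon> > 0" "\<And>z l. z \<in> ball (of_real (\<xi> j)) \<epsilon> \<Longrightarrow> Im (poly F z) > 0 \<Longrightarrow> lab (poly F z) z = of_int l \<Longrightarrow>
          2 * l + \<kappa> = (if Im z > 0 then int j else - int j)"
        using lab_near[OF j(1)] unfolding \<kappa>_def same_cv_parity(3)[OF k jk] by blast
      obtain n where "z n \<in> ball \<rho> \<epsilon>" using ev[OF \<epsilon>(1)] by blast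
      then have "2 * l + \<kappa> = (if Im (z n) > 0 then int j else - int j)"
        using \<epsilon>(2)[of "z n" l] z[of n] j(2) by simp
      then have "nat \<bar>2 * l + \<kappa>\<bar> = j" by (auto split: if_splits)
      then show False using False jk by simp
    qed
    then have "deriv (poly F) \<rho> \<noteq> 0" by (simp add: deriv_poly)
    from holomorphic_local_inverse[OF holomorphic_poly open_UNIV UNIV_I this zero_less_one]
    obtain \<delta> \<eta> g where \<delta>: "\<delta> > 0" and g: "g holomorphic_on ball (poly F \<rho>) \<delta>"
      "\<And>t. t \<in> ball (poly F \<rho>) \<delta> \<Longrightarrow> poly F (g t) = t"
      and \<eta>: "\<eta> > 0" "\<And>z. z \<in> ball \<rho> \<eta> \<Longrightarrow> poly F z \<in> ball (poly F \<rho>) \<delta> \<and> g (poly F z) = z"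
      by (metis IntD2 mem_ball)
    define B where "B = ball (poly F \<rho>) \<delta> \<inter> {t. Im t > 0}"
    obtain n where n: "z n \<in> ball \<rho> \<eta>" using ev[OF \<eta>(1)] by blast
    then have nB: "T (s n) \<in> B" "g (T (s n)) = z n" using \<eta>(2)[OF n] z[of n] by (auto simp: B_def)
    have "connected B" unfolding B_def
      by (intro convex_connected convex_Int convex_ball convex_halfspace_Im_gt)
    moreover have "continuous_on B g"
      by (rule continuous_on_subset[OF holomorphic_on_imp_continuous_on[OF g(1)]]) (auto simp: B_def)
    moreover have "Im t > 0 \<and> poly F (g t) = t" if "t \<in> B" for t using that g(2)[of t] by (simp add: B_def)
    ultimately obtain m where m: "m \<in> {-h..h}" "\<And>t. t \<in> B \<Longrightarrow> g t = X t m"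
      using label_constant[of B "\<lambda>t. t" g] nB(1) continuous_on_id by blast
    have "m = l" by (rule X_inj[OF z(3) m(1) l, of n]) (use m(2)[OF nB(1)] nB(2) in \<open>simp add: z_def\<close>)
    define \<delta>' where "\<delta>' = min 1 \<delta>"
    have \<delta>': "\<delta>' > 0" using \<delta> by (simp add: \<delta>'_def)
    have Tb: "T u \<in> ball (poly F \<rho>) \<delta>" if "u \<in> ball 0 \<delta>'" for u
    proof -
      have "cmod u < 1" "cmod u < \<delta>" using that by (auto simp: \<delta>'_def)
      then have "cmod u * cmod u \<le> 1 * cmod u" by (intro mult_right_mono) auto
      then show ?thesis using \<open>cmod u < \<delta>\<close> by (simp add: T_def F\<rho> dist_norm norm_mult power2_eq_square)
    qed
    \<comment> \<open>This continuation is an even function of \<open>u\<close>, which matches the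
      fact that the flip fixes the label \<open>l\<close>.\<close>
    have holG: "(\<lambda>u. g (T u)) holomorphic_on ball 0 \<delta>'"
    proof (rule holomorphic_on_compose_gen[OF _ g(1), of T, unfolded o_def])
      show "T holomorphic_on ball 0 \<delta>'" unfolding T_def[abs_def] by (intro holomorphic_intros)
      show "T ` ball 0 \<delta>' \<subseteq> ball (poly F \<rho>) \<delta>" using Tb by blast
    qed
    have "X (T u) l = g (T u) \<and> X (T u) (flip \<kappa> (same_cv k) l) = g (T (- u))"
      if "u \<in> ball 0 \<delta>'" "Re u > 0" "Im u > 0" for u
    proof -
      have "T u \<in> B" using Tb[OF that(1)] ImT[OF that(2,3)] by (simp add: B_def)
      from m(2)[OF this] show ?thesis using \<open>m = l\<close> fl by (simp add: T_def)
    qed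
    then show ?thesis using \<delta>' holG unfolding T_def \<kappa>_def
      by (intro exI[of _ \<delta>'] conjI exI[of _ "\<lambda>u. g (T u)"]) (auto simp: T_def)
  qed
qed

lemma upper_half_plane: "open {t. Im t > 0}" "connected {t. Im t > 0}"
  by (simp_all add: open_halfspace_Im_gt convex_connected convex_halfspace_Im_gt)

text \<open>As a function of s the relation is holomorphic near 0 and zero on a quadrant, so it is
  also zero at - s, where the flipped roots appear. The identity theorem is used a second time to
  spread the new relation from a half disc at the critical value to the upper half plane.\<close>

lemma relation_flip:
  assumes k: "k \<in> {1..<p}"
    and rel: "\<And>t. Im t > 0 \<Longrightarrow> (\<Sum>l\<in>{-h..h}. a l * X t l) = 0"
    and t: "Im t > 0"
  shows "(\<Sum>l\<in>{-h..h}. a l * X t (flip (int (k mod 2)) (same_cv k) l)) = 0"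
proof -
  define \<phi> where "\<phi> = flip (int (k mod 2)) (same_cv k)"
  define T where "T s = of_real (cv k) + s\<^sup>2" for s :: complex
  obtain D G where DG: "\<And>l. l \<in> {-h..h} \<Longrightarrow> D l > 0 \<and> G l holomorphic_on ball 0 (D l) \<and>
      (\<forall>s\<in>ball 0 (D l). Re s > 0 \<longrightarrow> Im s > 0 \<longrightarrow> X (T s) l = G l s \<and> X (T s) (\<phi> l) = G l (- s))"
    using local_continuation[OF k] unfolding \<phi>_def T_def by metis
  have ne: "{-h..h} \<noteq> {}" using p_eq p_ge by auto
  define \<delta> where "\<delta> = Min (D ` {-h..h})"
  have \<delta>: "\<delta> > 0" "\<And>l. l \<in> {-h..h} \<Longrightarrow> \<delta> \<le> D l" using DG ne by (auto simp: \<delta>_def)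
  define Q where "Q = {s \<in> ball 0 \<delta>. Re s > 0 \<and> Im s > 0}"
  note Qp = quadrant[OF \<delta>(1), folded Q_def]
  define \<Phi> where "\<Phi> s = (\<Sum>l\<in>{-h..h}. a l * G l s)" for s
  have hol: "\<Phi> holomorphic_on ball 0 \<delta>" unfolding \<Phi>_def[abs_def]
  proof (intro holomorphic_intros)
    fix l assume l: "l \<in> {-h..h}"
    then show "G l holomorphic_on ball 0 \<delta>"
      using DG[OF l] \<delta>(2)[OF l] by (metis holomorphic_on_subset subset_ball)
  qed
  have QG: "X (T s) l = G l s \<and> X (T s) (\<phi> l) = G l (- s)" if "s \<in> Q" "l \<in> {-h..h}" for s l
    using DG[OF that(2)] \<delta>(2)[OF that(2)] that(1) by (auto simp: Q_def)
  have ImT: "Im (T s) > 0" if "s \<in> Q" for s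
    using that by (simp add: T_def Q_def Im_real_plus_square del: plus_complex.simps)
  have "\<Phi> s = 0" if "s \<in> Q" for s
    using rel[OF ImT[OF that]] QG[OF that] by (simp add: \<Phi>_def)
  moreover have "Q \<subseteq> ball 0 \<delta>" by (auto simp: Q_def)
  ultimately have \<Phi>0: "\<Phi> s = 0" if "s \<in> ball 0 \<delta>" for s
    using analytic_continuation_open[OF Qp(3) open_ball Qp(2) connected_ball _ hol, of "\<lambda>_. 0" s] that
    by simp
  have flipped: "(\<Sum>l\<in>{-h..h}. a l * X (T s) (\<phi> l)) = 0" if "s \<in> Q" for s
  proof -
    have "- s \<in> ball 0 \<delta>" using that by (simp add: Q_def)
    from \<Phi>0[OF this] QG[OF that] show ?thesis by (simp add: \<Phi>_def)
  qed
  have \<phi>r: "\<phi> l \<in> {-h..h}" if "l \<in> {-h..h}" for l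
    unfolding \<phi>_def by (rule flip_range[OF _ _ that]) (auto simp: same_cv_def)
  define N where "N = ball (of_real (cv k)) (\<delta>\<^sup>2) \<inter> {t. Im t > 0}"
  have N0: "(\<Sum>l\<in>{-h..h}. a l * X u (\<phi> l)) = 0" if u: "u \<in> N" for u
  proof -
    define s where "s = csqrt (u - of_real (cv k))"
    have s2: "s\<^sup>2 = u - of_real (cv k)" by (simp add: s_def)
    then have Ts: "T s = u" by (simp add: T_def)
    have "Im (T s) > 0" using u Ts by (simp add: N_def)
    then have pos: "Re s * Im s > 0" by (simp add: T_def Im_real_plus_square mult.commute del: plus_complex.simps)
    \<comment> \<open>The principal square root has nonnegative real part, and a positive product of
      real and imaginary part then places it in the first quadrant.\<close>
    have "Re s \<ge> 0" 
      using csqrt_principal[of "u - of_real (cv k)"] unfolding s_def by linarith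
    then have "Re s > 0" "Im s > 0" using pos by (auto simp: zero_less_mult_iff)
    moreover have "(cmod s)\<^sup>2 < \<delta>\<^sup>2"
      using u s2 by (simp add: N_def dist_norm norm_minus_commute flip: norm_power)
    then have "cmod s < \<delta>" using \<delta>(1) by (simp add: power_less_imp_less_base)
    ultimately have "s \<in> Q" by (simp add: Q_def)
    from flipped[OF this] Ts show ?thesis by simp
  qed
  have "open N" unfolding N_def by (intro open_Int open_ball upper_half_plane)
  moreover obtain s1 where "s1 \<in> Q" using Qp(2) by blast
  have "N \<noteq> {}"
  proof -
    have "cmod (of_real (\<delta>\<^sup>2 / 2) * \<i>) < \<delta>\<^sup>2" using \<delta>(1) by (simp add: norm_mult norm_power)
    then have "of_real (cv k) + of_real (\<delta>\<^sup>2 / 2) * \<i> \<in> N" using \<delta>(1) by (simp add: N_def dist_norm)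
    then show ?thesis by blast
  qed
  moreover have "(\<lambda>u. \<Sum>l\<in>{-h..h}. a l * X u (\<phi> l)) holomorphic_on {t. Im t > 0}"
    by (intro holomorphic_intros X_holomorphic \<phi>r)
  ultimately have "(\<Sum>l\<in>{-h..h}. a l * X t (\<phi> l)) = 0"
    using analytic_continuation_open[of N "{t. Im t > 0}" "\<lambda>u. \<Sum>l\<in>{-h..h}. a l * X u (\<phi> l)" "\<lambda>_. 0" t]
      upper_half_plane N0 t by (auto simp: N_def)
  then show ?thesis by (simp add: \<phi>_def)
qed

end

section \<open>Matrices invariant under all flips\<close>

lemma coeff_prod_linear_factors:
  fixes f :: "'i \<Rightarrow> 'a::idom"
  assumes "finite A" "A \<noteq> {}"
  shows "poly.coeff (\<Prod>i\<in>A. [:- f i, 1:]) (card A - 1) = - sum f A"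
  using assms
proof (induction rule: finite_ne_induct)
  case (insert a A)
  define Q where "Q = (\<Prod>i\<in>A. [:- f i, 1:])"
  have "degree Q = card A" unfolding Q_def by (subst degree_prod_sum_eq) auto
  moreover have "lead_coeff Q = 1" unfolding Q_def by (simp add: lead_coeff_prod)
  ultimately have lc: "poly.coeff Q (card A) = 1" by simp
  obtain n where n: "card A = Suc n" using insert.hyps by (metis card_gt_0_iff gr0_implies_Suc)
  have "poly.coeff (\<Prod>i\<in>insert a A. [:- f i, 1:]) (card (insert a A) - 1) = poly.coeff ([:- f a, 1:] * Q) (Suc n)"
    using insert.hyps n by (simp add: Q_def)
  also have "\<dots> = - f a + poly.coeff Q n" using lc n by simp
  also have "poly.coeff Q n = - sum f A" using insert.IH n by (simp add: Q_def)
  finally show ?case using insert.hyps by simp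
qed auto

lemma flip_Un:
  assumes "K1 \<inter> K2 = {}"
  shows "flip \<kappa> (K1 \<union> K2) l = flip \<kappa> K1 (flip \<kappa> K2 l)"
proof -
  have "\<bar>2 * (- l - \<kappa>) + \<kappa>\<bar> = \<bar>2 * l + \<kappa>\<bar>" by (simp add: abs_if)
  then show ?thesis using assms by (auto simp: flip_def)
qed

lemma flip_flip: "flip \<kappa> K (flip \<kappa> K l) = l"
proof -
  have "\<bar>2 * (- l - \<kappa>) + \<kappa>\<bar> = \<bar>2 * l + \<kappa>\<bar>" by (simp add: abs_if)
  then show ?thesis by (auto simp: flip_def)
qed

context real_rooted
begin

lemma fibre_factorization:
  assumes "inj_on f A" "card A = p" "\<And>i. i \<in> A \<Longrightarrow> poly F (f i) = t"
  shows "F - [:t:] = (\<Prod>i\<in>A. [:- f i, 1:])"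
proof (rule poly_eqI_degree_lead_coeff[where n = p and A = "f ` A"])
  have fin: "finite A" using assms(2) p_pos card.infinite by fastforce
  define Q where "Q = (\<Prod>i\<in>A. [:- f i, 1:])"
  have dQ: "degree Q = p" unfolding Q_def using assms(2) by (subst degree_prod_sum_eq) auto
  have "lead_coeff Q = 1" unfolding Q_def by (simp add: lead_coeff_prod)
  then have "poly.coeff Q p = 1" by (simp add: dQ)
  moreover have "poly.coeff (F - [:t:]) p = 1"
    using lead_coeff_F degree_F p_pos by (simp add: coeff_pCons split: nat.splits)
  ultimately show "poly.coeff (F - [:t:]) p = poly.coeff (\<Prod>i\<in>A. [:- f i, 1:]) p" by (simp add: Q_def)
  show "degree (F - [:t:]) \<le> p" by (simp add: degree_F_minus_const)
  show "degree (\<Prod>i\<in>A. [:- f i, 1:]) \<le> p" using dQ by (simp add: Q_def)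
  show "p \<le> card (f ` A)" using assms by (simp add: card_image)
  fix z assume "z \<in> f ` A"
  then obtain i where i: "i \<in> A" "z = f i" by blast
  then have "poly Q z = 0" unfolding Q_def poly_prod using fin by (intro prod_zero bexI[of _ i]) auto
  then show "poly (F - [:t:]) z = poly (\<Prod>i\<in>A. [:- f i, 1:]) z" using i assms(3) by (simp add: Q_def)
qed

text \<open>Changing t alters only the constant coefficient, and the sum of the roots is read off at
  degree \<open>p - 1\<close>, which is positive.\<close>

lemma sum_fibre:
  assumes "inj_on f A" "card A = p" "\<And>i. i \<in> A \<Longrightarrow> poly F (f i) = t"
  shows "sum f A = of_real (\<Sum>j<p. c j)"
proof -
  have fin: "finite A" "A \<noteq> {}" using assms(2) p_pos card.infinite by fastforce+
  have "poly.coeff (F - [:t:]) (p - 1) = poly.coeff F (p - 1)"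
    using p_ge by (simp add: coeff_pCons split: nat.splits)
  also have "\<dots> = - (\<Sum>j<p. of_real (c j))"
    using coeff_prod_linear_factors[of "{..<p}" "\<lambda>j. complex_of_real (c j)"] p_pos by (simp add: F_def)
  finally show ?thesis
    using coeff_prod_linear_factors[OF fin, of f] assms(2) by (simp add: fibre_factorization[OF assms])
qed

text \<open>Different critical values of one sign have disjoint index sets, so the composition of
  their flips is the flip of the union. The induction runs over a finite set of values, taking one
  whole level at a time.\<close>

lemma flip_invariant_all:
  assumes inv: "\<And>k l m. k \<in> {1..<p} \<Longrightarrow> l \<in> {-h..h} \<Longrightarrow> m \<in> {-h..h} \<Longrightarrow>
      E (flip (int (k mod 2)) (same_cv k) l) (flip (int (k mod 2)) (same_cv k) m) = E l m"
    and \<kappa>: "\<kappa> \<in> {0, 1}" and lm: "l \<in> {-h..h}" "m \<in> {-h..h}"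
  defines "K \<equiv> {k \<in> {1..<p}. int (k mod 2) = \<kappa>}"
  shows "E (flip \<kappa> K l) (flip \<kappa> K m) = E l m"
proof -
  have "E (flip \<kappa> {k \<in> K. cv k \<in> V} l) (flip \<kappa> {k \<in> K. cv k \<in> V} m) = E l m" if "finite V" for V
    using that
  proof induction
    case empty
    then show ?case by (simp add: flip_def)
  next
    case (insert r V)
    show ?case
    proof (cases "\<exists>k\<in>K. cv k = r")
      case False
      then have "{k \<in> K. cv k \<in> insert r V} = {k \<in> K. cv k \<in> V}" by auto
      then show ?thesis using insert.IH by simp
    next
      case True
      then obtain k where k: "k \<in> K" "cv k = r" by blast
      have k': "k \<in> {1..<p}" "int (k mod 2) = \<kappa>" using k(1) by (auto simp: K_def)
      have "same_cv k = {j \<in> K. cv j = r}"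
      proof (intro equalityI subsetI)
        fix j assume j: "j \<in> same_cv k"
        then show "j \<in> {j \<in> K. cv j = r}"
          using same_cv_parity[OF k'(1) j] k'(2) k(2) by (simp add: K_def)
      next
        fix j assume "j \<in> {j \<in> K. cv j = r}"
        then show "j \<in> same_cv k" using k(2) by (simp add: K_def same_cv_def)
      qed
      then have eq: "{k \<in> K. cv k \<in> insert r V} = same_cv k \<union> {k \<in> K. cv k \<in> V}"
        and dj: "same_cv k \<inter> {k \<in> K. cv k \<in> V} = {}" using insert.hyps by auto
      have "flip \<kappa> {k \<in> K. cv k \<in> V} x \<in> {-h..h}" if "x \<in> {-h..h}" for x
        by (rule flip_range[OF \<kappa> _ that]) (auto simp: K_def)
      then show ?thesis
        unfolding eq flip_Un[OF dj] using inv[OF k'(1), of "flip \<kappa> {k \<in> K. cv k \<in> V} l" "flip \<kappa> {k \<in> K. cv k \<in> V} m"] lm insert.IH k'(2)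
        by simp
    qed
  qed
  from this[of "cv ` K"] have "E (flip \<kappa> {k \<in> K. cv k \<in> cv ` K} l) (flip \<kappa> {k \<in> K. cv k \<in> cv ` K} m) = E l m"
    by (simp add: K_def)
  moreover have "{k \<in> K. cv k \<in> cv ` K} = K" by auto
  ultimately show ?thesis by simp
qed

text \<open>The labels are the residues modulo p of least absolute value; through \<open>rep\<close>
  a function of labels becomes a function on residues.\<close>

definition rep :: "int \<Rightarrow> int" where "rep y = (y + h) mod int p - h"

lemma rep: "rep y \<in> {-h..h}" "[rep y = y] (mod int p)"
proof -
  have "0 \<le> (y + h) mod int p" "(y + h) mod int p < int p" using p_pos by auto
  then show "rep y \<in> {-h..h}" using p_eq by (auto simp: rep_def)
  have "[(y + h) mod int p - h = y + h - h] (mod int p)" by (intro cong_diff) auto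
  then show "[rep y = y] (mod int p)" by (simp add: rep_def)
qed

lemma label_cong_imp_eq:
  assumes "l \<in> {-h..h}" "m \<in> {-h..h}" "[l = m] (mod int p)"
  shows "l = m"
proof -
  have "int p dvd l - m" using assms(3) by (simp add: cong_iff_dvd_diff)
  moreover have "\<bar>l - m\<bar> < \<bar>int p\<bar>" using assms(1,2) p_eq by auto
  ultimately show ?thesis using dvd_imp_le_int[of "l - m" "int p"] by linarith
qed

lemma rep_eqI: "l \<in> {-h..h} \<Longrightarrow> [l = y] (mod int p) \<Longrightarrow> rep y = l"
  by (rule label_cong_imp_eq[OF rep(1)]) (auto intro: cong_trans[OF rep(2)] cong_sym)

lemma rep_cong: "[x = y] (mod int p) \<Longrightarrow> rep x = rep y"
  by (rule rep_eqI[OF rep(1)]) (auto intro: cong_trans[OF rep(2)] cong_sym)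

text \<open>The complete flips of the two parities are the reflections l \<mapsto> - l and l
  \<mapsto> - l - 1 of the residues. Their composition is translation by one.\<close>

lemma flip_invariant_difference:
  assumes inv: "\<And>k l m. k \<in> {1..<p} \<Longrightarrow> l \<in> {-h..h} \<Longrightarrow> m \<in> {-h..h} \<Longrightarrow>
      E (flip (int (k mod 2)) (same_cv k) l) (flip (int (k mod 2)) (same_cv k) m) = E l m"
  obtains e where "\<And>l m. E (rep l) (rep m) = e (l - m)"
    "\<And>x y. [x = y] (mod int p) \<Longrightarrow> e x = e y" "\<And>x. e (- x) = e x"
proof -
  define N where "N l m = E (rep l) (rep m)" for l m
  have neg: "N (- l) (- m) = N l m" for l m
  proof -
    define K where "K = {k \<in> {1..<p}. int (k mod 2) = 0}"
    have "flip 0 K (rep y) = rep (- y)" for y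
    proof -
      have "nat \<bar>2 * rep y + 0\<bar> \<in> K" if "rep y \<noteq> 0"
        using rep(1)[of y] that p_eq by (auto simp: K_def nat_mult_distrib abs_mult even_nat_iff)
      then have "flip 0 K (rep y) = - rep y" by (auto simp: flip_def)
      moreover have "rep (- y) = - rep y"
        by (rule rep_eqI) (use rep(1)[of y] rep(2)[of y] in \<open>auto simp: cong_minus_minus_iff\<close>)
      ultimately show ?thesis by simp
    qed
    then show ?thesis
      using flip_invariant_all[of E 0 "rep l" "rep m", OF inv _ rep(1) rep(1)] by (simp add: K_def N_def)
  qed
  have neg1: "N (- l - 1) (- m - 1) = N l m" for l m
  proof -
    define K where "K = {k \<in> {1..<p}. int (k mod 2) = 1}"
    have "flip 1 K (rep y) = rep (- y - 1)" for y
    \<comment> \<open>For the label h the number 2 h + 1 is p itself, which is not the index of a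
      critical point, so h is fixed. This agrees with the reflection, as - h - 1 is congruent to h
      modulo p.\<close>
    proof (cases "rep y = h")
      case True
      have "nat \<bar>2 * rep y + 1\<bar> = p" using True p_eq by simp
      then have "flip 1 K (rep y) = h" using True by (auto simp: flip_def K_def)
      moreover have "rep (- y - 1) = h"
      proof (rule rep_eqI)
        have "[- rep y - 1 = - y - 1] (mod int p)"
          by (intro cong_diff cong_refl) (simp add: cong_minus_minus_iff rep)
        moreover have "[h = - rep y - 1] (mod int p)" using True p_eq by (simp add: cong_iff_dvd_diff)
        ultimately show "[h = - y - 1] (mod int p)" by (rule cong_trans[rotated])
      qed (use rep(1)[of y] True in auto)
      ultimately show ?thesis by simp
    next
      case False
      then have ry: "- h \<le> rep y" "rep y < h" using rep(1)[of y] by auto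
      have "odd (nat \<bar>2 * rep y + 1\<bar>)" by (simp add: even_nat_iff)
      have odd_ge: "n mod 2 = 1 \<Longrightarrow> 1 \<le> n" for n :: nat by presburger
      have md: "nat \<bar>2 * rep y + 1\<bar> mod 2 = 1"
        using \<open>odd (nat \<bar>2 * rep y + 1\<bar>)\<close> by presburger
      moreover have "nat \<bar>2 * rep y + 1\<bar> < p" using ry p_eq by (auto simp: abs_if)
      moreover have "nat \<bar>2 * rep y + 1\<bar> \<ge> 1" using md by (rule odd_ge)
      ultimately have "nat \<bar>2 * rep y + 1\<bar> \<in> K" by (simp add: K_def)
      then have "flip 1 K (rep y) = - rep y - 1" by (simp add: flip_def)
      moreover have "rep (- y - 1) = - rep y - 1"
      proof (rule rep_eqI)
        show "[- rep y - 1 = - y - 1] (mod int p)"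
          by (intro cong_diff cong_refl) (simp add: cong_minus_minus_iff rep)
      qed (use ry in auto)
      ultimately show ?thesis by simp
    qed
    then show ?thesis
      using flip_invariant_all[of E 1 "rep l" "rep m", OF inv _ rep(1) rep(1)] by (simp add: K_def N_def)
  qed
  have shift1: "N (l + 1) (m + 1) = N l m" for l m
    using neg[of "l + 1" "m + 1"] neg1[of l m] by simp
  have shiftn: "N (l + int n) (m + int n) = N l m" for l m n
  proof (induction n)
    case (Suc n)
    then show ?case using shift1[of "l + int n" "m + int n"] by (simp add: add_ac)
  qed simp
  define e where "e d = N d 0" for d
  have Ne: "N l m = e (l - m)" for l m
  proof (cases "m \<ge> 0")
    case True
    then show ?thesis using shiftn[of "l - m" "nat m" 0] by (simp add: e_def)
  next
    case False
    then show ?thesis using shiftn[of l "nat (- m)" m] by (simp add: e_def)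
  qed
  have e_cong: "e x = e y" if "[x = y] (mod int p)" for x y
    using rep_cong[OF that] by (simp add: e_def N_def)
  have e_even: "e (- x) = e x" for x using neg[of x 0] by (simp add: e_def)
  show thesis
    by (rule that[of e]) (use Ne e_cong e_even in \<open>simp_all add: N_def\<close>)
qed

text \<open>In the coordinate y = 2 l + \<kappa> modulo p, every flip acts as y \<mapsto> - y on a symmetric
  set of residues, and the flips of both parities together generate the translations.\<close>

lemma flip_invariant_constant:
  assumes p: "prime p"
    and inv: "\<And>k l m. k \<in> {1..<p} \<Longrightarrow> l \<in> {-h..h} \<Longrightarrow> m \<in> {-h..h} \<Longrightarrow>
      E (flip (int (k mod 2)) (same_cv k) l) (flip (int (k mod 2)) (same_cv k) m) = E l m"
    and ij: "i \<in> {1..<p}" "j \<in> {1..<p}" "i mod 2 = j mod 2" "cv i \<noteq> cv j"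
  obtains \<beta> \<gamma> where "\<And>l m. l \<in> {-h..h} \<Longrightarrow> m \<in> {-h..h} \<Longrightarrow> E l m = (if l = m then \<gamma> else \<beta>)"
proof -
  obtain e where Ne: "\<And>l m. E (rep l) (rep m) = e (l - m)"
    and e_cong: "\<And>x y. [x = y] (mod int p) \<Longrightarrow> e x = e y" and e_even: "\<And>x. e (- x) = e x"
    using flip_invariant_difference[of E, OF inv] by blast
  define \<kappa> where "\<kappa> = int (i mod 2)"
  define K where "K = same_cv i"
  have K: "k \<in> {1..<p}" "cv k = cv i" "int (k mod 2) = \<kappa>" if "k \<in> K" for k
    using same_cv_parity[OF ij(1)] that by (auto simp: K_def \<kappa>_def)
  define U where "U = {y. \<exists>k\<in>K. [y = int k] (mod int p) \<or> [y = - int k] (mod int p)}"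
  have "2 * (h + 1) - 1 = int p" using p_eq by simp
  then have two: "[2 * (h + 1) = 1] (mod int p)" by (simp only: cong_iff_dvd_diff dvd_refl)
  \<comment> \<open>Multiplication by h + 1 is division by 2 modulo p. In the coordinate y = 2 l +
    \<kappa> differences are doubled, so \<open>e2\<close> is \<open>e\<close> rewritten for that
    coordinate.\<close>
  define e2 where "e2 d = e (d * (h + 1))" for d
  have e2: "e2 (2 * d) = e d" for d
  proof -
    have "[2 * (h + 1) * d = 1 * d] (mod int p)" by (intro cong_mult two cong_refl)
    then show ?thesis unfolding e2_def by (intro e_cong) (simp add: mult_ac)
  qed
  have e2_cong: "e2 x = e2 y" if "[x = y] (mod int p)" for x y
    unfolding e2_def by (intro e_cong cong_mult that cong_refl)
  define lb where "lb y = rep ((y - \<kappa>) * (h + 1))" for y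
  have lb: "lb y \<in> {-h..h}" "[2 * lb y + \<kappa> = y] (mod int p)" for y
  proof -
    show "lb y \<in> {-h..h}" by (simp only: lb_def rep)
    have "[2 * lb y = 2 * ((y - \<kappa>) * (h + 1))] (mod int p)" unfolding lb_def by (intro cong_mult rep cong_refl)
    moreover have "[(y - \<kappa>) * (2 * (h + 1)) = (y - \<kappa>) * 1] (mod int p)" by (intro cong_mult two cong_refl)
    ultimately have "[2 * lb y = y - \<kappa>] (mod int p)" by (simp add: mult_ac cong_trans)
    from cong_add[OF this cong_refl[of \<kappa>]] show "[2 * lb y + \<kappa> = y] (mod int p)" by simp
  qed
  have inK: "nat \<bar>2 * lb y + \<kappa>\<bar> \<in> K \<longleftrightarrow> y \<in> U" for y
  proof
    assume a: "nat \<bar>2 * lb y + \<kappa>\<bar> \<in> K"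
    define k where "k = nat \<bar>2 * lb y + \<kappa>\<bar>"
    have "2 * lb y + \<kappa> = int k \<or> 2 * lb y + \<kappa> = - int k" by (auto simp: k_def)
    with cong_sym[OF lb(2)[of y]] have "[y = int k] (mod int p) \<or> [y = - int k] (mod int p)" by auto
    then show "y \<in> U" using a unfolding U_def k_def[symmetric] by blast
  next
    assume "y \<in> U"
    then obtain k where k: "k \<in> K" "[y = int k] (mod int p) \<or> [y = - int k] (mod int p)" by (auto simp: U_def)
    define x where "x = 2 * lb y + \<kappa>"
    have \<kappa>01: "\<kappa> \<in> {0,1}" by (auto simp: \<kappa>_def)
    have px: "x mod 2 = \<kappa>" using \<kappa>01 unfolding x_def by (elim insertE) auto
    have bx: "\<bar>x\<bar> \<le> int p" using lb(1)[of y] \<kappa>01 p_eq by (auto simp: x_def abs_if)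
    have pk: "int k mod 2 = \<kappa>" using K(3)[OF k(1)] by (simp add: zmod_int)
    have bk: "0 < int k" "int k < int p" using K(1)[OF k(1)] by auto
    \<comment> \<open>\<open>K\<close> consists of integers and \<open>U\<close> of residues modulo
      p. The parity of 2 l + \<kappa> is known, so a congruence modulo p becomes one modulo 2 p, and
      the sizes then leave only equality.\<close>
    have lift: "x = z" if "[x = z] (mod int p)" "z mod 2 = \<kappa>" "\<bar>z\<bar> < int p" for z
    proof -
      have "int p dvd x - z" using that(1) by (simp add: cong_iff_dvd_diff)
      moreover have "2 dvd x - z" using px that(2) by (metis mod_eq_dvd_iff)
      moreover have "coprime 2 (int p)" using odd_p by (simp add: coprime_left_2_iff_odd)
      ultimately have "2 * int p dvd x - z" by (simp add: divides_mult)
      moreover have "\<bar>x - z\<bar> < \<bar>2 * int p\<bar>" using bx that(3) by linarith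
      ultimately show ?thesis by (metis dvd_imp_le_int eq_iff_diff_eq_0 not_less)
    qed
    have "[x = y] (mod int p)" using lb(2)[of y] by (simp add: x_def)
    then have "[x = int k] (mod int p) \<or> [x = - int k] (mod int p)" using k(2) cong_trans by blast
    then have "x = int k \<or> x = - int k"
    proof
      assume "[x = int k] (mod int p)"
      then show ?thesis using lift pk bk by auto
    next
      assume "[x = - int k] (mod int p)"
      moreover have "(- int k) mod 2 = \<kappa>" using pk by presburger
      ultimately show ?thesis using lift bk by auto
    qed
    then have "nat \<bar>x\<bar> = k" by auto
    then show "nat \<bar>2 * lb y + \<kappa>\<bar> \<in> K" using k(1) by (simp add: x_def)
  qed
  have "e2 d = e2 1" if "\<not> int p dvd d" for d
  proof (rule flip_rigidity[OF p odd_p, of e2 U "int i" "int j" d])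
    show "e2 x = e2 y" if "[x = y] (mod int p)" for x y using e2_cong[OF that] .
    show "e2 (- x) = e2 x" for x using e_even[of "x * (h + 1)"] by (simp add: e2_def)
    show "y \<in> U" if "[x = y] (mod int p)" "x \<in> U" for x y
      using that cong_trans cong_sym unfolding U_def by blast
    show "- x \<in> U" if "x \<in> U" for x
    proof -
      have "[- x = - k] (mod int p)" if "[x = k] (mod int p)" for k using that by (simp add: cong_minus_minus_iff)
      from this[of "int _"] this[of "- int _"] show ?thesis using \<open>x \<in> U\<close> unfolding U_def by force
    qed
    show "0 \<notin> U"
    proof
      assume "0 \<in> U"
      then obtain k where k: "k \<in> K" "[0 = int k] (mod int p) \<or> [0 = - int k] (mod int p)" by (auto simp: U_def)
      then have "int p dvd int k" by (auto simp: cong_iff_dvd_diff)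
      then show False using K(1)[OF k(1)] zdvd_not_zless[of "int k" "int p"] by auto
    qed
    show "e2 (u + w) = e2 (u - w)" if uw: "u \<in> U" "w \<notin> U" for u w
    proof -
      have "flip \<kappa> K (lb u) = - lb u - \<kappa>" "flip \<kappa> K (lb w) = lb w"
        using inK[of u] inK[of w] uw by (auto simp: flip_def)
      then have "E (- lb u - \<kappa>) (lb w) = E (lb u) (lb w)"
        using inv[OF ij(1) lb(1)[of u] lb(1)[of w]] by (simp add: \<kappa>_def K_def)
      moreover have "- lb u - \<kappa> \<in> {-h..h}"
        using flip_range[of \<kappa> K "lb u"] lb(1) \<open>flip \<kappa> K (lb u) = - lb u - \<kappa>\<close> K(1) by (fastforce simp: \<kappa>_def)
      ultimately have "E (rep (- lb u - \<kappa>)) (rep (lb w)) = E (rep (lb u)) (rep (lb w))"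
        using rep_eqI[OF _ cong_refl] lb(1)[of u] lb(1)[of w] by simp
      then have "e ((- lb u - \<kappa>) - lb w) = e (lb u - lb w)" by (simp only: Ne)
      moreover have "(- lb u - \<kappa>) - lb w = - (lb u + \<kappa> + lb w)" by simp
      ultimately have "e (- (lb u + \<kappa> + lb w)) = e (lb u - lb w)" by (simp only:)
      then have eq: "e2 (2 * (lb u + \<kappa> + lb w)) = e2 (2 * (lb u - lb w))" by (simp only: e_even e2)
      have "[(2 * lb u + \<kappa>) + (2 * lb w + \<kappa>) = u + w] (mod int p)" by (intro cong_add lb)
      then have 1: "e2 (2 * (lb u + \<kappa> + lb w)) = e2 (u + w)" by (intro e2_cong) (simp add: algebra_simps)
      have "[(2 * lb u + \<kappa>) - (2 * lb w + \<kappa>) = u - w] (mod int p)" by (intro cong_diff lb)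
      then have 2: "e2 (2 * (lb u - lb w)) = e2 (u - w)" by (intro e2_cong) (simp add: algebra_simps)
      show ?thesis using eq 1 2 by simp
    qed
    show "int i \<in> U" using ij(1) by (auto simp: U_def K_def same_cv_def intro!: bexI[of _ i])
    show "int j \<notin> U"
    proof
      assume "int j \<in> U"
      then obtain k where k: "k \<in> K" "[int j = int k] (mod int p) \<or> [int j = - int k] (mod int p)" by (auto simp: U_def)
      have b: "k \<in> {1..<p}" "cv k = cv i" "k mod 2 = j mod 2" using K[OF k(1)] ij(3) by (auto simp: \<kappa>_def)
      from k(2) show False
      proof
        assume "[int j = int k] (mod int p)"
        then have "j = k" using b(1) ij(2) by (simp add: cong_int_iff cong_less_modulus_unique_nat)
        then show False using b(2) ij(4) by simp
      next
        \<comment> \<open>The size bounds leave only j + k = p, which is odd, while j and k have the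
          same parity.\<close>
        assume "[int j = - int k] (mod int p)"
        then have "p dvd j + k" by (simp add: cong_iff_dvd_diff flip: of_nat_add)
        then obtain q where q: "j + k = p * q" by blast
        have "j + k < p * 2" "j + k > 0" using b(1) ij(2) by auto
        then have "q = 1" using q by (cases q) auto
        then have "odd (j + k)" using odd_p unfolding q by simp
        moreover have "even j = even k" by (simp only: even_iff_mod_2_eq_zero b(3))
        ultimately show False by simp
      qed
    qed
    show "\<not> int p dvd int j" using ij(2) by (auto dest: dvd_imp_le)
  qed (rule that)
  \<comment> \<open>\<open>e d\<close> equals \<open>e2 (2 * d)\<close>, and p, being odd, does not
    divide 2 d either.\<close>
  then have const: "e d = e2 1" if "\<not> int p dvd d" for d
    using e2[of d] that p odd_p by (metis coprime_commute coprime_left_2_iff_odd coprime_dvd_mult_right_iff even_of_nat_iff)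
  show thesis
  proof (rule that[of "e 0" "e2 1"])
    fix l m assume lm: "l \<in> {-h..h}" "m \<in> {-h..h}"
    have El: "E l m = e (l - m)" using lm rep_eqI[OF _ cong_refl] by (simp flip: Ne)
    have "\<not> int p dvd l - m" if "l \<noteq> m" using label_cong_imp_eq[OF lm] that by (auto simp: cong_iff_dvd_diff)
    then show "E l m = (if l = m then e 0 else e2 1)" using El const by auto
  qed
qed

end

section \<open>Linear relations between the roots\<close>

lemma subspace_projection:
  fixes A :: "'a::euclidean_space set"
  assumes "subspace A"
  obtains q where "\<And>x. q x \<in> A" "\<And>x w. w \<in> A \<Longrightarrow> (x - q x) \<bullet> w = 0"
proof -
  have "\<exists>y. y \<in> A \<and> (\<forall>w\<in>A. (x - y) \<bullet> w = 0)" for x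
  proof -
    obtain y z where "y \<in> span A" "\<And>w. w \<in> span A \<Longrightarrow> orthogonal z w" "x = y + z"
      by (rule orthogonal_subspace_decomp_exists[of A x]) blast
    moreover have "span A = A" using assms by simp
    ultimately show ?thesis by (intro exI[of _ y]) (auto simp: orthogonal_def)
  qed
  then show thesis using that by metis
qed

context real_rooted
begin

text \<open>The flips permute coordinates, hence are orthogonal, and they preserve the space
  \<open>A\<close> of relations; so they commute with the orthogonal projection onto
  \<open>A\<close>. Its matrix therefore has one value on the diagonal and one off it. If these
  agree, the columns are constant vectors, and a nonzero one contradicts the nonzero sum of the
  roots; if not, \<open>A\<close> contains a difference of two unit vectors, and two roots would
  coincide.\<close>

lemma relation_trivial:
  fixes lbl :: "'n::finite \<Rightarrow> int" and a :: "real^'n"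
  assumes p: "prime p" and lbl: "bij_betw lbl (UNIV::'n set) {-h..h}"
    and sum_ne: "(\<Sum>j<p. c j) \<noteq> 0"
    and ij: "i \<in> {1..<p}" "j \<in> {1..<p}" "i mod 2 = j mod 2" "cv i \<noteq> cv j"
    and rel: "\<And>t. Im t > 0 \<Longrightarrow> (\<Sum>i\<in>UNIV. of_real (a $ i) * X t (lbl i)) = 0"
  shows "a = 0"
proof -
  define A where "A = {a::real^'n. \<forall>t. Im t > 0 \<longrightarrow> (\<Sum>i\<in>UNIV. of_real (a $ i) * X t (lbl i)) = 0}"
  have sA: "subspace A"
  proof (rule subspaceI)
    fix x y :: "real^'n" and r :: real
    assume x: "x \<in> A"
    have "(\<Sum>i\<in>UNIV. of_real ((r *\<^sub>R x) $ i) * X t (lbl i)) = of_real r * (\<Sum>i\<in>UNIV. of_real (x $ i) * X t (lbl i))" for t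
      by (simp add: sum_distrib_left mult.assoc)
    then show "r *\<^sub>R x \<in> A" using x by (simp add: A_def del: vector_scaleR_component)
    assume y: "y \<in> A"
    have "(\<Sum>i\<in>UNIV. of_real ((x + y) $ i) * X t (lbl i)) =
        (\<Sum>i\<in>UNIV. of_real (x $ i) * X t (lbl i)) + (\<Sum>i\<in>UNIV. of_real (y $ i) * X t (lbl i))" for t
      by (simp add: sum.distrib distrib_right)
    then show "x + y \<in> A" using x y by (simp add: A_def del: vector_add_component)
  qed (simp add: A_def)
  obtain q where q: "\<And>x. q x \<in> A" "\<And>x w. w \<in> A \<Longrightarrow> (x - q x) \<bullet> w = 0"
    using subspace_projection[OF sA] by blast
  have q_unique: "y = q x" if "y \<in> A" "\<And>w. w \<in> A \<Longrightarrow> (x - y) \<bullet> w = 0" for x y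
  proof -
    have d: "y - q x \<in> A" using that(1) q(1) sA by (intro subspace_diff)
    have "(y - q x) \<bullet> (y - q x) = (x - q x) \<bullet> (y - q x) - (x - y) \<bullet> (y - q x)"
      by (simp add: inner_diff_left)
    also have "\<dots> = 0" using q(2)[OF d] that(2)[OF d] by simp
    finally show ?thesis by simp
  qed
  define il where "il = inv_into UNIV lbl"
  have inj: "inj lbl" and range: "range lbl = {-h..h}" using lbl by (auto simp: bij_betw_def)
  have il: "lbl (il l) = l" if "l \<in> {-h..h}" for l using that range by (simp add: il_def f_inv_into_f)
  have il': "il (lbl i) = i" for i using inj by (simp add: il_def)
  have lblI: "lbl i \<in> {-h..h}" for i using range by blast
  define \<phi> where "\<phi> k = flip (int (k mod 2)) (same_cv k)" for k
  have \<phi>r: "\<phi> k l \<in> {-h..h}" if "l \<in> {-h..h}" for k l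
    unfolding \<phi>_def by (rule flip_range[OF _ _ that]) (auto simp: same_cv_def)
  define \<sigma> where "\<sigma> k i = il (\<phi> k (lbl i))" for k i
  have lbl\<sigma>: "lbl (\<sigma> k i) = \<phi> k (lbl i)" for k i by (simp add: \<sigma>_def il \<phi>r lblI del: atLeastAtMost_iff)
  have \<sigma>\<sigma>: "\<sigma> k (\<sigma> k i) = i" for k i
    using inj lbl\<sigma>[of k "\<sigma> k i"] lbl\<sigma>[of k i] by (simp add: \<phi>_def flip_flip inj_eq)
  have bij\<sigma>: "bij (\<sigma> k)" for k by (rule involuntory_imp_bij) (rule \<sigma>\<sigma>)
  define R where "R k x = (\<chi> i. x $ (\<sigma> k i))" for k and x :: "real^'n"
  have RR: "R k (R k x) = x" for k x by (simp add: R_def \<sigma>\<sigma>)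
  have R_inner: "R k x \<bullet> R k y = x \<bullet> y" for k x y
    unfolding inner_vec_def R_def
    by (simp add: sum.reindex_bij_betw[OF bij\<sigma>, of "\<lambda>i. x $ i * y $ i" k])
  have R_diff: "R k x - R k y = R k (x - y)" for k x y by (simp add: R_def vec_eq_iff)
  have RA: "R k b \<in> A" if k: "k \<in> {1..<p}" and b: "b \<in> A" for k b
    unfolding A_def
  proof (intro CollectI allI impI)
    fix t assume t: "Im t > 0"
    have *: "(\<Sum>l\<in>{-h..h}. of_real (b $ il l) * X u (g l)) = (\<Sum>i\<in>UNIV. of_real (b $ i) * X u (g (lbl i)))" for u g
      using sum.reindex_bij_betw[OF lbl, of "\<lambda>l. of_real (b $ il l) * X u (g l)"] by (simp add: il')
    have "(\<Sum>l\<in>{-h..h}. of_real (b $ il l) * X t (\<phi> k l)) = 0"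
      unfolding \<phi>_def by (rule relation_flip[OF k _ t]) (use b *[of _ "\<lambda>l. l"] in \<open>simp add: A_def\<close>)
    then have "(\<Sum>i\<in>UNIV. of_real (b $ i) * X t (lbl (\<sigma> k i))) = 0" by (simp add: * lbl\<sigma>)
    also have "(\<Sum>i\<in>UNIV. of_real (b $ i) * X t (lbl (\<sigma> k i))) = (\<Sum>i\<in>UNIV. of_real (b $ \<sigma> k i) * X t (lbl i))"
      using sum.reindex_bij_betw[OF bij\<sigma>, of "\<lambda>i. of_real (b $ \<sigma> k i) * X t (lbl i)" k] by (simp add: \<sigma>\<sigma>)
    finally show "(\<Sum>i\<in>UNIV. of_real (R k b $ i) * X t (lbl i)) = 0" by (simp add: R_def)
  qed
  have R_q: "R k (q x) = q (R k x)" if k: "k \<in> {1..<p}" for k x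
  proof (rule q_unique[OF RA[OF k q(1)]])
    fix w assume "w \<in> A"
    then have "(x - q x) \<bullet> R k w = 0" using RA[OF k] q(2) by blast
    moreover have "(R k x - R k (q x)) \<bullet> w = (x - q x) \<bullet> R k w"
      using R_inner[of k "x - q x" "R k w"] by (simp add: R_diff RR)
    ultimately show "(R k x - R k (q x)) \<bullet> w = 0" by simp
  qed
  have R_axis: "R k (axis i 1) = axis (\<sigma> k i) 1" for k i
  proof -
    have "\<sigma> k j = i \<longleftrightarrow> j = \<sigma> k i" for j by (metis \<sigma>\<sigma>)
    then show ?thesis by (auto simp: R_def vec_eq_iff axis_def)
  qed
  \<comment> \<open>The Gram matrix of the projected unit vectors. An orthogonal projection is
    symmetric and idempotent, so this is also its matrix, and the invariance under isometries is
    visible in this form.\<close>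
  define E where "E l m = q (axis (il l) 1) \<bullet> q (axis (il m) 1)" for l m
  have "E (\<phi> k l) (\<phi> k m) = E l m"
    if "k \<in> {1..<p}" "l \<in> {-h..h}" "m \<in> {-h..h}" for k l m
  proof -
    have "il (\<phi> k l) = \<sigma> k (il l)" "il (\<phi> k m) = \<sigma> k (il m)"
      using il[OF that(2)] il[OF that(3)] by (simp_all add: \<sigma>_def)
    then show ?thesis by (simp add: E_def R_inner flip: R_axis R_q[OF that(1)])
  qed
  then obtain \<beta> \<gamma> where E: "\<And>l m. l \<in> {-h..h} \<Longrightarrow> m \<in> {-h..h} \<Longrightarrow> E l m = (if l = m then \<gamma> else \<beta>)"
    unfolding \<phi>_def using flip_invariant_constant[OF p _ ij, of E] by blast
  have comp: "b $ i = b \<bullet> q (axis i 1)" if "b \<in> A" for b i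
  proof -
    have "axis i 1 \<bullet> b = q (axis i 1) \<bullet> b" using q(2)[OF that, of "axis i 1"] by (simp add: inner_diff_left)
    then show ?thesis unfolding inner_commute[of b] by (simp add: inner_axis')
  qed
  have qc: "q (axis i 1) $ j = (if i = j then \<gamma> else \<beta>)" for i j
    using comp[OF q(1)[of "axis i 1"], of j] E[OF lblI[of i] lblI[of j]] inj
    by (simp add: E_def il' inj_eq)
  have cardn: "CARD('n) = p" using bij_betw_same_card[OF lbl] p_eq by simp
  \<comment> \<open>A sample point; any other point of the upper half plane would serve.\<close>
  have t0: "Im \<i> > 0" by simp
  have injX: "inj_on (\<lambda>i. X \<i> (lbl i)) UNIV"
    by (intro inj_onI injD[OF inj]) (use X_inj[OF t0 lblI lblI] in blast)
  show ?thesis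
  proof (cases "\<gamma> = \<beta>")
    case True
    have "(\<Sum>i\<in>UNIV. of_real \<beta> * X \<i> (lbl i)) = 0"
    proof -
      have "q (axis undefined 1) $ i = \<beta>" for i using True by (simp add: qc)
      moreover have "(\<Sum>i\<in>UNIV. of_real (q (axis undefined 1) $ i) * X \<i> (lbl i)) = 0"
        using q(1)[of "axis undefined 1"] t0 unfolding A_def by blast
      ultimately show ?thesis by simp
    qed
    moreover have "(\<Sum>i\<in>UNIV. X \<i> (lbl i)) = of_real (\<Sum>j<p. c j)"
      by (rule sum_fibre[of _ _ \<i>]) (use injX cardn X(1)[OF t0 lblI] in auto)
    ultimately have "of_real \<beta> * complex_of_real (\<Sum>j<p. c j) = 0" by (metis sum_distrib_left)
    then have "\<beta> = 0" using sum_ne by (metis mult_eq_0_iff of_real_eq_0_iff)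
    then have q0: "q (axis i 1) = 0" for i using True by (simp add: vec_eq_iff qc)
    have "a \<in> A" using rel by (simp add: A_def)
    then have "a $ i = 0" for i using comp[of a i] unfolding q0 by simp
    then show ?thesis by (simp add: vec_eq_iff)
  next
    case False
    obtain i1 i2 :: 'n where i12: "i1 \<noteq> i2"
    proof -
      have "\<not> is_singleton (UNIV :: 'n set)" using cardn p_ge by (simp add: is_singleton_altdef)
      then show thesis using that unfolding is_singleton_def by blast
    qed
    \<comment> \<open>Off the diagonal the two columns agree, so their difference is
      \<open>\<gamma> - \<beta>\<close> times the difference of the unit vectors at
      \<open>i1\<close> and \<open>i2\<close>.\<close>
    have "q (axis i1 1) - q (axis i2 1) \<in> A" using q(1) sA by (intro subspace_diff)
    then have "(\<Sum>i\<in>UNIV. of_real ((q (axis i1 1) - q (axis i2 1)) $ i) * X \<i> (lbl i)) = 0"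
      using t0 unfolding A_def by blast
    also have "(\<Sum>i\<in>UNIV. of_real ((q (axis i1 1) - q (axis i2 1)) $ i) * X \<i> (lbl i)) =
        (\<Sum>i\<in>UNIV. (if i = i1 then of_real (\<gamma> - \<beta>) * X \<i> (lbl i) else 0) + (if i = i2 then of_real (\<beta> - \<gamma>) * X \<i> (lbl i) else 0))"
      using i12 by (intro sum.cong) (auto simp: qc)
    also have "\<dots> = of_real (\<gamma> - \<beta>) * (X \<i> (lbl i1) - X \<i> (lbl i2))"
      by (simp add: sum.distrib algebra_simps)
    finally have "X \<i> (lbl i1) = X \<i> (lbl i2)" using False by simp
    then show ?thesis using injX i12 by (auto simp: inj_on_def)
  qed
qed

end

section \<open>The resolvent as a polynomial in t\<close>

lemma holomorphic_mult_eq_0: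
  assumes f: "f holomorphic_on S" and g: "g holomorphic_on S" and S: "open S" "connected S"
    and fg: "\<And>z. z \<in> S \<Longrightarrow> f z * g z = 0"
  shows "(\<forall>z\<in>S. f z = 0) \<or> (\<forall>z\<in>S. g z = 0)"
proof (rule disjCI)
  assume "\<not> (\<forall>z\<in>S. g z = 0)"
  then obtain w where w: "w \<in> S" "g w \<noteq> 0" by blast
  define N where "N = {z \<in> S. g z \<noteq> 0}"
  have "open N"
    using continuous_open_preimage[OF holomorphic_on_imp_continuous_on[OF g] S(1), of "- {0}"]
    by (auto simp: N_def vimage_def Int_def)
  moreover have "f z = 0" if "z \<in> N" for z using fg[of z] that by (auto simp: N_def)
  ultimately show "\<forall>z\<in>S. f z = 0"
    using analytic_continuation_open[of N S f "\<lambda>_. 0"] f S w by (auto simp: N_def)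
qed

lemma holomorphic_prod_eq_0:
  assumes "finite A" and "\<And>i. i \<in> A \<Longrightarrow> f i holomorphic_on S" and S: "open S" "connected S" "S \<noteq> {}"
    and "\<And>z. z \<in> S \<Longrightarrow> (\<Prod>i\<in>A. f i z) = 0"
  shows "\<exists>i\<in>A. \<forall>z\<in>S. f i z = 0"
  using assms(1,2,6)
proof (induction A)
  case empty
  then show ?case using S(3) by auto
next
  case (insert a A)
  have "(\<forall>z\<in>S. f a z = 0) \<or> (\<forall>z\<in>S. (\<Prod>i\<in>A. f i z) = 0)"
    by (rule holomorphic_mult_eq_0[OF _ _ S(1,2)]) (use insert in \<open>auto intro!: holomorphic_intros\<close>)
  then show ?case using insert by auto
qed

text \<open>A nonzero polynomial vanishes at 0 to an order at most its degree, and the cofactor of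
  that power of z has a nonzero limit at 0.\<close>

lemma poly_eq_0_if_high_order:
  fixes G :: "complex poly"
  assumes "degree G < N" and "eventually (\<lambda>z. cmod (poly G z) \<le> C * cmod z ^ N) (at 0)"
  shows "G = 0"
proof (rule ccontr)
  assume "G \<noteq> 0"
  then obtain q where q: "G = [:-0,1:] ^ order 0 G * q" "\<not> [:-0,1:] dvd q"
    using order_decomp by blast
  define m where "m = order 0 G"
  have m: "m < N" using order_degree[OF \<open>G \<noteq> 0\<close>, of 0] assms(1) by (simp add: m_def)
  have Gz: "poly G z = z ^ m * poly q z" for z by (subst q(1)) (simp add: m_def)
  have "eventually (\<lambda>z. cmod (poly q z) \<le> C * cmod z ^ (N - m)) (at 0)"
    using assms(2) eventually_neq_at_within[of 0 0 UNIV]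
  proof eventually_elim
    case (elim z)
    have "cmod z ^ m * cmod (poly q z) \<le> cmod z ^ m * (C * cmod z ^ (N - m))"
      using elim(1) m by (simp add: Gz norm_mult norm_power mult_ac flip: power_add)
    then show ?case using elim(2) by simp
  qed
  moreover have "((\<lambda>z. cmod (poly q z)) \<longlongrightarrow> cmod (poly q 0)) (at 0)"
    by (intro tendsto_norm) (metis isCont_def poly_isCont)
  moreover have "((\<lambda>z::complex. C * cmod z ^ (N - m)) \<longlongrightarrow> C * cmod 0 ^ (N - m)) (at 0)"
    by (intro tendsto_intros)
  ultimately have "cmod (poly q 0) \<le> C * cmod 0 ^ (N - m)"
    by (intro tendsto_le[OF trivial_limit_at])
  then have "poly q 0 = 0" using m by (simp add: power_0_left)
  then show False using q(2) by (simp add: poly_eq_0_iff_dvd)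
qed

context real_rooted
begin

lemma card_fibre_le: "card {z. poly F z = t} \<le> p"
proof -
  have "F - [:t:] \<noteq> 0" using degree_F_minus_const[of t] p_pos by auto
  from card_poly_roots_bound[OF this] show ?thesis by (simp add: degree_F_minus_const)
qed

lemma enumerates_fibre:
  fixes y :: "'n::finite \<Rightarrow> complex"
  assumes "CARD('n) = p" "inj y" "\<And>i. poly F (y i) = t"
  shows "bij_betw y UNIV {z. poly F z = t}"
proof -
  have "y ` UNIV = {z. poly F z = t}"
    by (rule card_seteq) (use assms card_fibre_le[of t] in \<open>auto simp: card_image finite_fibre\<close>)
  then show ?thesis using assms(2) by (simp add: bij_betw_def)
qed

lemma local_enumeration:
  fixes y :: "'n::finite \<Rightarrow> complex"
  assumes card: "CARD('n) = p" and y: "inj y" "\<And>i. poly F (y i) = t0"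
    and nc: "\<And>i. poly (pderiv F) (y i) \<noteq> 0"
  shows "\<exists>\<delta> Y. \<delta> > 0 \<and> (\<forall>i. Y i holomorphic_on ball t0 \<delta> \<and> Y i t0 = y i) \<and>
    (\<forall>t\<in>ball t0 \<delta>. bij_betw (\<lambda>i. Y i t) UNIV {z. poly F z = t})"
proof -
  \<comment> \<open>At most half the least distance between two of the roots, so that the branches
    stay in disjoint balls. The inserted 1 keeps the set nonempty.\<close>
  define e where "e = Min (insert 1 ((\<lambda>(i, j). dist (y i) (y j) / 2) ` {(i, j). i \<noteq> j}))"
  have fin: "finite ((\<lambda>(i, j). dist (y i) (y j) / 2) ` {(i::'n, j). i \<noteq> j})" by simp
  have e: "e > 0" unfolding e_def using y(1) by (subst Min_gr_iff) (auto simp: inj_eq)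
  have sep: "e \<le> dist (y i) (y j) / 2" if "i \<noteq> j" for i j
    unfolding e_def using that by (intro Min_le) auto
  have "\<exists>\<delta> g. \<delta> > 0 \<and> g holomorphic_on ball t0 \<delta> \<and> g t0 = y i \<and>
      (\<forall>t\<in>ball t0 \<delta>. g t \<in> ball (y i) e \<and> poly F (g t) = t)" for i
  proof -
    have "deriv (poly F) (y i) \<noteq> 0" using nc by (simp add: deriv_poly)
    from holomorphic_local_inverse[OF holomorphic_poly open_UNIV UNIV_I this e]
    obtain \<delta> g where "\<delta> > 0" "g holomorphic_on ball (poly F (y i)) \<delta>" "g (poly F (y i)) = y i"
      "\<And>t. t \<in> ball (poly F (y i)) \<delta> \<Longrightarrow> g t \<in> UNIV \<inter> ball (y i) e \<and> poly F (g t) = t"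
      by metis
    then show ?thesis unfolding y(2) by blast
  qed
  then obtain D Y where DY: "\<And>i. D i > 0" "\<And>i. Y i holomorphic_on ball t0 (D i)" "\<And>i. Y i t0 = y i"
    "\<And>i t. t \<in> ball t0 (D i) \<Longrightarrow> Y i t \<in> ball (y i) e \<and> poly F (Y i t) = t" by metis
  define \<delta> where "\<delta> = Min (range D)"
  have \<delta>: "\<delta> > 0" "\<And>i. \<delta> \<le> D i" using DY(1) by (auto simp: \<delta>_def)
  then have sub: "ball t0 \<delta> \<subseteq> ball t0 (D i)" for i by (simp add: subset_ball)
  show ?thesis
  proof (intro exI[of _ \<delta>] exI[of _ Y] conjI allI ballI)
    show "\<delta> > 0" by (rule \<delta>)
    show "Y i holomorphic_on ball t0 \<delta>" for i using DY(2) sub holomorphic_on_subset by blast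
    show "Y i t0 = y i" for i by (rule DY)
    fix t assume t: "t \<in> ball t0 \<delta>"
    have Yt: "Y i t \<in> ball (y i) e" "poly F (Y i t) = t" for i
      using DY(4)[OF subsetD[OF sub t], of i] by auto
    have "inj (\<lambda>i. Y i t)"
    proof (rule injI, rule ccontr)
      fix i j assume eq: "Y i t = Y j t" and ne: "i \<noteq> j"
      have "dist (y i) (y j) \<le> dist (y i) (Y i t) + dist (y j) (Y i t)" by (rule dist_triangle2)
      also have "\<dots> < e + e" using Yt(1)[of i] Yt(1)[of j] eq by (intro add_strict_mono) auto
      finally show False using sep[OF ne] by simp
    qed
    then show "bij_betw (\<lambda>i. Y i t) UNIV {z. poly F z = t}"
      by (rule enumerates_fibre[OF card]) (rule Yt)
  qed
qed

text \<open>The product over all enumerations of the roots of F = t is symmetric in the roots, so it is a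
  polynomial in t; its degree is at most fact p / p, as the roots grow like the p-th root of t.\<close>

definition resolvent :: "real^'n \<Rightarrow> complex \<Rightarrow> complex" where
  "resolvent a t = (\<Prod>g\<in>{g :: 'n \<Rightarrow> complex. bij_betw g UNIV {z. poly F z = t}}. \<Sum>i\<in>UNIV. of_real (a $ i) * g i)"

lemma resolvent_eq:
  fixes y :: "'n::finite \<Rightarrow> complex"
  assumes y: "bij_betw y UNIV {z. poly F z = t}"
  shows "resolvent a t = (\<Prod>\<sigma>\<in>{\<sigma>. \<sigma> permutes UNIV}. \<Sum>i\<in>UNIV. of_real (a $ i) * y (\<sigma> i))"
proof -
  have inj: "inj y" using y by (simp add: bij_betw_def)
  have "bij_betw (\<lambda>\<sigma>. y \<circ> \<sigma>) {\<sigma>. \<sigma> permutes UNIV} {g. bij_betw g UNIV {z. poly F z = t}}"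
  proof (intro bij_betw_imageI equalityI subsetI)
    show "inj_on (\<lambda>\<sigma>. y \<circ> \<sigma>) {\<sigma>. \<sigma> permutes UNIV}"
      by (rule inj_onI) (use inj in \<open>auto simp: fun_eq_iff inj_eq\<close>)
  next
    fix g assume "g \<in> (\<lambda>\<sigma>. y \<circ> \<sigma>) ` {\<sigma>. \<sigma> permutes UNIV}"
    then obtain \<sigma> where "\<sigma> permutes UNIV" "g = y \<circ> \<sigma>" by blast
    then show "g \<in> {g. bij_betw g UNIV {z. poly F z = t}}"
      using bij_betw_trans[OF permutes_imp_bij y] by simp
  next
    fix g :: "'n \<Rightarrow> complex" assume "g \<in> {g. bij_betw g UNIV {z. poly F z = t}}"
    then have g: "bij_betw g UNIV {z. poly F z = t}" by simp
    define \<sigma> where "\<sigma> = inv_into UNIV y \<circ> g"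
    have "bij \<sigma>" unfolding \<sigma>_def by (rule bij_betw_trans[OF g bij_betw_inv_into[OF y]])
    then have "\<sigma> permutes UNIV" by (rule bij_imp_permutes) auto
    moreover have "y (\<sigma> i) = g i" for i
      unfolding \<sigma>_def comp_def by (rule f_inv_into_f) (use g y in \<open>auto simp: bij_betw_def\<close>)
    ultimately show "g \<in> (\<lambda>\<sigma>. y \<circ> \<sigma>) ` {\<sigma>. \<sigma> permutes UNIV}"
      by (intro image_eqI[of _ _ \<sigma>]) (auto simp: fun_eq_iff)
  qed
  from prod.reindex_bij_betw[OF this, of "\<lambda>g. \<Sum>i\<in>UNIV. of_real (a $ i) * g i"]
  show ?thesis by (simp add: resolvent_def)
qed

lemma fibre_enumeration:
  assumes card: "CARD('n::finite) = p" and nc: "\<And>z. poly F z = t \<Longrightarrow> poly (pderiv F) z \<noteq> 0"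
  obtains y :: "'n::finite \<Rightarrow> complex" where "bij_betw y UNIV {z. poly F z = t}"
proof -
  have "card {z. poly F z = t} = p" by (rule card_fibre) (rule nc)
  then have "\<exists>y :: 'n \<Rightarrow> complex. bij_betw y UNIV {z. poly F z = t}"
    using card by (intro finite_same_card_bij) (auto simp: finite_fibre)
  then show thesis using that by blast
qed

text \<open>A root of large modulus is at least half that modulus away from every
  \<open>c j\<close>; for the remaining roots a constant bound suffices because
  \<open>cmod t \<ge> 1\<close>.\<close>

lemma root_power_bound:
  assumes t: "cmod t \<ge> 1" and z: "poly F z = t"
  shows "cmod z ^ p \<le> (2 * ((\<Sum>j<p. \<bar>c j\<bar>) + 1)) ^ p * cmod t"
proof -
  define S where "S = (\<Sum>j<p. \<bar>c j\<bar>) + 1"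
  have S: "S \<ge> 1" by (simp add: S_def sum_nonneg)
  show ?thesis
  proof (cases "cmod z \<ge> 2 * S")
    case True
    have "cmod z / 2 \<le> cmod (z - of_real (c j))" if "j < p" for j
    proof -
      have "\<bar>c j\<bar> \<le> (\<Sum>j<p. \<bar>c j\<bar>)" using that by (intro member_le_sum) auto
      moreover have "cmod z - \<bar>c j\<bar> \<le> cmod (z - of_real (c j))" by (metis norm_of_real norm_triangle_ineq2)
      ultimately show ?thesis using True by (simp add: S_def)
    qed
    then have "(\<Prod>j<p. cmod z / 2) \<le> (\<Prod>j<p. cmod (z - of_real (c j)))" by (intro prod_mono) auto
    then have "(cmod z / 2) ^ p \<le> cmod t" using z by (simp add: poly_F prod_norm)
    then have "cmod z ^ p \<le> 2 ^ p * cmod t" by (simp add: power_divide field_simps)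
    also have "\<dots> \<le> (2 * S) ^ p * cmod t" using S by (intro mult_right_mono power_mono) auto
    finally show ?thesis by (simp add: S_def)
  next
    case False
    then have "cmod z ^ p \<le> (2 * S) ^ p" by (intro power_mono) auto
    also have "\<dots> \<le> (2 * S) ^ p * cmod t" using S t by simp
    finally show ?thesis by (simp add: S_def)
  qed
qed

definition crit_values :: "complex set" where
  "crit_values = (\<lambda>k. of_real (cv k)) ` {1..<p}"

lemma finite_crit_values: "finite crit_values"
  by (simp add: crit_values_def)

lemma noncritical: "t \<notin> crit_values \<Longrightarrow> poly F z = t \<Longrightarrow> poly (pderiv F) z \<noteq> 0"
  by (auto simp: critical_iff crit_values_def poly_F_of_real cv_def)

lemma resolvent_holomorphic:
  fixes a :: "real^'n::finite"
  assumes card: "CARD('n) = p"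
  shows "resolvent a holomorphic_on (UNIV - crit_values)"
proof -
  have "resolvent a analytic_on (UNIV - crit_values)" unfolding analytic_on_def
  proof
    fix t0 assume "t0 \<in> UNIV - crit_values"
    then have "t0 \<notin> crit_values" by simp
    note nc = noncritical[OF this]
    obtain y :: "'n \<Rightarrow> complex" where y: "bij_betw y UNIV {z. poly F z = t0}"
      by (rule fibre_enumeration[OF card nc])
    have y': "inj y" "\<And>i. poly F (y i) = t0" using bij_betw_imp_inj_on[OF y] bij_betwE[OF y] by auto
    from local_enumeration[OF card y' nc[OF y'(2)]] obtain \<delta> Y where
      "\<delta> > 0 \<and> (\<forall>i. Y i holomorphic_on ball t0 \<delta> \<and> Y i t0 = y i) \<and>
        (\<forall>t\<in>ball t0 \<delta>. bij_betw (\<lambda>i. Y i t) UNIV {z. poly F z = t})" by (elim exE)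
    then have Y: "\<delta> > 0" "\<And>i. Y i holomorphic_on ball t0 \<delta>"
      "\<And>t. t \<in> ball t0 \<delta> \<Longrightarrow> bij_betw (\<lambda>i. Y i t) UNIV {z. poly F z = t}" by simp_all
    have "(\<lambda>t. \<Prod>\<sigma>\<in>{\<sigma>. \<sigma> permutes UNIV}. \<Sum>i\<in>UNIV. of_real (a $ i) * Y (\<sigma> i) t) holomorphic_on ball t0 \<delta>"
      by (intro holomorphic_intros Y)
    then have "resolvent a holomorphic_on ball t0 \<delta>"
    proof (rule holomorphic_transform)
      fix t assume "t \<in> ball t0 \<delta>"
      from resolvent_eq[OF Y(3)[OF this], of a]
      show "(\<Prod>\<sigma>\<in>{\<sigma>. \<sigma> permutes UNIV}. \<Sum>i\<in>UNIV. of_real (a $ i) * Y (\<sigma> i) t) = resolvent a t" by (rule sym)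
    qed
    then show "\<exists>e>0. resolvent a holomorphic_on ball t0 e" using Y(1) by blast
  qed
  then show ?thesis by (rule analytic_imp_holomorphic)
qed

lemma resolvent_norm_le:
  fixes a :: "real^'n::finite"
  assumes card: "CARD('n) = p" and t: "t \<notin> crit_values"
    and u: "\<And>z. poly F z = t \<Longrightarrow> cmod z \<le> u"
  shows "cmod (resolvent a t) \<le> ((\<Sum>i\<in>UNIV. \<bar>a $ i\<bar>) * u) ^ fact p"
proof -
  obtain y :: "'n \<Rightarrow> complex" where y: "bij_betw y UNIV {z. poly F z = t}"
    using fibre_enumeration[OF card noncritical[OF t]] by blast
  then have yb: "cmod (y i) \<le> u" for i using u by (auto simp: bij_betw_def)
  have "cmod (\<Sum>i\<in>UNIV. of_real (a $ i) * y (\<sigma> i)) \<le> (\<Sum>i\<in>UNIV. \<bar>a $ i\<bar>) * u" for \<sigma>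
  proof -
    have "cmod (\<Sum>i\<in>UNIV. of_real (a $ i) * y (\<sigma> i)) \<le> (\<Sum>i\<in>UNIV. \<bar>a $ i\<bar> * u)"
      by (rule sum_norm_le) (auto simp: norm_mult intro!: mult_left_mono yb)
    then show ?thesis by (simp add: sum_distrib_right)
  qed
  then have "cmod (resolvent a t) \<le> (\<Prod>\<sigma>\<in>{\<sigma>::'n\<Rightarrow>'n. \<sigma> permutes UNIV}. (\<Sum>i\<in>UNIV. \<bar>a $ i\<bar>) * u)"
    unfolding resolvent_eq[OF y] prod_norm[symmetric] by (intro prod_mono) auto
  also have "card {\<sigma>::'n\<Rightarrow>'n. \<sigma> permutes UNIV} = fact p"
    using card_permutations[of "UNIV :: 'n set" p] card by simp
  then have "(\<Prod>\<sigma>\<in>{\<sigma>::'n\<Rightarrow>'n. \<sigma> permutes UNIV}. (\<Sum>i\<in>UNIV. \<bar>a $ i\<bar>) * u) = ((\<Sum>i\<in>UNIV. \<bar>a $ i\<bar>) * u) ^ fact p"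
    by simp
  finally show ?thesis .
qed

lemma eventually_noncritical: "eventually (\<lambda>t. t \<notin> crit_values) (at z)"
proof -
  have "open (- (crit_values - {z}))" using finite_crit_values by (intro open_Compl finite_imp_closed) auto
  from eventually_at_in_open[OF this, of z] show ?thesis by (rule eventually_mono) auto
qed

text \<open>The resolvent is bounded near the finitely many critical values, so they are removable
  singularities; the growth bound and Liouville's theorem for polynomials do the rest.\<close>

lemma resolvent_polynomial:
  fixes a :: "real^'n::finite"
  assumes card: "CARD('n) = p"
  obtains G where "degree G \<le> fact (p - 1)" "\<And>t. t \<notin> crit_values \<Longrightarrow> resolvent a t = poly G t"
proof -
  define M where "M = (\<Sum>i\<in>UNIV. \<bar>a $ i\<bar>)"
  have M: "M \<ge> 0" by (simp add: M_def sum_nonneg)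
  define S where "S = (\<Sum>j<p. \<bar>c j\<bar>) + 1"
  have S: "S \<ge> 1" by (simp add: S_def sum_nonneg)
  have "resolvent a \<in> O[at z](\<lambda>_. 1)" for z
  proof (rule bigoI)
    have "eventually (\<lambda>t. t \<in> ball z 1) (at z)" by (rule eventually_at_in_open') auto
    with eventually_noncritical[of z]
    show "eventually (\<lambda>t. norm (resolvent a t) \<le> (M * (S + (cmod z + 1))) ^ fact p * norm (1::complex)) (at z)"
    proof eventually_elim
      case (elim t)
      have "cmod t \<le> cmod z + 1"
        using elim(2) norm_triangle_sub[of t z] by (simp add: dist_norm norm_minus_commute)
      then have "cmod w \<le> S + (cmod z + 1)" if "poly F w = t" for w
        using root_bound[of w "cmod z + 1"] that by (simp add: S_def)
      from resolvent_norm_le[OF card elim(1) this] show ?case by (simp add: M_def)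
    qed
  qed
  then obtain g where g: "g holomorphic_on UNIV" "\<And>t. t \<notin> crit_values \<Longrightarrow> g t = resolvent a t"
    using removable_singularities[of crit_values UNIV "resolvent a"] finite_crit_values
      resolvent_holomorphic[OF card] by auto
  obtain A0 where A0: "\<And>t. t \<in> crit_values \<Longrightarrow> cmod t \<le> A0"
    using finite_imp_bounded[OF finite_crit_values] unfolding bounded_iff by blast
  have growth: "cmod (g t) \<le> (M * (2 * S)) ^ fact p * cmod t ^ fact (p - 1)" if t: "max 1 (A0 + 1) \<le> cmod t" for t
  proof -
    have nc: "t \<notin> crit_values" using A0[of t] t by auto
    define u where "u = root p (cmod t)"
    have u: "u ^ p = cmod t" "u \<ge> 0" using p_pos by (auto simp: u_def)
    have "cmod z \<le> 2 * S * u" if "poly F z = t" for z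
    proof (rule power_le_imp_le_base)
      have "cmod z ^ p \<le> (2 * S) ^ p * u ^ p" using root_power_bound[OF _ that] t by (simp add: S_def u)
      then show "cmod z ^ Suc (p - 1) \<le> (2 * S * u) ^ Suc (p - 1)" using p_pos by (simp add: power_mult_distrib)
      show "0 \<le> 2 * S * u" using S u by simp
    qed
    from resolvent_norm_le[OF card nc this]
    have "cmod (g t) \<le> (M * (2 * S) * u) ^ fact p" by (simp add: g(2)[OF nc] M_def mult_ac)
    \<comment> \<open>\<open>u\<close> is the p-th root of \<open>cmod t\<close>, and grouping the
      p! factors into blocks of p gives the exponent (p - 1)!.\<close>
    also have "\<dots> = (M * (2 * S)) ^ fact p * (u ^ p) ^ fact (p - 1)"
    proof -
      have "fact p = p * fact (p - 1)" using p_pos by (simp add: fact_reduce)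
      then show ?thesis by (simp add: power_mult_distrib power_mult)
    qed
    finally show ?thesis by (simp add: u)
  qed
  define G where "G = (\<Sum>k\<le>fact (p - 1). monom ((deriv ^^ k) g 0 / fact k) k)"
  show thesis
  proof (rule that)
    show "degree G \<le> fact (p - 1)" unfolding G_def
      by (intro degree_sum_le) (auto intro: order.trans[OF degree_monom_le])
    fix t assume "t \<notin> crit_values"
    then have "resolvent a t = g t" by (simp add: g(2))
    also have "g t = (\<Sum>k\<le>fact (p - 1). (deriv ^^ k) g 0 / fact k * t ^ k)"
      by (rule Liouville_polynomial[OF g(1) growth])
    also have "\<dots> = poly G t" by (simp add: G_def poly_sum poly_monom)
    finally show "resolvent a t = poly G t" .
  qed
qed

lemma inj_c: "inj_on c {..<p}"
proof (rule inj_onI)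
  fix i j assume "i \<in> {..<p}" "j \<in> {..<p}" "c i = c j"
  then show "i = j" using dec[of i j] dec[of j i] by (cases i j rule: linorder_cases) auto
qed

text \<open>A factor that vanishes at t = 0 is O(t), since the branches are holomorphic there. So
  many such factors give the resolvent a zero of order above its degree, hence it is zero; on the
  connected upper half plane one of its holomorphic factors must then vanish identically.\<close>

lemma relation_if_many_zeros:
  fixes a :: "real^'n::finite" and e :: "'n \<Rightarrow> nat" and lbl :: "'n \<Rightarrow> int"
  assumes e: "bij_betw e (UNIV::'n set) {..<p}" and lbl: "bij_betw lbl (UNIV::'n set) {-h..h}"
    and many: "card {\<sigma>. \<sigma> permutes UNIV \<and> (\<Sum>i\<in>UNIV. a $ i * c (e (\<sigma> i))) = 0} > fact (p - 1)"
  obtains \<sigma> where "\<sigma> permutes UNIV" "\<And>t. Im t > 0 \<Longrightarrow> (\<Sum>i\<in>UNIV. of_real (a $ i) * X t (lbl (\<sigma> i))) = 0"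
proof -
  have card: "CARD('n) = p" using bij_betw_same_card[OF e] by simp
  obtain G where G: "degree G \<le> fact (p - 1)" "\<And>t. t \<notin> crit_values \<Longrightarrow> resolvent a t = poly G t"
    using resolvent_polynomial[OF card] by blast
  define y where "y i = complex_of_real (c (e i))" for i
  have eI: "e i < p" for i using e by (auto simp: bij_betw_def)
  have y: "inj y" "\<And>i. poly F (y i) = 0"
    using e inj_c eI by (auto simp: y_def bij_betw_def inj_on_def poly_F)
  \<comment> \<open>The roots of F are simple, so t = 0 is a regular value and the branches are
    holomorphic around it.\<close>
  have "(0::complex) \<notin> crit_values"
    using cv_sgn by (fastforce simp: crit_values_def)
  then have nc: "poly (pderiv F) (y i) \<noteq> 0" for i by (rule noncritical[OF _ y(2)])
  from local_enumeration[OF card y nc] obtain \<delta> Y where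
    "\<delta> > 0 \<and> (\<forall>i. Y i holomorphic_on ball 0 \<delta> \<and> Y i 0 = y i) \<and>
      (\<forall>t\<in>ball 0 \<delta>. bij_betw (\<lambda>i. Y i t) UNIV {z. poly F z = t})" by (elim exE)
  then have Y: "\<delta> > 0" "\<And>i. Y i holomorphic_on ball 0 \<delta>" "\<And>i. Y i 0 = y i"
    "\<And>t. t \<in> ball 0 \<delta> \<Longrightarrow> bij_betw (\<lambda>i. Y i t) UNIV {z. poly F z = t}" by simp_all
  define P where "P = {\<sigma>::'n\<Rightarrow>'n. \<sigma> permutes UNIV}"
  have finP: "finite P" by (simp add: P_def finite_permutations)
  define \<Phi> where "\<Phi> \<sigma> t = (\<Sum>i\<in>UNIV. of_real (a $ i) * Y (\<sigma> i) t)" for \<sigma> t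
  have hol\<Phi>: "\<Phi> \<sigma> holomorphic_on ball 0 \<delta>" for \<sigma>
    unfolding \<Phi>_def[abs_def] by (intro holomorphic_intros Y)
  define Z where "Z = {\<sigma> \<in> P. \<Phi> \<sigma> 0 = 0}"
  have "Z = {\<sigma>. \<sigma> permutes UNIV \<and> (\<Sum>i\<in>UNIV. a $ i * c (e (\<sigma> i))) = 0}"
  proof -
    have "\<Phi> \<sigma> 0 = of_real (\<Sum>i\<in>UNIV. a $ i * c (e (\<sigma> i)))" for \<sigma>
      by (simp add: \<Phi>_def Y(3) y_def)
    then show ?thesis by (auto simp: Z_def P_def simp del: of_real_sum)
  qed
  then have Z: "card Z > fact (p - 1)" using many by simp
  have "\<exists>B\<ge>0. eventually (\<lambda>t. cmod (\<Phi> \<sigma> t) \<le> B * (if \<sigma> \<in> Z then cmod t else 1)) (at 0)" for \<sigma>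
  proof (cases "\<sigma> \<in> Z")
    case True
    then have z: "\<Phi> \<sigma> 0 = 0" by (simp add: Z_def)
    have "(\<Phi> \<sigma> has_field_derivative deriv (\<Phi> \<sigma>) 0) (at 0)"
      using hol\<Phi> Y(1) by (intro holomorphic_derivI[of _ "ball 0 \<delta>"]) auto
    then have "((\<lambda>t. \<Phi> \<sigma> t / t) \<longlongrightarrow> deriv (\<Phi> \<sigma>) 0) (at 0)"
      by (simp add: DERIV_def z)
    then have "((\<lambda>t. cmod (\<Phi> \<sigma> t / t)) \<longlongrightarrow> cmod (deriv (\<Phi> \<sigma>) 0)) (at 0)" by (rule tendsto_norm)
    then have "eventually (\<lambda>t. cmod (\<Phi> \<sigma> t / t) < cmod (deriv (\<Phi> \<sigma>) 0) + 1) (at 0)"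
      by (rule order_tendstoD) simp
    then have "eventually (\<lambda>t. cmod (\<Phi> \<sigma> t) \<le> (cmod (deriv (\<Phi> \<sigma>) 0) + 1) * cmod t) (at 0)"
      using eventually_neq_at_within[of 0 0 UNIV]
    proof eventually_elim
      case (elim t)
      then show ?case by (simp add: norm_divide field_simps)
    qed
    then show ?thesis using True by (intro exI[of _ "cmod (deriv (\<Phi> \<sigma>) 0) + 1"]) auto
  next
    case False
    have "continuous_on (ball 0 \<delta>) (\<Phi> \<sigma>)" using hol\<Phi> by (rule holomorphic_on_imp_continuous_on)
    then have "isCont (\<Phi> \<sigma>) 0" using Y(1) by (simp add: continuous_on_eq_continuous_at)
    then have "((\<lambda>t. cmod (\<Phi> \<sigma> t)) \<longlongrightarrow> cmod (\<Phi> \<sigma> 0)) (at 0)"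
      unfolding isCont_def by (rule tendsto_norm)
    then have "eventually (\<lambda>t. cmod (\<Phi> \<sigma> t) < cmod (\<Phi> \<sigma> 0) + 1) (at 0)"
      by (rule order_tendstoD) simp
    then have "eventually (\<lambda>t. cmod (\<Phi> \<sigma> t) \<le> (cmod (\<Phi> \<sigma> 0) + 1) * 1) (at 0)"
      by (rule eventually_mono) simp
    then show ?thesis using False by (intro exI[of _ "cmod (\<Phi> \<sigma> 0) + 1"]) auto
  qed
  then obtain B where B: "\<And>\<sigma>. B \<sigma> \<ge> 0"
    "\<And>\<sigma>. eventually (\<lambda>t. cmod (\<Phi> \<sigma> t) \<le> B \<sigma> * (if \<sigma> \<in> Z then cmod t else 1)) (at 0)" by metis
  have "eventually (\<lambda>t. \<forall>\<sigma>\<in>P. cmod (\<Phi> \<sigma> t) \<le> B \<sigma> * (if \<sigma> \<in> Z then cmod t else 1)) (at 0)"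
    using finP B(2) by (intro eventually_ball_finite) auto
  moreover have "eventually (\<lambda>t. t \<in> ball 0 \<delta>) (at 0)" using Y(1) by (intro eventually_at_in_open') auto
  moreover note eventually_noncritical[of 0]
  ultimately have "eventually (\<lambda>t. cmod (poly G t) \<le> (\<Prod>\<sigma>\<in>P. B \<sigma>) * cmod t ^ card Z) (at 0)"
  proof eventually_elim
    case (elim t)
    have "poly G t = (\<Prod>\<sigma>\<in>P. \<Phi> \<sigma> t)"
      using G(2)[OF elim(3)] resolvent_eq[OF Y(4)[OF elim(2)]] by (simp add: P_def \<Phi>_def)
    then have "cmod (poly G t) = (\<Prod>\<sigma>\<in>P. cmod (\<Phi> \<sigma> t))" by (simp add: prod_norm)
    also have "\<dots> \<le> (\<Prod>\<sigma>\<in>P. B \<sigma> * (if \<sigma> \<in> Z then cmod t else 1))"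
      using elim(1) by (intro prod_mono) auto
    also have "\<dots> = (\<Prod>\<sigma>\<in>P. B \<sigma>) * (\<Prod>\<sigma>\<in>P. if \<sigma> \<in> Z then cmod t else 1)" by (rule prod.distrib)
    also have "(\<Prod>\<sigma>\<in>P. if \<sigma> \<in> Z then cmod t else 1) = (\<Prod>\<sigma>\<in>Z. cmod t)"
      using finP by (intro prod.mono_neutral_cong_right) (auto simp: Z_def)
    finally show ?case by simp
  qed
  then have "G = 0" by (rule poly_eq_0_if_high_order[rotated]) (use G(1) Z in linarith)
  have "\<exists>\<sigma>\<in>P. \<forall>t\<in>{t. Im t > 0}. (\<Sum>i\<in>UNIV. of_real (a $ i) * X t (lbl (\<sigma> i))) = 0"
  proof (rule holomorphic_prod_eq_0[OF finP _ upper_half_plane])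
    have lblI: "lbl i \<in> {-h..h}" for i using lbl by (auto simp: bij_betw_def)
    show "(\<lambda>t. \<Sum>i\<in>UNIV. of_real (a $ i) * X t (lbl (\<sigma> i))) holomorphic_on {t. Im t > 0}" for \<sigma>
      by (intro holomorphic_intros X_holomorphic lblI)
    have "\<i> \<in> {t. Im t > 0}" by simp
    then show "{t. Im t > 0} \<noteq> {}" by blast
    fix t assume "t \<in> {t. Im t > 0}"
    then have t: "Im t > 0" by simp
    have "t \<notin> crit_values" using t by (auto simp: crit_values_def)
    then have "resolvent a t = 0" by (simp add: G(2) \<open>G = 0\<close>)
    moreover have "bij_betw (\<lambda>i. X t (lbl i)) UNIV {z. poly F z = t}"
    proof (rule enumerates_fibre[OF card])
      show "inj (\<lambda>i. X t (lbl i))"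
      proof (rule injI)
        fix i j assume "X t (lbl i) = X t (lbl j)"
        then have "lbl i = lbl j" by (rule X_inj[OF t lblI lblI])
        then show "i = j" using lbl by (auto simp: bij_betw_def inj_eq)
      qed
      show "poly F (X t (lbl i)) = t" for i by (rule X(1)[OF t lblI])
    qed
    ultimately show "(\<Prod>\<sigma>\<in>P. \<Sum>i\<in>UNIV. of_real (a $ i) * X t (lbl (\<sigma> i))) = 0"
      by (simp add: resolvent_eq P_def)
  qed
  then show thesis using that by (auto simp: P_def)
qed

end

section \<open>Two critical values: the Chebyshev case\<close>

lemma prod_square_dvd:
  fixes P :: "complex poly"
  assumes "finite S" "P \<noteq> 0" "\<And>x. x \<in> S \<Longrightarrow> [:-x,1:] ^ 2 dvd P"
  shows "(\<Prod>x\<in>S. [:-x,1:]) ^ 2 dvd P"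
  using assms(1,3)
proof (induction S)
  case (insert a S)
  then obtain R where R: "P = (\<Prod>x\<in>S. [:-x,1:]) ^ 2 * R" by (auto elim: dvdE)
  define W where "W = (\<Prod>x\<in>S. [:-x,1:]) ^ 2"
  have "poly W a \<noteq> 0" using insert.hyps by (auto simp: W_def poly_power poly_prod)
  then have "order a W = 0" by (simp add: order_0I)
  moreover have "W * R \<noteq> 0" using assms(2) R by (simp add: W_def)
  ultimately have "order a P = order a R" using R by (simp add: order_mult W_def)
  moreover have "2 \<le> order a P" using insert.prems[of a] assms(2) by (simp add: order_divides)
  ultimately have "[:-a,1:] ^ 2 dvd R" by (simp add: order_divides)
  then have "[:-a,1:] ^ 2 * W dvd R * W" by (rule mult_dvd_mono) simp
  moreover have "(\<Prod>x\<in>insert a S. [:-x,1:]) ^ 2 = [:-a,1:] ^ 2 * W"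
    by (simp only: prod.insert[OF insert.hyps] power_mult_distrib W_def)
  moreover have "P = R * W" unfolding R W_def by (rule mult.commute)
  ultimately show ?case by (simp only:)
qed simp

context real_rooted
begin

lemma double_root_dvd:
  assumes k: "k \<in> {1..<p}"
  shows "[:- of_real (\<xi> k), 1:] ^ 2 dvd F - [:of_real (cv k):]"
proof -
  define x where "x = complex_of_real (\<xi> k)"
  define v where "v = complex_of_real (cv k)"
  have "poly (F - [:v:]) x = 0" by (simp add: x_def v_def poly_F_of_real cv_def)
  then obtain q1 where q1: "F - [:v:] = [:-x,1:] * q1" unfolding poly_eq_0_iff_dvd by (elim dvdE)
  have "pderiv F = pderiv (F - [:v:])" by (simp add: pderiv_diff pderiv_pCons)
  also note q1
  finally have "poly (pderiv F) x = poly q1 x" by (simp only: pderiv_linear_mult) simp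
  moreover have "poly (pderiv F) x = 0" using critical_iff[of x] k x_def by blast
  ultimately obtain q where q: "q1 = [:-x,1:] * q" by (metis poly_eq_0_iff_dvd dvdE)
  have "F - [:v:] = [:-x,1:] ^ 2 * q" unfolding q1 q by (simp only: power2_eq_square mult.assoc)
  then show ?thesis by (simp add: x_def v_def)
qed

text \<open>With the critical values M and m, the polynomial (F - M) (F - m) is (F')^2 times a quadratic
  (z - b)^2 - r^2, up to the factor p^2. This is the differential equation of a Chebyshev polynomial;
  in the variable z = b + r cos \<theta> its derivative becomes g'' = - p^2 g.\<close>

lemma chebyshev_form:
  assumes eq: "\<And>i j. i \<in> {1..<p} \<Longrightarrow> j \<in> {1..<p} \<Longrightarrow> i mod 2 = j mod 2 \<Longrightarrow> cv i = cv j"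
  obtains b r A B :: complex where "r \<noteq> 0" "B \<noteq> 0"
    "\<And>\<theta>. poly F (b + r * cos \<theta>) = A + B * cos (of_nat p * \<theta>)"
proof -
  have I: "1 \<in> {1..<p}" "2 \<in> {1..<p}" using p_ge by auto
  define M m where "M = complex_of_real (cv 2)" and "m = complex_of_real (cv 1)"
  have Mm: "M \<noteq> m" using cv_sgn[OF I(1)] cv_sgn[OF I(2)] by (auto simp: M_def m_def)
  define A B where "A = (M + m) / 2" and "B = (M - m) / 2"
  have B: "B \<noteq> 0" using Mm by (simp add: B_def)
  define D where "D = (\<Prod>k\<in>{1..<p}. [:- of_real (\<xi> k), 1::complex:])"
  define P where "P = (F - [:M:]) * (F - [:m:])"
  have dM: "degree (F - [:t:]) = p" "lead_coeff (F - [:t:]) = 1" for t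
    using lead_coeff_F degree_F p_pos by (auto simp: degree_F_minus_const coeff_pCons split: nat.splits)
  have nz: "F - [:t:] \<noteq> 0" for t using dM(2)[of t] by auto
  have degP: "degree P = 2 * p" using nz dM by (simp add: P_def degree_mult_eq)
  have lcP: "lead_coeff P = 1" unfolding P_def lead_coeff_mult using dM(2) by simp
  have P0: "P \<noteq> 0" using nz by (simp add: P_def)
  have injx: "inj_on (\<lambda>k. complex_of_real (\<xi> k)) {1..<p}" using inj_xi by (auto simp: inj_on_def)
  \<comment> \<open>Every critical value is \<open>M\<close> or \<open>m\<close>, so each critical
    point is a double zero of one factor of \<open>P\<close>. They use up 2 (p - 1) of the degree 2
    p and leave a monic quadratic.\<close>
  have "(\<Prod>x\<in>(\<lambda>k. of_real (\<xi> k)) ` {1..<p}. [:-x,1:]) ^ 2 dvd P"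
  proof (rule prod_square_dvd[OF _ P0])
    fix x assume "x \<in> (\<lambda>k. complex_of_real (\<xi> k)) ` {1..<p}"
    then obtain k where k: "k \<in> {1..<p}" "x = of_real (\<xi> k)" by blast
    have "cv k = cv 2 \<or> cv k = cv 1"
      using eq[OF k(1) I(1)] eq[OF k(1) I(2)] by (cases "even k") (auto simp: even_iff_mod_2_eq_zero odd_iff_mod_2_eq_one)
    then show "[:-x,1:] ^ 2 dvd P"
      using double_root_dvd[OF k(1)] k(2) by (auto simp: P_def M_def m_def intro: dvd_mult dvd_mult2)
  qed simp
  moreover have "(\<Prod>x\<in>(\<lambda>k. of_real (\<xi> k)) ` {1..<p}. [:-x,1:]) = D"
    unfolding D_def by (subst prod.reindex[OF injx]) (simp add: o_def)
  ultimately have "D ^ 2 dvd P" by (simp only:)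
  then obtain Q where Q: "P = D ^ 2 * Q" by blast
  have degD: "degree D = p - 1" unfolding D_def by (subst degree_prod_sum_eq) auto
  have lcD: "lead_coeff D = 1" unfolding D_def by (simp add: lead_coeff_prod)
  have "D \<noteq> 0" "Q \<noteq> 0" using Q P0 by auto
  then have "degree P = 2 * (p - 1) + degree Q" using Q degD by (simp add: degree_mult_eq degree_power_eq)
  then have degQ: "degree Q = 2" using degP p_ge by simp
  have "lead_coeff Q = 1" using lcP Q lcD by (simp add: lead_coeff_mult lead_coeff_power)
  then have c2: "poly.coeff Q 2 = 1" using degQ by simp
  have Qz: "poly Q z = poly.coeff Q 0 + poly.coeff Q 1 * z + z ^ 2" for z
    using c2 by (simp add: poly_altdef degQ numeral_2_eq_2)
  define b where "b = - poly.coeff Q 1 / 2"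
  define r where "r = csqrt (b ^ 2 - poly.coeff Q 0)"
  have Qbr: "poly Q z = (z - b) ^ 2 - r ^ 2" for z
  proof -
    have "r ^ 2 = b ^ 2 - poly.coeff Q 0" "poly.coeff Q 1 = - 2 * b" by (simp_all add: r_def b_def)
    then show ?thesis by (simp only: Qz) (simp add: power2_eq_square algebra_simps)
  qed
  have F'D: "pderiv F = smult (of_nat p) D" unfolding D_def by (rule pderiv_F_eq)
  have ode1: "smult (of_nat p ^ 2) P = pderiv F ^ 2 * Q"
    by (simp add: Q F'D power2_eq_square)
  have "pderiv P = pderiv F * (F - [:M:] + (F - [:m:]))"
  proof -
    have "pderiv (F - [:t:]) = pderiv F" for t by (simp add: pderiv_diff pderiv_pCons)
    then show ?thesis unfolding P_def pderiv_mult by (simp only: distrib_left mult.commute add.commute)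
  qed
  moreover have "pderiv (pderiv F ^ 2 * Q) = pderiv F * (smult 2 (pderiv (pderiv F)) * Q + pderiv F * pderiv Q)"
  proof -
    have "pderiv (pderiv F ^ 2) = pderiv F * smult 2 (pderiv (pderiv F))"
    proof -
      have "smult 2 q = q + q" for q :: "complex poly" by (metis smult_add_left one_add_one smult_1_left)
      then show ?thesis by (simp add: power2_eq_square pderiv_mult algebra_simps)
    qed
    then show ?thesis by (simp add: pderiv_mult power2_eq_square algebra_simps)
  qed
  \<comment> \<open>The differentiated equation has the common factor F', and cancelling it leaves a
    linear differential equation of second order.\<close>
  ultimately have eqm: "pderiv F * smult (of_nat p ^ 2) (F - [:M:] + (F - [:m:])) =
      pderiv F * (smult 2 (pderiv (pderiv F)) * Q + pderiv F * pderiv Q)"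
    using arg_cong[OF ode1, of pderiv] by (simp only: pderiv_smult mult_smult_right)
  have "pderiv F \<noteq> 0" using F'D \<open>D \<noteq> 0\<close> p_pos by simp
  from mult_left_cancel[OF this] eqm
  have eqp: "smult (of_nat p ^ 2) (F - [:M:] + (F - [:m:])) = smult 2 (pderiv (pderiv F)) * Q + pderiv F * pderiv Q"
    by blast
  have "of_nat p ^ 2 * (poly F z - M + (poly F z - m)) = 2 * poly (pderiv (pderiv F)) z * poly Q z + poly (pderiv F) z * poly (pderiv Q) z" for z
    using arg_cong[OF eqp, of "\<lambda>q. poly q z"] by simp
  moreover have "poly (pderiv Q) z = 2 * (z - b)" for z
  proof -
    have "poly Q = poly [:b ^ 2 - r ^ 2, - 2 * b, 1:]"
      by (rule ext) (simp add: Qbr power2_eq_square algebra_simps)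
    then have "Q = [:b ^ 2 - r ^ 2, - 2 * b, 1:]" by (simp only: poly_eq_poly_eq_iff)
    then show ?thesis by (simp add: pderiv_pCons)
  qed
  ultimately have ode2: "of_nat p ^ 2 * (poly F z - A) = poly (pderiv (pderiv F)) z * ((z - b) ^ 2 - r ^ 2) + poly (pderiv F) z * (z - b)" for z
    by (simp add: Qbr A_def field_simps)
  have ode1': "of_nat p ^ 2 * ((poly F z - A) ^ 2 - B ^ 2) = poly (pderiv F) z ^ 2 * ((z - b) ^ 2 - r ^ 2)" for z
  proof -
    have "of_nat p ^ 2 * poly P z = poly (pderiv F) z ^ 2 * poly Q z"
      using arg_cong[OF ode1, of "\<lambda>q. poly q z"] by simp
    moreover have "poly P z = (poly F z - A) ^ 2 - B ^ 2"
      by (simp add: P_def A_def B_def power2_eq_square field_simps)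
    ultimately show ?thesis by (simp add: Qbr)
  qed
  \<comment> \<open>With r = 0 the second-order equation at z = b gives F(b) = A, and the
    first-order one then gives B = 0.\<close>
  have r: "r \<noteq> 0"
  proof
    assume "r = 0"
    then have "poly F b = A" using ode2[of b] p_pos by simp
    then show False using ode1'[of b] \<open>r = 0\<close> B p_pos by simp
  qed
  define g where "g \<theta> = poly F (b + r * cos \<theta>) - A" for \<theta>
  define g' where "g' \<theta> = - r * sin \<theta> * poly (pderiv F) (b + r * cos \<theta>)" for \<theta>
  have Dg: "(g has_field_derivative g' \<theta>) (at \<theta>)" for \<theta>
    unfolding g_def[abs_def] g'_def by (auto intro!: derivative_eq_intros poly_DERIV[THEN DERIV_chain2])
  have Dg': "(g' has_field_derivative - (of_nat p ^ 2) * g \<theta>) (at \<theta>)" for \<theta>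
  proof -
    have "(g' has_field_derivative (- r * cos \<theta> * poly (pderiv F) (b + r * cos \<theta>) +
        (- r * sin \<theta>) * (poly (pderiv (pderiv F)) (b + r * cos \<theta>) * (- r * sin \<theta>)))) (at \<theta>)"
      unfolding g'_def[abs_def] by (auto intro!: derivative_eq_intros poly_DERIV[THEN DERIV_chain2] simp: algebra_simps)
    moreover have sq: "(b + r * cos \<theta> - b) ^ 2 - r ^ 2 = - (r ^ 2 * sin \<theta> ^ 2)"
      by (simp add: cos_squared_eq power_mult_distrib algebra_simps)
    have "of_nat p ^ 2 * g \<theta> = poly (pderiv (pderiv F)) (b + r * cos \<theta>) * (- (r ^ 2 * sin \<theta> ^ 2)) +
        poly (pderiv F) (b + r * cos \<theta>) * (b + r * cos \<theta> - b)"
      by (simp only: g_def ode2 sq)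
    then have "- (of_nat p ^ 2) * g \<theta> = - r * cos \<theta> * poly (pderiv F) (b + r * cos \<theta>) +
        (- r * sin \<theta>) * (poly (pderiv (pderiv F)) (b + r * cos \<theta>) * (- r * sin \<theta>))"
      by (simp add: power2_eq_square algebra_simps)
    ultimately show ?thesis by simp
  qed
  define n where "n = complex_of_nat p"
  have n: "n \<noteq> 0" using p_pos by (simp add: n_def)
  have dc: "((\<lambda>\<theta>. cos (n * \<theta>)) has_field_derivative - sin (n * \<theta>) * n) (at \<theta>)"
    and ds: "((\<lambda>\<theta>. sin (n * \<theta>)) has_field_derivative cos (n * \<theta>) * n) (at \<theta>)" for \<theta>
    by (auto intro!: derivative_eq_intros)
  \<comment> \<open>Two first integrals of g'' = - n^2 g. Solving them for g gives g = K1 cos (n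
    \<theta>) + K2 sin (n \<theta>), and K2 = 0 because g' contains the factor sin \<theta>.\<close>
  have "((\<lambda>\<theta>. g \<theta> * cos (n * \<theta>) - g' \<theta> * sin (n * \<theta>) / n) has_field_derivative 0) (at \<theta>)" for \<theta>
  proof -
    have "((\<lambda>\<theta>. g \<theta> * cos (n * \<theta>) - g' \<theta> * sin (n * \<theta>) / n) has_field_derivative
        (g \<theta> * (- sin (n * \<theta>) * n) + g' \<theta> * cos (n * \<theta>)) -
        (g' \<theta> * (cos (n * \<theta>) * n) + - (of_nat p ^ 2) * g \<theta> * sin (n * \<theta>)) / n) (at \<theta>)"
      by (intro DERIV_diff DERIV_mult' DERIV_cdivide Dg Dg' dc ds)
    then show ?thesis using n by (simp add: n_def[symmetric] power2_eq_square field_simps)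
  qed
  then obtain K1 where K1: "\<And>\<theta>. g \<theta> * cos (n * \<theta>) - g' \<theta> * sin (n * \<theta>) / n = K1"
    using has_field_derivative_zero_constant[of UNIV "\<lambda>\<theta>. g \<theta> * cos (n * \<theta>) - g' \<theta> * sin (n * \<theta>) / n"] by auto
  have "((\<lambda>\<theta>. g \<theta> * sin (n * \<theta>) + g' \<theta> * cos (n * \<theta>) / n) has_field_derivative 0) (at \<theta>)" for \<theta>
  proof -
    have "((\<lambda>\<theta>. g \<theta> * sin (n * \<theta>) + g' \<theta> * cos (n * \<theta>) / n) has_field_derivative
        (g \<theta> * (cos (n * \<theta>) * n) + g' \<theta> * sin (n * \<theta>)) +
        (g' \<theta> * (- sin (n * \<theta>) * n) + - (of_nat p ^ 2) * g \<theta> * cos (n * \<theta>)) / n) (at \<theta>)"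
      by (intro DERIV_add DERIV_mult' DERIV_cdivide Dg Dg' dc ds)
    then show ?thesis using n by (simp add: n_def[symmetric] power2_eq_square field_simps)
  qed
  then obtain K2 where K2: "\<And>\<theta>. g \<theta> * sin (n * \<theta>) + g' \<theta> * cos (n * \<theta>) / n = K2"
    using has_field_derivative_zero_constant[of UNIV "\<lambda>\<theta>. g \<theta> * sin (n * \<theta>) + g' \<theta> * cos (n * \<theta>) / n"] by auto
  have "K2 = 0" using K2[of 0] by (simp add: g'_def)
  have gK: "g \<theta> = K1 * cos (n * \<theta>)" for \<theta>
  proof -
    define C S where "C = cos (n * \<theta>)" and "S = sin (n * \<theta>)"
    have "S * S + C * C = 1" by (simp add: C_def S_def flip: power2_eq_square)
    moreover have "(g \<theta> * C - g' \<theta> * S / n) * C + (g \<theta> * S + g' \<theta> * C / n) * S = g \<theta> * (S * S + C * C)"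
      by (simp add: algebra_simps)
    ultimately show ?thesis using K1[of \<theta>] K2[of \<theta>] \<open>K2 = 0\<close> by (simp add: C_def S_def)
  qed
  have "K1 \<noteq> 0"
  proof
    assume "K1 = 0"
    then have "poly F (b + r) = A" using gK[of 0] by (simp add: g_def)
    then show False using ode1'[of "b + r"] B p_pos by simp
  qed
  then show thesis
    using that[of r K1 b A] r gK by (simp add: g_def n_def algebra_simps)
qed

end

section \<open>The curve as a family of fibres; Zariski closed sets\<close>

lemma prod_linear_esym:
  fixes x :: "complex^'n"
  shows "(\<Prod>i\<in>UNIV. z - x $ i) = (\<Sum>k\<le>CARD('n). (-1) ^ k * esym k x * z ^ (CARD('n) - k))"
proof -
  have "(\<Prod>i\<in>UNIV. z - x $ i) = (\<Prod>i\<in>UNIV. - (x $ i) + z)" by simp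
  also have "\<dots> = (\<Sum>S\<in>Pow UNIV. (\<Prod>i\<in>S. - (x $ i)) * (\<Prod>i\<in>UNIV - S. z))"
    by (rule prod_add) simp
  also have "\<dots> = (\<Sum>S\<in>UNIV. (-1) ^ card S * (\<Prod>i\<in>S. x $ i) * z ^ (CARD('n) - card S))"
    by (simp add: prod_uminus card_Diff_subset)
  also have "\<dots> = (\<Sum>k\<le>CARD('n). \<Sum>S\<in>{S\<in>UNIV. card S = k}. (-1) ^ card S * (\<Prod>i\<in>S. x $ i) * z ^ (CARD('n) - card S))"
    by (rule sum.group[symmetric]) (auto intro: card_mono)
  also have "\<dots> = (\<Sum>k\<le>CARD('n). (-1) ^ k * esym k x * z ^ (CARD('n) - k))"
    by (intro sum.cong refl) (simp add: esym_def sum_distrib_left sum_distrib_right)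
  finally show ?thesis .
qed

lemma esym_0:
  fixes x :: "'a::comm_ring_1^'n"
  shows "esym 0 x = 1"
proof -
  have "{S::'n set. card S = 0} = {{}}" by (auto simp: card_eq_0_iff)
  then show ?thesis by (simp add: esym_def)
qed

text \<open>By Vieta the equations fix all coefficients of the monic polynomial with roots
  \<open>x $ i\<close> except the constant one, which is free and plays the role of t.\<close>

lemma esym_curve_iff:
  fixes v :: "real^'n" and x :: "complex^'n"
  shows "x \<in> esym_curve v \<longleftrightarrow>
    (\<exists>t. \<forall>z. (\<Prod>i\<in>UNIV. z - x $ i) = (\<Prod>i\<in>UNIV. z - of_real (v $ i)) - t)"
proof -
  define V :: "complex^'n" where "V = (\<chi> i. of_real (v $ i))"
  define n where "n = CARD('n)"
  have n: "n > 0" by (simp add: n_def)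
  define d where "d k = (-1) ^ k * (esym k x - esym k V)" for k
  have diff: "(\<Prod>i\<in>UNIV. z - x $ i) - (\<Prod>i\<in>UNIV. z - of_real (v $ i)) = (\<Sum>k\<le>n. d k * z ^ (n - k))" for z
    using prod_linear_esym[of z x] prod_linear_esym[of z V]
    by (simp add: V_def d_def n_def algebra_simps sum_subtractf)
  have d0: "d 0 = 0" by (simp add: d_def esym_0)
  show ?thesis
  proof
    assume "x \<in> esym_curve v"
    then have dk: "d k = 0" if "k < n" for k
      using that d0 by (cases "k = 0") (auto simp: esym_curve_def d_def V_def n_def)
    have "(\<Sum>k\<le>n. d k * z ^ (n - k)) = d n" for z
      using dk by (subst sum.remove[of _ n]) auto
    then have "(\<Prod>i\<in>UNIV. z - x $ i) = (\<Prod>i\<in>UNIV. z - of_real (v $ i)) - (- d n)" for z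
      using diff[of z] by (simp add: algebra_simps)
    then show "\<exists>t. \<forall>z. (\<Prod>i\<in>UNIV. z - x $ i) = (\<Prod>i\<in>UNIV. z - of_real (v $ i)) - t" by blast
  next
    assume "\<exists>t. \<forall>z. (\<Prod>i\<in>UNIV. z - x $ i) = (\<Prod>i\<in>UNIV. z - of_real (v $ i)) - t"
    then obtain t where t: "\<And>z. (\<Prod>i\<in>UNIV. z - x $ i) = (\<Prod>i\<in>UNIV. z - of_real (v $ i)) - t" by blast
    define W where "W = (\<Sum>k\<le>n. monom (d k) (n - k)) + [:t:]"
    have "poly W z = 0" for z
    proof -
      have "(\<Sum>k\<le>n. d k * z ^ (n - k)) = - t" using diff[of z] t[of z] by simp
      then show ?thesis by (simp add: W_def poly_sum poly_monom)
    qed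
    then have "W = 0" using poly_all_0_iff_0 by blast
    have "d k = 0" if k: "k \<in> {1..n - 1}" for k
    proof -
      have "0 = poly.coeff W (n - k)" using \<open>W = 0\<close> by simp
      also have "\<dots> = (\<Sum>j\<le>n. if n - j = n - k then d j else 0)"
        using k by (auto simp: W_def coeff_sum coeff_pCons split: nat.splits)
      also have "\<dots> = (\<Sum>j\<le>n. if j = k then d k else 0)"
        using k by (intro sum.cong) auto
      also have "\<dots> = d k" using k by (subst sum.delta) auto
      finally show ?thesis by simp
    qed
    then show "x \<in> esym_curve v" by (auto simp: esym_curve_def d_def V_def n_def)
  qed
qed

lemma poly_fun_diff: "f \<in> poly_fun \<Longrightarrow> g \<in> poly_fun \<Longrightarrow> (\<lambda>x. f x - g x) \<in> poly_fun"
  using pf_add[OF _ pf_mult[OF pf_const[of "-1"]], of f g] by simp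

lemma poly_fun_power2: "f \<in> poly_fun \<Longrightarrow> (\<lambda>x. (f x)\<^sup>2) \<in> poly_fun"
  using pf_mult[of f f] by (simp add: power2_eq_square)

lemmas poly_fun_intros = pf_const pf_coord pf_add pf_mult poly_fun_diff poly_fun_power2

lemma zariski_closed_Int: "zariski_closed A \<Longrightarrow> zariski_closed B \<Longrightarrow> zariski_closed (A \<inter> B)"
  unfolding zariski_closed_def
proof (elim exE conjE)
  fix G H assume "G \<subseteq> poly_fun" "A = {x. \<forall>f\<in>G. f x = 0}" "H \<subseteq> poly_fun" "B = {x. \<forall>f\<in>H. f x = 0}"
  then show "\<exists>F\<subseteq>poly_fun. A \<inter> B = {x. \<forall>f\<in>F. f x = 0}" by (intro exI[of _ "G \<union> H"]) auto
qed

lemma zariski_closed_Un: "zariski_closed A \<Longrightarrow> zariski_closed B \<Longrightarrow> zariski_closed (A \<union> B)"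
  unfolding zariski_closed_def
proof (elim exE conjE)
  fix G H assume G: "G \<subseteq> poly_fun" "A = {x. \<forall>f\<in>G. f x = 0}" and H: "H \<subseteq> poly_fun" "B = {x. \<forall>f\<in>H. f x = 0}"
  define K where "K = (\<lambda>(f, g) x. f x * g x) ` (G \<times> H)"
  have "K \<subseteq> poly_fun" using G(1) H(1) by (auto simp: K_def intro!: pf_mult)
  moreover have "A \<union> B = {x. \<forall>f\<in>K. f x = 0}"
    unfolding G(2) H(2) K_def by fastforce
  ultimately show "\<exists>F\<subseteq>poly_fun. A \<union> B = {x. \<forall>f\<in>F. f x = 0}" by blast
qed

lemma zariski_closed_empty: "zariski_closed {}"
  unfolding zariski_closed_def by (intro exI[of _ "{\<lambda>x. 1}"]) (auto intro: pf_const)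

lemma zariski_closed_Union:
  "finite S \<Longrightarrow> (\<And>i. i \<in> S \<Longrightarrow> zariski_closed (Q i)) \<Longrightarrow> zariski_closed (\<Union>i\<in>S. Q i)"
  by (induction S rule: finite_induct) (auto intro: zariski_closed_empty zariski_closed_Un)

lemma zariski_irreducible_subset_Union:
  assumes Z: "zariski_irreducible Z" and S: "finite S" "\<And>i. i \<in> S \<Longrightarrow> zariski_closed (Q i)"
    and sub: "Z \<subseteq> (\<Union>i\<in>S. Q i)"
  shows "\<exists>i\<in>S. Z \<subseteq> Q i"
  using S sub
proof (induction S rule: finite_induct)
  case empty
  then show ?case using Z by (simp add: zariski_irreducible_def)
next
  case (insert a S)
  have "zariski_closed (Z \<inter> Q a)" "zariski_closed (Z \<inter> (\<Union>i\<in>S. Q i))"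
    using Z insert by (auto simp: zariski_irreducible_def intro!: zariski_closed_Int zariski_closed_Union)
  moreover have "Z = (Z \<inter> Q a) \<union> (Z \<inter> (\<Union>i\<in>S. Q i))" using insert.prems by auto
  ultimately have "Z = Z \<inter> Q a \<or> Z = Z \<inter> (\<Union>i\<in>S. Q i)"
    using Z unfolding zariski_irreducible_def by blast
  then show ?case using insert by blast
qed

section \<open>Conics parametrized by cosines\<close>

text \<open>Every cosine here is a combination of cos \<theta> and sin \<theta>, so the coordinates
  satisfy affine relations and a quadratic one: a conic. The parameter is complex, hence no points
  are missing.\<close>

definition cheb_curve :: "complex \<Rightarrow> complex \<Rightarrow> nat \<Rightarrow> ('n \<Rightarrow> nat) \<Rightarrow> (complex^'n) set" where
  "cheb_curve b r p e = {x. \<exists>\<theta>. \<forall>i. x $ i = b + r * cos (\<theta> + of_nat (e i) * of_real (2 * pi / p))}"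

text \<open>The equations \<open>f\<close> express each coordinate by those at \<open>i0\<close> and
  \<open>i1\<close>, through sin \<phi> cos (\<theta> + k \<phi>) = sin (k \<phi>) cos (\<theta> +
  \<phi>) - sin ((k - 1) \<phi>) cos \<theta>. The equation \<open>g\<close> comes from sin^2 +
  cos^2 = 1 after eliminating sin \<theta>. Both need sin \<phi> \<noteq> 0, which holds for p \<ge>
  3.\<close>

lemma cheb_curve_closed:
  fixes e :: "'n::finite \<Rightarrow> nat"
  assumes p: "p \<ge> 3" and r: "r \<noteq> 0" and i0: "e i0 = 0" and i1: "e i1 = 1"
  shows "zariski_closed (cheb_curve b r p e)"
proof -
  define \<phi> where "\<phi> = complex_of_real (2 * pi / p)"
  have "sin (2 * pi / p) > 0" using p by (intro sin_gt_zero) (auto simp: field_simps)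
  then have s: "sin \<phi> \<noteq> 0" by (simp add: \<phi>_def sin_of_real del: of_real_divide of_real_mult)
  define f where "f i x = sin \<phi> * (x $ i - b) + sin ((of_nat (e i) - 1) * \<phi>) * (x $ i0 - b) -
      sin (of_nat (e i) * \<phi>) * (x $ i1 - b)" for i and x :: "complex^'n"
  define g where "g x = (cos \<phi> * (x $ i0 - b) - (x $ i1 - b))\<^sup>2 - (sin \<phi>)\<^sup>2 * (r\<^sup>2 - (x $ i0 - b)\<^sup>2)" for x :: "complex^'n"
  have "insert g (range f) \<subseteq> poly_fun"
    unfolding f_def[abs_def] g_def[abs_def] by (auto intro!: poly_fun_intros)
  moreover have "cheb_curve b r p e = {x. \<forall>h\<in>insert g (range f). h x = 0}"
  proof (intro equalityI subsetI)
    fix x assume "x \<in> cheb_curve b r p e"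
    then obtain \<theta> where x: "\<And>i. x $ i = b + r * cos (\<theta> + of_nat (e i) * \<phi>)" by (auto simp: cheb_curve_def \<phi>_def)
    have "f i x = 0" for i
      unfolding f_def x i0 i1 by (simp add: cos_add sin_diff left_diff_distrib algebra_simps)
    moreover have "g x = 0"
    proof -
      have "cos \<phi> * (x $ i0 - b) - (x $ i1 - b) = r * sin \<theta> * sin \<phi>"
        unfolding x i0 i1 by (simp add: cos_add algebra_simps)
      moreover have "r\<^sup>2 - (x $ i0 - b)\<^sup>2 = (r * sin \<theta>)\<^sup>2"
        unfolding x i0 by (simp add: power_mult_distrib sin_squared_eq algebra_simps)
      ultimately show ?thesis by (simp add: g_def power_mult_distrib)
    qed
    ultimately show "x \<in> {x. \<forall>h\<in>insert g (range f). h x = 0}" by auto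
  next
    fix x assume "x \<in> {x. \<forall>h\<in>insert g (range f). h x = 0}"
    then have f0: "f i x = 0" and g0: "g x = 0" for i by auto
    define \<theta> where "\<theta> = Arccos ((x $ i0 - b) / r)"
    have c\<theta>: "r * cos \<theta> = x $ i0 - b" using r by (simp add: \<theta>_def)
    have "(cos \<phi> * (x $ i0 - b) - (x $ i1 - b))\<^sup>2 = (r * sin \<theta> * sin \<phi>)\<^sup>2"
      using g0 unfolding g_def c\<theta>[symmetric] by (simp add: power_mult_distrib sin_squared_eq algebra_simps)
    then have "cos \<phi> * (x $ i0 - b) - (x $ i1 - b) = r * sin \<theta> * sin \<phi> \<or>
        cos \<phi> * (x $ i0 - b) - (x $ i1 - b) = - (r * sin \<theta> * sin \<phi>)"
      by (simp only: power2_eq_iff)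
    \<comment> \<open>\<open>Arccos\<close> fixes the parameter only up to sign; the sign is chosen
      so that the coordinate at \<open>i1\<close> also fits.\<close>
    then obtain \<psi> where \<psi>: "r * cos \<psi> = x $ i0 - b" "cos \<phi> * (x $ i0 - b) - (x $ i1 - b) = r * sin \<psi> * sin \<phi>"
      using that[of \<theta>] that[of "- \<theta>"] c\<theta> by auto
    have x1: "x $ i1 - b = r * cos (\<psi> + \<phi>)"
    proof -
      have "x $ i1 - b = cos \<phi> * (x $ i0 - b) - r * sin \<psi> * sin \<phi>" using \<psi>(2) by (simp add: algebra_simps)
      also have "\<dots> = r * cos (\<psi> + \<phi>)" unfolding \<psi>(1)[symmetric] by (simp add: cos_add algebra_simps)
      finally show ?thesis .
    qed
    have "x $ i = b + r * cos (\<psi> + of_nat (e i) * \<phi>)" for i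
    proof -
      have "sin \<phi> * (x $ i - b) = sin (of_nat (e i) * \<phi>) * (r * cos (\<psi> + \<phi>)) - sin ((of_nat (e i) - 1) * \<phi>) * (r * cos \<psi>)"
        using f0[of i] unfolding f_def x1 \<psi>(1)[symmetric] by (simp add: algebra_simps)
      also have "\<dots> = sin \<phi> * (r * cos (\<psi> + of_nat (e i) * \<phi>))"
        by (simp add: cos_add sin_diff left_diff_distrib algebra_simps)
      finally have "x $ i - b = r * cos (\<psi> + of_nat (e i) * \<phi>)" using s by simp
      then show ?thesis by (simp only: diff_eq_eq add.commute)
    qed
    then show "x \<in> cheb_curve b r p e" unfolding cheb_curve_def \<phi>_def by blast
  qed
  ultimately show ?thesis unfolding zariski_closed_def by blast
qed

lemma cheb_curve_point: "(\<chi> i. b + r * cos (\<theta> + of_nat (e i) * of_real (2 * pi / p))) \<in> cheb_curve b r p e"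
  unfolding cheb_curve_def by auto

lemma poly_fun_on_cheb_curve_holomorphic:
  assumes "f \<in> poly_fun"
  shows "(\<lambda>\<theta>. f (\<chi> i. b + r * cos (\<theta> + of_nat (e i) * of_real (2 * pi / p)))) holomorphic_on UNIV"
  using assms by induction (auto intro!: holomorphic_intros)

text \<open>The curve is the image of an entire map on the plane. Polynomials pulled back along it
  are entire functions, and these have no zero divisors.\<close>

lemma cheb_curve_irreducible:
  fixes e :: "'n::finite \<Rightarrow> nat"
  assumes cl: "zariski_closed (cheb_curve b r p e)"
  shows "zariski_irreducible (cheb_curve b r p e)"
  unfolding zariski_irreducible_def
proof (intro conjI allI impI)
  show "cheb_curve b r p e \<noteq> {}" using cheb_curve_point by blast
  show "zariski_closed (cheb_curve b r p e)" by (rule cl)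
  fix A B assume AB: "zariski_closed A \<and> zariski_closed B \<and> cheb_curve b r p e = A \<union> B"
  obtain G where G: "G \<subseteq> poly_fun" "A = {x. \<forall>f\<in>G. f x = 0}" using AB by (auto simp: zariski_closed_def)
  obtain H where H: "H \<subseteq> poly_fun" "B = {x. \<forall>f\<in>H. f x = 0}" using AB by (auto simp: zariski_closed_def)
  define \<gamma> where "\<gamma> \<theta> = (\<chi> i. b + r * cos (\<theta> + of_nat (e i) * of_real (2 * pi / p)))" for \<theta>
  have curve: "\<exists>\<theta>. x = \<gamma> \<theta>" if "x \<in> cheb_curve b r p e" for x
    using that by (auto simp: cheb_curve_def \<gamma>_def vec_eq_iff)
  show "cheb_curve b r p e = A \<or> cheb_curve b r p e = B"
  proof (rule ccontr)
    assume "\<not> ?thesis"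
    then obtain x y where x: "x \<in> cheb_curve b r p e" "x \<notin> A" and y: "y \<in> cheb_curve b r p e" "y \<notin> B"
      using AB by blast
    obtain \<theta>1 \<theta>2 where \<theta>: "x = \<gamma> \<theta>1" "y = \<gamma> \<theta>2" using curve x(1) y(1) by blast
    obtain f where f: "f \<in> G" "f (\<gamma> \<theta>1) \<noteq> 0" using x(2) G(2) \<theta> by auto
    obtain g where g: "g \<in> H" "g (\<gamma> \<theta>2) \<noteq> 0" using y(2) H(2) \<theta> by auto
    have "\<gamma> \<theta> \<in> A \<union> B" for \<theta> using AB cheb_curve_point[of b r \<theta> e p] by (simp add: \<gamma>_def)
    then have "f (\<gamma> \<theta>) * g (\<gamma> \<theta>) = 0" for \<theta> using f(1) g(1) G(2) H(2) by auto
    then have "(\<forall>\<theta>\<in>UNIV. f (\<gamma> \<theta>) = 0) \<or> (\<forall>\<theta>\<in>UNIV. g (\<gamma> \<theta>) = 0)"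
      using poly_fun_on_cheb_curve_holomorphic[of f b r e p] poly_fun_on_cheb_curve_holomorphic[of g b r e p] f(1) g(1) G(1) H(1)
      by (intro holomorphic_mult_eq_0) (auto simp: \<gamma>_def)
    then show False using f(2) g(2) by auto
  qed
qed

lemma cos_cong_2pi: "w = z + of_real (2 * pi) * of_int k \<Longrightarrow> cos w = cos (z::complex)"
  unfolding complex_cos_eq by (intro bexI[of _ "of_int k"]) auto

lemma cheb_curve_affine_subset:
  assumes p: "p > 0" and s: "s \<in> {1, -1::int}"
    and aff: "\<And>i. [int (e' i) = a + s * int (e i)] (mod int p)"
  shows "cheb_curve b r p e' \<subseteq> cheb_curve b r p e"
proof
  fix x assume "x \<in> cheb_curve b r p e'"
  define \<phi> where "\<phi> = complex_of_real (2 * pi / p)"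
  obtain \<theta> where x: "\<And>i. x $ i = b + r * cos (\<theta> + of_nat (e' i) * \<phi>)"
    using \<open>x \<in> cheb_curve b r p e'\<close> by (auto simp: cheb_curve_def \<phi>_def)
  have p\<phi>: "of_nat p * \<phi> = of_real (2 * pi)" using p by (simp add: \<phi>_def)
  \<comment> \<open>Chosen so that \<theta> + (a + s k) \<phi> = s (\<theta>' + k \<phi>); cosine
    does not see the sign s or multiples of 2 pi.\<close>
  define \<theta>' where "\<theta>' = of_int s * (\<theta> + of_int a * \<phi>)"
  have "cos (\<theta> + of_nat (e' i) * \<phi>) = cos (\<theta>' + of_nat (e i) * \<phi>)" for i
  proof -
    obtain k where k: "int (e' i) = a + s * int (e i) + int p * k"
      using aff[of i] by (metis cong_iff_lin cong_sym)
    have "complex_of_int (int (e' i)) = of_int (a + s * int (e i) + int p * k)" using k by simp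
    then have "of_nat (e' i) * \<phi> = (of_int a + of_int s * of_nat (e i)) * \<phi> + (of_nat p * \<phi>) * of_int k"
      by (simp add: algebra_simps)
    then have "\<theta> + of_nat (e' i) * \<phi> = (\<theta> + of_int a * \<phi> + of_int s * of_nat (e i) * \<phi>) + of_real (2 * pi) * of_int k"
      unfolding p\<phi> by (simp add: algebra_simps)
    then have 1: "cos (\<theta> + of_nat (e' i) * \<phi>) = cos (\<theta> + of_int a * \<phi> + of_int s * of_nat (e i) * \<phi>)"
      by (rule cos_cong_2pi)
    from s consider "s = 1" | "s = -1" by auto
    then show ?thesis
    proof cases
      case 1
      then show ?thesis using \<open>cos (\<theta> + of_nat (e' i) * \<phi>) = _\<close> by (simp add: \<theta>'_def)
    next
      case 2
      then have "\<theta> + of_int a * \<phi> + of_int s * of_nat (e i) * \<phi> = - (\<theta>' + of_nat (e i) * \<phi>)"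
        by (simp add: \<theta>'_def)
      then show ?thesis using 1 by (simp only: cos_minus)
    qed
  qed
  then show "x \<in> cheb_curve b r p e" using x unfolding cheb_curve_def \<phi>_def by auto
qed

lemma cheb_curve_affine_eq:
  assumes p: "p > 0" and s: "s \<in> {1, -1::int}"
    and aff: "\<And>i. [int (e' i) = a + s * int (e i)] (mod int p)"
  shows "cheb_curve b r p e' = cheb_curve b r p e"
proof
  show "cheb_curve b r p e' \<subseteq> cheb_curve b r p e" by (rule cheb_curve_affine_subset[OF p s aff])
  have "[int (e i) = - s * a + s * int (e' i)] (mod int p)" for i
  proof -
    have "[- s * a + s * int (e' i) = - s * a + s * (a + s * int (e i))] (mod int p)"
      by (intro cong_add cong_mult cong_refl aff)
    moreover have "- s * a + s * (a + s * int (e i)) = int (e i)" using s by auto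
    ultimately show ?thesis by (metis cong_sym)
  qed
  then show "cheb_curve b r p e \<subseteq> cheb_curve b r p e'" by (rule cheb_curve_affine_subset[OF p s])
qed

text \<open>Comparing imaginary parts at a non-real parameter shows that the sign in
  cos u = cos w, i.e. u = w or u = - w modulo 2 pi, is the same for all coordinates.\<close>

lemma cheb_curve_subset_imp_affine:
  assumes p: "p > 0" and r: "r \<noteq> 0" and sub: "cheb_curve b r p e' \<subseteq> cheb_curve b r p e"
  shows "\<exists>a s. s \<in> {1, -1} \<and> (\<forall>i. [int (e' i) = a + s * int (e i)] (mod int p))"
proof -
  define \<phi> where "\<phi> = complex_of_real (2 * pi / p)"
  obtain \<theta> where "\<And>i. b + r * cos (\<i> + of_nat (e' i) * \<phi>) = b + r * cos (\<theta> + of_nat (e i) * \<phi>)"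
    using subsetD[OF sub cheb_curve_point[of b r \<i> e' p]] by (auto simp: cheb_curve_def \<phi>_def)
  then have "cos (\<i> + of_nat (e' i) * \<phi>) = cos (\<theta> + of_nat (e i) * \<phi>)" for i using r by simp
  then have ex: "\<exists>n\<in>\<int>. \<i> + of_nat (e' i) * \<phi> = \<theta> + of_nat (e i) * \<phi> + of_real (2 * n * pi) \<or>
      \<i> + of_nat (e' i) * \<phi> = - (\<theta> + of_nat (e i) * \<phi>) + of_real (2 * n * pi)" for i
    unfolding complex_cos_eq .
  have Im\<phi>: "Im \<phi> = 0" "Re \<phi> = 2 * pi / p" by (simp_all add: \<phi>_def)
  define \<epsilon> :: int where "\<epsilon> = (if Im \<theta> = 1 then 1 else -1)"
  define w where "w = 2 * pi / p"
  have w: "w \<noteq> 0" "2 * pi = p * w" using p by (simp_all add: w_def)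
  have main: "\<exists>n::int. real (e' i) - \<epsilon> * real (e i) = \<epsilon> * Re \<theta> / w + p * n" for i
  proof -
    obtain n' where n': "n' \<in> \<int>" "\<i> + of_nat (e' i) * \<phi> = \<theta> + of_nat (e i) * \<phi> + of_real (2 * n' * pi) \<or>
      \<i> + of_nat (e' i) * \<phi> = - (\<theta> + of_nat (e i) * \<phi>) + of_real (2 * n' * pi)"
      using ex[of i] by blast
    obtain n :: int where n: "n' = of_int n" using n'(1) by (auto elim: Ints_cases)
    have "Re (\<i> + of_nat (e' i) * \<phi>) = \<epsilon> * Re (\<theta> + of_nat (e i) * \<phi>) + 2 * n * pi"
      using n'(2)
    proof
      assume a: "\<i> + of_nat (e' i) * \<phi> = \<theta> + of_nat (e i) * \<phi> + of_real (2 * n' * pi)"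
      have "Im \<theta> = 1" using arg_cong[OF a, of Im] Im\<phi> by simp
      then show ?thesis using arg_cong[OF a, of Re] n by (simp add: \<epsilon>_def)
    next
      assume a: "\<i> + of_nat (e' i) * \<phi> = - (\<theta> + of_nat (e i) * \<phi>) + of_real (2 * n' * pi)"
      have "Im \<theta> = -1" using arg_cong[OF a, of Im] Im\<phi> by simp
      then show ?thesis using arg_cong[OF a, of Re] n by (simp add: \<epsilon>_def)
    qed
    then have "real (e' i) * w = \<epsilon> * (Re \<theta> + real (e i) * w) + n * (2 * pi)"
      using Im\<phi> by (simp add: w_def)
    then have "(real (e' i) - \<epsilon> * real (e i) - p * n) * w = \<epsilon> * Re \<theta>"
      unfolding w(2) by (simp add: algebra_simps)
    then have "real (e' i) - \<epsilon> * real (e i) - p * n = \<epsilon> * Re \<theta> / w"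
      using w(1) by (simp only: eq_divide_eq) simp
    then show ?thesis by (intro exI[of _ n]) simp
  qed
  define i0 :: 'a where "i0 = undefined"
  define a where "a = int (e' i0) - \<epsilon> * int (e i0)"
  show ?thesis
  proof (rule exI[of _ a], rule exI[of _ \<epsilon>], intro conjI allI)
    show "\<epsilon> \<in> {1, -1}" by (simp add: \<epsilon>_def)
    fix i
    obtain n m :: int where n: "real (e' i) - \<epsilon> * real (e i) = \<epsilon> * Re \<theta> / w + p * n"
      and m: "real (e' i0) - \<epsilon> * real (e i0) = \<epsilon> * Re \<theta> / w + p * m"
      using main[of i] main[of i0] by blast
    have "of_int (int (e' i) - (a + \<epsilon> * int (e i))) = (of_int (int p * (n - m)) :: real)"
      using n m by (simp add: a_def algebra_simps)
    then have "int (e' i) - (a + \<epsilon> * int (e i)) = int p * (n - m)" by (simp only: of_int_eq_iff)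
    then show "[int (e' i) = a + \<epsilon> * int (e i)] (mod int p)" by (simp add: cong_iff_dvd_diff)
  qed
qed

section \<open>Stabilizers of the conics\<close>

definition dihedral_act :: "nat \<Rightarrow> nat \<times> bool \<Rightarrow> nat \<Rightarrow> nat" where
  "dihedral_act p x j = (fst x + (if snd x then p - j else j)) mod p"

lemma dihedral_act_cong:
  assumes "j \<le> p"
  shows "[int (dihedral_act p x j) = int (fst x) + (if snd x then - 1 else 1) * int j] (mod int p)"
proof -
  define A where "A = int (fst x) + (if snd x then int p - int j else int j)"
  have "int (dihedral_act p x j) = A mod int p"
    using assms by (simp add: dihedral_act_def A_def zmod_int of_nat_diff)
  then have "[int (dihedral_act p x j) = A] (mod int p)" by simp
  moreover have "[A = int (fst x) + (if snd x then - 1 else 1) * int j] (mod int p)"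
    by (simp add: A_def cong_iff_dvd_diff)
  ultimately show ?thesis by (rule cong_trans)
qed

lemma dihedral_act_less: "p > 0 \<Longrightarrow> dihedral_act p x j < p"
  by (simp add: dihedral_act_def)

lemma nat_eq_if_int_cong: "i < p \<Longrightarrow> j < p \<Longrightarrow> [int i = int j] (mod int p) \<Longrightarrow> i = j"
  by (simp add: cong_int_iff cong_less_modulus_unique_nat)

lemma dihedral_act_mult:
  assumes p: "p > 0" and j: "j < p" and y: "y \<in> carrier (dihedral_group p)"
  shows "dihedral_act p x (dihedral_act p y j) = dihedral_act p (x \<otimes>\<^bsub>dihedral_group p\<^esub> y) j"
proof (rule nat_eq_if_int_cong[OF dihedral_act_less[OF p] dihedral_act_less[OF p]])
  obtain a s b t where xy: "x = (a, s)" "y = (b, t)" by (cases x, cases y) auto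
  have b: "b < p" using y xy by (simp add: dihedral_group_def)
  define sg :: "bool \<Rightarrow> int" where "sg u = (if u then - 1 else 1)" for u
  have act: "[int (dihedral_act p z i) = int (fst z) + sg (snd z) * int i] (mod int p)" if "i < p" for z i
    using dihedral_act_cong[of i p z] that by (simp add: sg_def)
  have f1: "[int (dihedral_act p x (dihedral_act p y j)) = int a + sg s * int (dihedral_act p y j)] (mod int p)"
    using act[OF dihedral_act_less[OF p, of y j], of x] xy by simp
  have f2: "[int a + sg s * int (dihedral_act p y j) = int a + sg s * (int b + sg t * int j)] (mod int p)"
    using act[OF j, of y] xy by (intro cong_add cong_mult cong_refl) simp
  have f3: "[int a + sg s * (int b + sg t * int j) = int ((a + (if s then p - b else b)) mod p) + sg (s \<noteq> t) * int j] (mod int p)"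
  proof -
    have 1: "[int ((a + (if s then p - b else b)) mod p) = int a + sg s * int b] (mod int p)"
      using dihedral_act_cong[of b p x] b xy by (simp add: dihedral_act_def sg_def)
    have "sg s * sg t = sg (s \<noteq> t)" by (simp add: sg_def)
    then have 2: "int a + sg s * (int b + sg t * int j) = int a + sg s * int b + sg (s \<noteq> t) * int j"
      by (simp add: distrib_left flip: mult.assoc)
    show ?thesis unfolding 2 by (intro cong_add cong_refl cong_sym[OF 1])
  qed
  have f4: "[int (dihedral_act p (x \<otimes>\<^bsub>dihedral_group p\<^esub> y) j) = int ((a + (if s then p - b else b)) mod p) + sg (s \<noteq> t) * int j] (mod int p)"
    using act[OF j, of "x \<otimes>\<^bsub>dihedral_group p\<^esub> y"] xy by (simp add: dihedral_group_def)
  show "[int (dihedral_act p x (dihedral_act p y j)) = int (dihedral_act p (x \<otimes>\<^bsub>dihedral_group p\<^esub> y) j)] (mod int p)"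
    by (rule cong_trans[OF f1 cong_trans[OF f2 cong_trans[OF f3 cong_sym[OF f4]]]])
qed

lemma dihedral_mult_closed:
  "p > 0 \<Longrightarrow> x \<otimes>\<^bsub>dihedral_group p\<^esub> y \<in> carrier (dihedral_group p)"
  by (cases x; cases y) (simp add: dihedral_group_def)

text \<open>Preimages are the convenient side: \<open>perm_act\<close> contains the inverse
  permutation, so the preimage of a conic is simply the conic for
  \<open>e \<circ> \<sigma>\<close>.\<close>

lemma perm_act_image_eq_iff:
  fixes Z :: "(complex^'n) set"
  assumes "bij \<sigma>"
  shows "perm_act \<sigma> ` Z = Z \<longleftrightarrow> {x. perm_act \<sigma> x \<in> Z} = Z"
proof -
  define \<rho> where "\<rho> x = (\<chi> i. x $ \<sigma> i)" for x :: "complex^'n"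
  have 1: "perm_act \<sigma> (\<rho> x) = x" for x
    using assms by (simp add: perm_act_def \<rho>_def vec_eq_iff bij_is_surj surj_f_inv_f)
  have 2: "\<rho> (perm_act \<sigma> x) = x" for x
    using assms by (simp add: perm_act_def \<rho>_def vec_eq_iff bij_is_inj)
  show ?thesis
  proof
    assume a: "perm_act \<sigma> ` Z = Z"
    show "{x. perm_act \<sigma> x \<in> Z} = Z"
    proof (intro equalityI subsetI)
      fix x assume "x \<in> {x. perm_act \<sigma> x \<in> Z}"
      then have "perm_act \<sigma> x \<in> perm_act \<sigma> ` Z" unfolding a by simp
      then obtain y where y: "perm_act \<sigma> x = perm_act \<sigma> y" "y \<in> Z" by (rule imageE)
      from arg_cong[OF y(1), of \<rho>] have "x = y" by (simp only: 2)
      then show "x \<in> Z" using y(2) by simp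
    next
      fix x assume "x \<in> Z"
      from imageI[OF this, of "perm_act \<sigma>"] show "x \<in> {x. perm_act \<sigma> x \<in> Z}" unfolding a by simp
    qed
  next
    assume a: "{x. perm_act \<sigma> x \<in> Z} = Z"
    show "perm_act \<sigma> ` Z = Z"
    proof (intro equalityI subsetI)
      fix x assume "x \<in> Z"
      then have "\<rho> x \<in> {x. perm_act \<sigma> x \<in> Z}" by (simp only: mem_Collect_eq 1)
      then have "perm_act \<sigma> (\<rho> x) \<in> perm_act \<sigma> ` Z" unfolding a by (rule imageI)
      then show "x \<in> perm_act \<sigma> ` Z" by (simp only: 1)
    next
      fix x assume "x \<in> perm_act \<sigma> ` Z"
      then obtain y where y: "x = perm_act \<sigma> y" "y \<in> Z" by (rule imageE)
      have "y \<in> {x. perm_act \<sigma> x \<in> Z}" unfolding a by (rule y(2))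
      then show "x \<in> Z" unfolding y(1) by (rule CollectD)
    qed
  qed
qed

lemma perm_act_cheb_curve:
  fixes e :: "'n::finite \<Rightarrow> nat"
  assumes "bij \<sigma>"
  shows "{x. perm_act \<sigma> x \<in> cheb_curve b r p e} = cheb_curve b r p (e \<circ> \<sigma>)"
proof -
  have eq: "(\<forall>i. perm_act \<sigma> x $ i = g (e i)) \<longleftrightarrow> (\<forall>i. x $ i = g ((e \<circ> \<sigma>) i))" for x :: "complex^'n" and g
    using assms by (simp add: perm_act_def) (metis bij_inv_eq_iff)
  show ?thesis unfolding cheb_curve_def mem_Collect_eq
    by (intro Collect_cong arg_cong[of _ _ Ex] ext) (rule eq)
qed

text \<open>A permutation preserves the conic exactly if, on the exponents \<open>e\<close>, it acts
  as an affine map of the residues with linear part 1 or -1, and these maps form the dihedral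
  group.\<close>

lemma stab_cheb_curve:
  fixes e :: "'n::finite \<Rightarrow> nat"
  assumes p: "p \<ge> 3" and r: "r \<noteq> 0" and e: "bij_betw e (UNIV::'n set) {..<p}"
  shows "stab (cheb_curve b r p e) \<cong> dihedral_group p"
proof -
  define D where "D = dihedral_group p"
  define S where "S = stab (cheb_curve b r p e)"
  have p0: "p > 0" using p by simp
  have Bij: "Bij (UNIV::'n set) = {\<sigma>. bij \<sigma>}" by (auto simp: Bij_def)
  have "carrier S = {\<sigma>. bij \<sigma> \<and> perm_act \<sigma> ` cheb_curve b r p e = cheb_curve b r p e}"
    by (simp add: S_def stab_def sym_grp_def BijGroup_def Bij)
  moreover have "perm_act \<sigma> ` cheb_curve b r p e = cheb_curve b r p e \<longleftrightarrow>
      cheb_curve b r p (e \<circ> \<sigma>) = cheb_curve b r p e" if "bij \<sigma>" for \<sigma>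
    unfolding perm_act_image_eq_iff[OF that] perm_act_cheb_curve[OF that] ..
  ultimately have carS: "carrier S = {\<sigma>. bij \<sigma> \<and> cheb_curve b r p (e \<circ> \<sigma>) = cheb_curve b r p e}"
    by (simp only: cong: conj_cong)
  have multS: "\<sigma> \<otimes>\<^bsub>S\<^esub> \<tau> = \<sigma> \<circ> \<tau>" if "\<sigma> \<in> carrier S" "\<tau> \<in> carrier S" for \<sigma> \<tau>
  proof -
    have "\<sigma> \<in> Bij UNIV" "\<tau> \<in> Bij UNIV" using that by (simp_all add: carS Bij)
    then show ?thesis by (simp add: S_def stab_def sym_grp_def BijGroup_def compose_def fun_eq_iff)
  qed
  have eI: "e i < p" for i using e by (auto simp: bij_betw_def)
  have einj: "inj e" using e by (simp add: bij_betw_def)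
  \<comment> \<open>The dihedral action on residues, transported to the index type along
    \<open>e\<close>.\<close>
  define \<psi> where "\<psi> x i = inv_into UNIV e (dihedral_act p x (e i))" for x i
  have e\<psi>: "e (\<psi> x i) = dihedral_act p x (e i)" for x i
    unfolding \<psi>_def by (rule f_inv_into_f) (use e dihedral_act_less[OF p0] in \<open>auto simp: bij_betw_def\<close>)
  define sg :: "bool \<Rightarrow> int" where "sg u = (if u then - 1 else 1)" for u
  have act: "[int (dihedral_act p x j) = int (fst x) + sg (snd x) * int j] (mod int p)" if "j < p" for x j
    using dihedral_act_cong[of j p x] that by (simp add: sg_def)
  have sg: "sg u \<in> {1, - 1}" for u by (simp add: sg_def)
  have \<psi>S: "\<psi> x \<in> carrier S" for x
  proof -
    have "inj (\<psi> x)"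
    proof (rule injI)
      fix i k assume "\<psi> x i = \<psi> x k"
      from arg_cong[OF this, of e] have "dihedral_act p x (e i) = dihedral_act p x (e k)" by (simp only: e\<psi>)
      then have "[int (fst x) + sg (snd x) * int (e i) = int (fst x) + sg (snd x) * int (e k)] (mod int p)"
        using cong_trans[OF cong_sym[OF act[OF eI[of i], of x]]] act[OF eI[of k], of x] by simp
      then have "[sg (snd x) * int (e i) = sg (snd x) * int (e k)] (mod int p)" by (simp add: cong_add_lcancel)
      then have "[int (e i) = int (e k)] (mod int p)"
        by (auto simp: sg_def cong_minus_minus_iff split: if_splits)
      then have "e i = e k" by (rule nat_eq_if_int_cong[OF eI eI])
      then show "i = k" using einj by (simp add: inj_eq)
    qed
    then have "bij (\<psi> x)" by (simp add: bij_def finite_UNIV_inj_surj)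
    moreover have "cheb_curve b r p (e \<circ> \<psi> x) = cheb_curve b r p e"
      by (rule cheb_curve_affine_eq[OF p0 sg]) (use act[OF eI] in \<open>simp add: e\<psi>\<close>)
    ultimately show ?thesis by (simp add: carS)
  qed
  have inj\<psi>: "inj_on \<psi> (carrier D)"
  proof (rule inj_onI)
    fix x y assume xy: "x \<in> carrier D" "y \<in> carrier D" "\<psi> x = \<psi> y"
    obtain i0 i1 where i: "e i0 = 0" "e i1 = 1"
    proof -
      have "0 \<in> range e" "1 \<in> range e" using e p by (auto simp: bij_betw_def)
      then obtain i0 i1 where "0 = e i0" "1 = e i1" by (elim rangeE)
      then show thesis using that[of i0 i1] by simp
    qed
    have eq: "dihedral_act p x (e i) = dihedral_act p y (e i)" for i
      using arg_cong[OF fun_cong[OF xy(3), of i], of e] by (simp only: e\<psi>)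
    have c: "fst x < p" "fst y < p" using xy by (auto simp: D_def dihedral_group_def)
    have "fst x = fst y" using eq[of i0] c by (auto simp: i dihedral_act_def split: if_splits)
    moreover have "snd x = snd y"
    proof (rule ccontr)
      assume ne: "snd x \<noteq> snd y"
      have "[int (fst x) + sg (snd x) * 1 = int (fst y) + sg (snd y) * 1] (mod int p)"
      proof -
        have a: "[int (dihedral_act p x 1) = int (fst x) + sg (snd x) * 1] (mod int p)"
          "[int (dihedral_act p y 1) = int (fst y) + sg (snd y) * 1] (mod int p)"
          using act[of 1 x] act[of 1 y] p by simp_all
        have "dihedral_act p x 1 = dihedral_act p y 1" using eq[of i1] by (simp add: i)
        then show ?thesis using cong_trans[OF cong_sym[OF a(1)]] a(2) by simp
      qed
      then have "[sg (snd x) = sg (snd y)] (mod int p)" using \<open>fst x = fst y\<close> by (simp add: cong_add_lcancel)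
      \<comment> \<open>A rotation and a reflection with the same image of 0 can agree at 1 only if
        1 = -1 modulo p, which p \<ge> 3 excludes.\<close>
      then have "int p dvd 2" using ne by (auto simp: sg_def cong_iff_dvd_diff split: if_splits)
      then have "int p \<le> 2" by (rule zdvd_imp_le) simp
      then show False using p by simp
    qed
    ultimately show "x = y" by (simp add: prod_eq_iff)
  qed
  have surj\<psi>: "carrier S \<subseteq> \<psi> ` carrier D"
  proof
    fix \<sigma> assume \<sigma>: "\<sigma> \<in> carrier S"
    then have "cheb_curve b r p (e \<circ> \<sigma>) \<subseteq> cheb_curve b r p e" by (simp add: carS)
    from cheb_curve_subset_imp_affine[OF p0 r this] obtain a s :: int
      where "s \<in> {1, - 1} \<and> (\<forall>i. [int ((e \<circ> \<sigma>) i) = a + s * int (e i)] (mod int p))" by (elim exE)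
    then have as: "s \<in> {1, - 1}" "\<And>i. [int ((e \<circ> \<sigma>) i) = a + s * int (e i)] (mod int p)" by simp_all
    define x where "x = (nat (a mod int p), s = - 1)"
    have xD: "x \<in> carrier D" using p0 by (simp add: x_def D_def dihedral_group_def nat_less_iff)
    have sgx: "sg (snd x) = s" using as(1) by (auto simp: x_def sg_def)
    have fx: "[int (fst x) = a] (mod int p)" using p0 by (simp add: x_def)
    have "\<psi> x i = \<sigma> i" for i
    proof -
      have g1: "[int (e (\<psi> x i)) = int (fst x) + s * int (e i)] (mod int p)" using act[OF eI[of i], of x] by (simp add: e\<psi> sgx)
      have g2: "[int (fst x) + s * int (e i) = a + s * int (e i)] (mod int p)"
        by (intro cong_add cong_refl fx)
      have g3: "[a + s * int (e i) = int (e (\<sigma> i))] (mod int p)" using cong_sym[OF as(2)[of i]] by simp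
      have "[int (e (\<psi> x i)) = int (e (\<sigma> i))] (mod int p)" by (rule cong_trans[OF g1 cong_trans[OF g2 g3]])
      then have "e (\<psi> x i) = e (\<sigma> i)" by (rule nat_eq_if_int_cong[OF eI eI])
      then show ?thesis using einj by (simp add: inj_eq)
    qed
    then have "\<sigma> = \<psi> x" by auto
    then show "\<sigma> \<in> \<psi> ` carrier D" using xD by blast
  qed
  have bij\<psi>: "bij_betw \<psi> (carrier D) (carrier S)"
    by (rule bij_betw_imageI[OF inj\<psi>], rule equalityI[OF _ surj\<psi>], rule image_subsetI, rule \<psi>S)
  have hom\<psi>: "\<psi> x \<circ> \<psi> y = \<psi> (x \<otimes>\<^bsub>D\<^esub> y)" if "y \<in> carrier D" for x y
  proof
    fix i
    have "e (\<psi> x (\<psi> y i)) = e (\<psi> (x \<otimes>\<^bsub>D\<^esub> y) i)"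
      using dihedral_act_mult[OF p0 eI[of i], of y x] that by (simp add: e\<psi> D_def)
    then show "(\<psi> x \<circ> \<psi> y) i = \<psi> (x \<otimes>\<^bsub>D\<^esub> y) i" using einj by (simp add: inj_eq)
  qed
  \<comment> \<open>The isomorphism is wanted from the stabilizer to the dihedral group, the
    direction opposite to \<open>\<psi>\<close>.\<close>
  define \<eta> where "\<eta> = inv_into (carrier D) \<psi>"
  have \<eta>\<psi>: "\<eta> (\<psi> x) = x" if "x \<in> carrier D" for x
    unfolding \<eta>_def by (rule inv_into_f_f[OF inj\<psi> that])
  have "\<eta> \<in> iso S D"
    unfolding iso_def hom_def
  proof (intro CollectI conjI ballI)
    show "bij_betw \<eta> (carrier S) (carrier D)" unfolding \<eta>_def by (rule bij_betw_inv_into[OF bij\<psi>])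
    then show "\<eta> \<in> carrier S \<rightarrow> carrier D" by (auto simp: bij_betw_def)
    fix \<sigma> \<tau> assume st: "\<sigma> \<in> carrier S" "\<tau> \<in> carrier S"
    obtain x y where xy: "x \<in> carrier D" "\<sigma> = \<psi> x" "y \<in> carrier D" "\<tau> = \<psi> y" using surj\<psi> st by blast
    have "x \<otimes>\<^bsub>D\<^esub> y \<in> carrier D" unfolding D_def by (rule dihedral_mult_closed[OF p0])
    then show "\<eta> (\<sigma> \<otimes>\<^bsub>S\<^esub> \<tau>) = \<eta> \<sigma> \<otimes>\<^bsub>D\<^esub> \<eta> \<tau>"
      using multS[OF st] xy hom\<psi>[OF xy(3), of x] by (simp add: \<eta>\<psi>)
  qed
  then show ?thesis unfolding is_iso_def S_def D_def by blast
qed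

section \<open>Components of the curve in the Chebyshev case\<close>

lemma image_mset_eq_sum: "finite A \<Longrightarrow> image_mset f (mset_set A) = (\<Sum>i\<in>A. {#f i#})"
  by (induction rule: finite_induct) auto

text \<open>Both families have the same multiset of roots. Multisets are needed because roots may
  coincide over critical values.\<close>

lemma permutes_if_linear_products_eq:
  fixes x y :: "'n::finite \<Rightarrow> complex"
  assumes "\<And>z. (\<Prod>i\<in>UNIV. z - x i) = (\<Prod>i\<in>UNIV. z - y i)"
  obtains \<sigma> where "\<sigma> permutes UNIV" "\<And>i. x i = y (\<sigma> i)"
proof -
  have pr: "proots (\<Prod>i\<in>UNIV. [:- w i, 1:]) = image_mset w (mset_set UNIV)" for w :: "'n \<Rightarrow> complex"
    by (subst proots_prod) (simp_all add: image_mset_eq_sum)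
  have "poly (\<Prod>i\<in>UNIV. [:- x i, 1:]) = poly (\<Prod>i\<in>UNIV. [:- y i, 1:])"
    using assms by (simp add: fun_eq_iff poly_prod)
  then have "(\<Prod>i\<in>UNIV. [:- x i, 1:]) = (\<Prod>i\<in>UNIV. [:- y i, 1:])" by (simp only: poly_eq_poly_eq_iff)
  then have "image_mset x (mset_set UNIV) = image_mset y (mset_set UNIV)" by (simp only: pr[symmetric])
  then obtain \<sigma> where "\<sigma> permutes UNIV" "\<forall>i\<in>UNIV. x i = y (\<sigma> i)"
    by (rule image_mset_eq_implies_permutes[OF finite])
  then show thesis by (intro that[of \<sigma>]) simp_all
qed

context real_rooted
begin

text \<open>For a nonreal parameter the p points are distinct, since equal cosines with opposite
  angles would contradict the imaginary parts; so they exhaust the fibre. Real parameters, where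
  roots can collide, follow by continuity.\<close>

lemma fibre_param:
  assumes form: "\<And>\<theta>. poly F (b + r * cos \<theta>) = A + B * cos (of_nat p * \<theta>)" and r: "r \<noteq> 0"
  shows "(\<Prod>j<p. z - (b + r * cos (\<theta> + of_nat j * of_real (2 * pi / p)))) = poly F z - (A + B * cos (of_nat p * \<theta>))"
proof -
  define \<phi> where "\<phi> = complex_of_real (2 * pi / p)"
  have p\<phi>: "of_nat p * \<phi> = of_real (2 * pi)" using p_pos by (simp add: \<phi>_def)
  define y where "y \<theta> j = b + r * cos (\<theta> + of_nat j * \<phi>)" for \<theta> and j :: nat
  have root: "poly F (y \<theta> j) = A + B * cos (of_nat p * \<theta>)" for \<theta> j
  proof -
    have "of_nat p * (\<theta> + of_nat j * \<phi>) = of_nat p * \<theta> + (of_nat p * \<phi>) * of_int (int j)"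
      by (simp add: algebra_simps)
    then have "cos (of_nat p * (\<theta> + of_nat j * \<phi>)) = cos (of_nat p * \<theta>)"
      unfolding p\<phi> by (rule cos_cong_2pi)
    then show ?thesis by (simp add: y_def form)
  qed
  have nonreal: "(\<Prod>j<p. z - y \<theta> j) = poly F z - (A + B * cos (of_nat p * \<theta>))" if \<theta>: "Im \<theta> \<noteq> 0" for \<theta>
  proof -
    have "inj_on (y \<theta>) {..<p}"
    proof (rule inj_onI)
      fix j k assume jk: "j \<in> {..<p}" "k \<in> {..<p}" "y \<theta> j = y \<theta> k"
      then have "cos (\<theta> + of_nat j * \<phi>) = cos (\<theta> + of_nat k * \<phi>)" using r by (simp add: y_def)
      then obtain n' where n': "n' \<in> \<int>" "\<theta> + of_nat j * \<phi> = \<theta> + of_nat k * \<phi> + of_real (2 * n' * pi) \<or>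
          \<theta> + of_nat j * \<phi> = - (\<theta> + of_nat k * \<phi>) + of_real (2 * n' * pi)"
        unfolding complex_cos_eq by blast
      obtain n :: int where n: "n' = of_int n" using n'(1) by (auto elim: Ints_cases)
      have Im\<phi>: "Im \<phi> = 0" "Re \<phi> = 2 * pi / p" by (simp_all add: \<phi>_def)
      from n'(2) show "j = k"
      proof
        assume a: "\<theta> + of_nat j * \<phi> = \<theta> + of_nat k * \<phi> + of_real (2 * n' * pi)"
        define w where "w = 2 * pi / p"
        have w: "w \<noteq> 0" "2 * pi = p * w" using p_pos by (simp_all add: w_def)
        have "real j * w = real k * w + n * (2 * pi)" using arg_cong[OF a, of Re] Im\<phi> n by (simp add: w_def)
        then have "(real j - real k - p * n) * w = 0" unfolding w(2) by (simp add: algebra_simps)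
        then have "real j - real k = p * n" using w(1) by simp
        then have "of_int (int j - int k) = (of_int (int p * n) :: real)" by simp
        then have "int j - int k = int p * n" by (simp only: of_int_eq_iff)
        then have "[int j = int k] (mod int p)" by (simp add: cong_iff_dvd_diff)
        then show ?thesis using jk by (intro nat_eq_if_int_cong) auto
      next
        assume a: "\<theta> + of_nat j * \<phi> = - (\<theta> + of_nat k * \<phi>) + of_real (2 * n' * pi)"
        then show ?thesis using arg_cong[OF a, of Im] Im\<phi> \<theta> by simp
      qed
    qed
    from fibre_factorization[OF this _ root]
    have "F - [:A + B * cos (of_nat p * \<theta>):] = (\<Prod>j<p. [:- y \<theta> j, 1:])" by simp
    from arg_cong[OF this, of "\<lambda>q. poly q z"] show ?thesis by (simp add: poly_prod)
  qed
  define G where "G \<theta> = (\<Prod>j<p. z - y \<theta> j) - (poly F z - (A + B * cos (of_nat p * \<theta>)))" for \<theta>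
  have "G \<theta> = 0"
  proof (cases "Im \<theta> = 0")
    case True
    define s where "s n = \<theta> + \<i> * of_real (inverse (real (Suc n)))" for n
    have "s \<longlonglongrightarrow> \<theta> + \<i> * of_real 0" unfolding s_def[abs_def]
      by (intro tendsto_intros LIMSEQ_inverse_real_of_nat)
    then have s: "s \<longlonglongrightarrow> \<theta>" by simp
    have "isCont G \<theta>" unfolding G_def[abs_def] y_def by (intro continuous_intros)
    then have "(\<lambda>n. G (s n)) \<longlonglongrightarrow> G \<theta>" using s by (rule isCont_tendsto_compose)
    moreover have "G (s n) = 0" for n
    proof -
      have "Im (s n) \<noteq> 0" using True by (simp add: s_def)
      from nonreal[OF this] show ?thesis by (simp add: G_def)
    qed
    ultimately show ?thesis by (simp add: LIMSEQ_const_iff)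
  next
    case False
    from nonreal[OF this] show ?thesis by (simp add: G_def)
  qed
  then show ?thesis by (simp add: G_def y_def \<phi>_def)
qed

lemma esym_curve_eq_Union:
  fixes v :: "real^'n" and e :: "'n \<Rightarrow> nat"
  assumes form: "\<And>\<theta>. poly F (b + r * cos \<theta>) = A + B * cos (of_nat p * \<theta>)" and r: "r \<noteq> 0" and B: "B \<noteq> 0"
    and e: "bij_betw e (UNIV::'n set) {..<p}" and v: "\<And>i. v $ i = c (e i)"
  shows "esym_curve v = (\<Union>\<sigma>\<in>{\<sigma>. \<sigma> permutes UNIV}. cheb_curve b r p (e \<circ> \<sigma>))"
proof -
  define y where "y \<theta> j = b + r * cos (\<theta> + of_nat j * of_real (2 * pi / p))" for \<theta> and j :: nat
  have vF: "(\<Prod>i\<in>UNIV. z - of_real (v $ i)) = poly F z" for z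
    using prod.reindex_bij_betw[OF e, of "\<lambda>j. z - of_real (c j)"] by (simp add: v poly_F)
  have yF: "(\<Prod>j<p. z - y \<theta> j) = poly F z - (A + B * cos (of_nat p * \<theta>))" for z \<theta>
    unfolding y_def by (rule fibre_param[OF form r])
  show ?thesis
  proof (intro equalityI subsetI)
    fix x assume "x \<in> esym_curve v"
    then obtain t where t: "\<And>z. (\<Prod>i\<in>UNIV. z - x $ i) = poly F z - t" by (auto simp: esym_curve_iff vF)
    \<comment> \<open>Complex cosine is surjective and B \<noteq> 0, so every fibre, whatever t, is
      reached by some parameter.\<close>
    define \<theta> where "\<theta> = Arccos ((t - A) / B) / of_nat p"
    have "A + B * cos (of_nat p * \<theta>) = t" using B p_pos by (simp add: \<theta>_def)
    then have "(\<Prod>i\<in>UNIV. z - x $ i) = (\<Prod>j<p. z - y \<theta> j)" for z using t yF[of z \<theta>] by simp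
    also have "(\<Prod>j<p. z - y \<theta> j) = (\<Prod>i\<in>UNIV. z - y \<theta> (e i))" for z
      using prod.reindex_bij_betw[OF e, of "\<lambda>j. z - y \<theta> j"] by simp
    finally have prod_eq: "(\<Prod>i\<in>UNIV. z - x $ i) = (\<Prod>i\<in>UNIV. z - y \<theta> (e i))" for z .
    show "x \<in> (\<Union>\<sigma>\<in>{\<sigma>. \<sigma> permutes UNIV}. cheb_curve b r p (e \<circ> \<sigma>))"
    proof (rule permutes_if_linear_products_eq[OF prod_eq])
      fix \<sigma> assume \<sigma>: "\<sigma> permutes UNIV" "\<And>i. x $ i = y \<theta> (e (\<sigma> i))"
      have "x \<in> cheb_curve b r p (e \<circ> \<sigma>)" unfolding cheb_curve_def using \<sigma>(2) by (auto simp: y_def)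
      then show ?thesis using \<sigma>(1) by blast
    qed
  next
    fix x assume "x \<in> (\<Union>\<sigma>\<in>{\<sigma>. \<sigma> permutes UNIV}. cheb_curve b r p (e \<circ> \<sigma>))"
    then obtain \<sigma> \<theta> where \<sigma>: "\<sigma> permutes UNIV" and x: "\<And>i. x $ i = y \<theta> ((e \<circ> \<sigma>) i)"
      by (auto simp: cheb_curve_def y_def)
    have "bij_betw (e \<circ> \<sigma>) UNIV {..<p}" by (rule bij_betw_trans[OF permutes_imp_bij[OF \<sigma>] e])
    from prod.reindex_bij_betw[OF this, of "\<lambda>j. z - y \<theta> j" for z]
    have "(\<Prod>i\<in>UNIV. z - x $ i) = poly F z - (A + B * cos (of_nat p * \<theta>))" for z
      unfolding x yF .
    then show "x \<in> esym_curve v" unfolding esym_curve_iff vF by (intro exI allI)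
  qed
qed

lemma stab_component_dihedral:
  fixes v :: "real^'n" and e :: "'n \<Rightarrow> nat"
  assumes eq: "\<And>i j. i \<in> {1..<p} \<Longrightarrow> j \<in> {1..<p} \<Longrightarrow> i mod 2 = j mod 2 \<Longrightarrow> cv i = cv j"
    and e: "bij_betw e (UNIV::'n set) {..<p}" and v: "\<And>i. v $ i = c (e i)"
    and C1: "irreducible_component (esym_curve v) C1"
  shows "stab C1 \<cong> dihedral_group p"
proof -
  have "\<exists>b r A B :: complex. r \<noteq> 0 \<and> B \<noteq> 0 \<and>
      (\<forall>\<theta>. poly F (b + r * cos \<theta>) = A + B * cos (of_nat p * \<theta>))"
  proof (rule chebyshev_form)
    fix i j assume "i \<in> {1..<p}" "j \<in> {1..<p}" "i mod 2 = j mod 2"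
    then show "cv i = cv j" by (rule eq)
  next
    fix b r A B :: complex
    assume "r \<noteq> 0" "B \<noteq> 0" "\<And>\<theta>. poly F (b + r * cos \<theta>) = A + B * cos (of_nat p * \<theta>)"
    then show ?thesis by (intro exI conjI allI)
  qed
  then obtain b r A B :: complex where "r \<noteq> 0 \<and> B \<noteq> 0 \<and>
      (\<forall>\<theta>. poly F (b + r * cos \<theta>) = A + B * cos (of_nat p * \<theta>))" by (elim exE)
  then have form: "r \<noteq> 0" "B \<noteq> 0" "\<And>\<theta>. poly F (b + r * cos \<theta>) = A + B * cos (of_nat p * \<theta>)"
    by simp_all
  define Q where "Q \<sigma> = cheb_curve b r p (e \<circ> \<sigma>)" for \<sigma> :: "'n \<Rightarrow> 'n"
  define P where "P = {\<sigma>::'n\<Rightarrow>'n. \<sigma> permutes UNIV}"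
  have curve: "esym_curve v = (\<Union>\<sigma>\<in>P. Q \<sigma>)"
    unfolding Q_def P_def by (rule esym_curve_eq_Union[OF form(3,1,2) e v])
  have bij: "bij_betw (e \<circ> \<sigma>) UNIV {..<p}" if "\<sigma> \<in> P" for \<sigma>
    using that bij_betw_trans[OF permutes_imp_bij e] by (simp add: P_def)
  have closed: "zariski_closed (Q \<sigma>)" if "\<sigma> \<in> P" for \<sigma>
  proof -
    have "0 \<in> range (e \<circ> \<sigma>)" "1 \<in> range (e \<circ> \<sigma>)" using bij[OF that] p_ge by (auto simp: bij_betw_def)
    then obtain i0 i1 where "0 = (e \<circ> \<sigma>) i0" "1 = (e \<circ> \<sigma>) i1" by (elim rangeE)
    then show ?thesis unfolding Q_def by (intro cheb_curve_closed[OF p_ge form(1), of _ i0 i1]) simp_all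
  qed
  have fin: "finite P" by (simp add: P_def finite_permutations)
  have "zariski_irreducible C1" "C1 \<subseteq> (\<Union>\<sigma>\<in>P. Q \<sigma>)"
    using C1 by (simp_all add: irreducible_component_def curve)
  from zariski_irreducible_subset_Union[OF this(1) fin closed this(2)]
  obtain \<sigma> where \<sigma>: "\<sigma> \<in> P" "C1 \<subseteq> Q \<sigma>" by blast
  have "zariski_irreducible (Q \<sigma>)" using closed[OF \<sigma>(1)] unfolding Q_def by (rule cheb_curve_irreducible)
  moreover have "Q \<sigma> \<subseteq> esym_curve v" using \<sigma>(1) unfolding curve by blast
  \<comment> \<open>The conic is itself irreducible and contained in the curve, so maximality of the
    component gives equality.\<close>
  ultimately have "Q \<sigma> = C1" using C1 \<sigma>(2) unfolding irreducible_component_def by blast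
  then show ?thesis using stab_cheb_curve[OF p_ge form(1) bij[OF \<sigma>(1)], of b] by (simp add: Q_def)
qed

section \<open>Counting orbit points on a hyperplane\<close>

lemma card_zeros_le:
  fixes a :: "real^'n" and e :: "'n \<Rightarrow> nat"
  assumes p: "prime p" and e: "bij_betw e (UNIV::'n set) {..<p}"
    and sum_ne: "(\<Sum>j<p. c j) \<noteq> 0"
    and ij: "i \<in> {1..<p}" "j \<in> {1..<p}" "i mod 2 = j mod 2" "cv i \<noteq> cv j"
    and a: "a \<noteq> 0"
  shows "card {\<sigma>. \<sigma> permutes UNIV \<and> (\<Sum>i\<in>UNIV. a $ i * c (e (\<sigma> i))) = 0} \<le> fact (p - 1)"
proof (rule ccontr)
  assume "\<not> ?thesis"
  then have many: "card {\<sigma>. \<sigma> permutes UNIV \<and> (\<Sum>i\<in>UNIV. a $ i * c (e (\<sigma> i))) = 0} > fact (p - 1)" by simp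
  have "card (UNIV :: 'n set) = card {-h..h}" using bij_betw_same_card[OF e] p_eq by simp
  then obtain lbl where lbl: "bij_betw lbl (UNIV :: 'n set) {-h..h}"
    using finite_same_card_bij[OF finite finite_atLeastAtMost_int] by blast
  show False
  proof (rule relation_if_many_zeros[OF e lbl many])
    fix \<sigma> assume \<sigma>: "\<sigma> permutes UNIV" "\<And>t. Im t > 0 \<Longrightarrow> (\<Sum>i\<in>UNIV. of_real (a $ i) * X t (lbl (\<sigma> i))) = 0"
    \<comment> \<open>The relation is found for permuted labels; moving the permutation to the
      coefficients gives one for \<open>lbl\<close> itself.\<close>
    define b :: "real^'n" where "b = (\<chi> i. a $ inv_into UNIV \<sigma> i)"
    have b\<sigma>: "b $ \<sigma> i = a $ i" for i using permutes_inverses(2)[OF \<sigma>(1)] by (simp add: b_def)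
    have "b = 0"
    proof (rule relation_trivial[OF p lbl sum_ne ij])
      fix t assume "Im t > 0"
      then show "(\<Sum>i\<in>UNIV. of_real (b $ i) * X t (lbl i)) = 0"
        using \<sigma>(2)[of t] sum.reindex_bij_betw[OF permutes_imp_bij[OF \<sigma>(1)], of "\<lambda>i. of_real (b $ i) * X t (lbl i)"]
        by (simp add: b\<sigma>)
    qed
    then have "a $ i = 0" for i using b\<sigma>[of i] by simp
    then show False using a by (simp add: vec_eq_iff)
  qed
qed

end

lemma sorted_enumeration:
  fixes v :: "real^'n"
  assumes "inj (\<lambda>i. v $ i)"
  obtains c e where "\<And>i j. i < j \<Longrightarrow> j < CARD('n) \<Longrightarrow> c j < c i"
    "bij_betw e (UNIV::'n set) {..<CARD('n)}" "\<And>i. v $ i = c (e i)"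
proof -
  define R where "R = range (\<lambda>i. v $ i)"
  define xs where "xs = sorted_list_of_set R"
  have R: "finite R" "card R = CARD('n)" using assms by (simp_all add: R_def card_image)
  have len: "length xs = CARD('n)" and set: "set xs = R" and srt: "sorted_wrt (<) xs"
    using R by (simp_all add: xs_def)
  define c where "c j = xs ! (CARD('n) - Suc j)" for j
  have dec: "c j < c i" if "i < j" "j < CARD('n)" for i j
    using sorted_wrt_nth_less[OF srt, of "CARD('n) - Suc j" "CARD('n) - Suc i"] that len by (simp add: c_def)
  have "c ` {..<CARD('n)} = R"
  proof
    show "c ` {..<CARD('n)} \<subseteq> R" using len set by (auto simp: c_def set_conv_nth)
    show "R \<subseteq> c ` {..<CARD('n)}"
    proof
      fix x assume "x \<in> R"
      then obtain k where k: "k < CARD('n)" "x = xs ! k" using set len by (auto simp: set_conv_nth)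
      then have "x = c (CARD('n) - Suc k)" by (simp add: c_def)
      then show "x \<in> c ` {..<CARD('n)}" using k by (intro image_eqI[of _ _ "CARD('n) - Suc k"]) auto
    qed
  qed
  moreover have "inj_on c {..<CARD('n)}"
  proof (rule inj_onI)
    fix i j assume "i \<in> {..<CARD('n)}" "j \<in> {..<CARD('n)}" "c i = c j"
    then show "i = j" using dec[of i j] dec[of j i] by (cases i j rule: linorder_cases) auto
  qed
  ultimately have c: "bij_betw c {..<CARD('n)} R" by (simp add: bij_betw_def)
  have vb: "bij_betw (\<lambda>i. v $ i) UNIV R" using assms by (simp add: bij_betw_def R_def)
  define e where "e = inv_into {..<CARD('n)} c \<circ> (\<lambda>i. v $ i)"
  have e: "bij_betw e UNIV {..<CARD('n)}"
    unfolding e_def by (rule bij_betw_trans[OF vb bij_betw_inv_into[OF c]])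
  have "v $ i = c (e i)" for i
  proof -
    have "v $ i \<in> c ` {..<CARD('n)}" using c by (auto simp: bij_betw_def R_def)
    then show ?thesis by (simp add: e_def f_inv_into_f)
  qed
  then show thesis by (intro that[of c e]) (use dec e in auto)
qed

lemma perm_orbit_eq: "perm_orbit v = (\<lambda>\<sigma>. \<chi> i. v $ \<sigma> i) ` {\<sigma>. \<sigma> permutes (UNIV :: 'n set)}"
  for v :: "real^'n"
proof -
  have "perm_orbit v = (\<lambda>\<sigma>. \<chi> i. v $ \<sigma> i) ` inv_into UNIV ` {\<sigma>. \<sigma> permutes (UNIV :: 'n set)}"
    by (auto simp: perm_orbit_def perm_act_def)
  also have "inv_into UNIV ` {\<sigma>. \<sigma> permutes (UNIV :: 'n set)} = {\<sigma>. \<sigma> permutes UNIV}"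
  proof (intro equalityI subsetI)
    fix \<sigma> :: "'n \<Rightarrow> 'n" assume "\<sigma> \<in> {\<sigma>. \<sigma> permutes UNIV}"
    then show "\<sigma> \<in> inv_into UNIV ` {\<sigma>. \<sigma> permutes UNIV}"
      by (intro image_eqI[of _ _ "inv_into UNIV \<sigma>"]) (simp_all add: permutes_inv permutes_inv_inv)
  qed (auto intro: permutes_inv)
  finally show ?thesis .
qed

lemma finite_perm_orbit: "finite (perm_orbit v)"
  by (simp add: perm_orbit_eq finite_permutations)

lemma card_hyperplane_perm_orbit:
  fixes v a :: "real^'n"
  assumes "inj (\<lambda>i. v $ i)"
  shows "card ({x. a \<bullet> x = 0} \<inter> perm_orbit v) = card {\<sigma>. \<sigma> permutes UNIV \<and> (\<Sum>i\<in>UNIV. a $ i * v $ \<sigma> i) = 0}"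
proof -
  have "inj (\<lambda>\<sigma>. (\<chi> i. v $ \<sigma> i) :: real^'n)"
    using assms by (auto simp: inj_def vec_eq_iff fun_eq_iff)
  then have "inj_on (\<lambda>\<sigma>. (\<chi> i. v $ \<sigma> i) :: real^'n) {\<sigma>. \<sigma> permutes UNIV \<and> (\<Sum>i\<in>UNIV. a $ i * v $ \<sigma> i) = 0}"
    by (rule inj_on_subset) simp
  moreover have "{x. a \<bullet> x = 0} \<inter> perm_orbit v =
      (\<lambda>\<sigma>. \<chi> i. v $ \<sigma> i) ` {\<sigma>. \<sigma> permutes UNIV \<and> (\<Sum>i\<in>UNIV. a $ i * v $ \<sigma> i) = 0}"
    by (auto simp: perm_orbit_eq inner_vec_def)
  ultimately show ?thesis by (simp add: card_image)
qed

text \<open>On the orbit the coordinate sum is the constant s, so the affine condition that the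
  coordinate at \<open>i0\<close> equals v_i0 can be made homogeneous.\<close>

lemma hyperplane_attaining_bound:
  fixes v :: "real^'n"
  assumes inj: "inj (\<lambda>i. v $ i)" and sum: "(\<Sum>i\<in>UNIV. v $ i) \<noteq> 0" and n: "CARD('n) \<ge> 2"
  obtains a where "a \<noteq> 0" "card ({x. a \<bullet> x = 0} \<inter> perm_orbit v) = fact (CARD('n) - 1)"
proof -
  define s where "s = (\<Sum>i\<in>UNIV. v $ i)"
  obtain i0 j0 :: 'n where ij: "i0 \<noteq> j0"
  proof -
    have "\<not> is_singleton (UNIV :: 'n set)" using n by (simp add: is_singleton_altdef)
    then show thesis using that unfolding is_singleton_def by blast
  qed
  \<comment> \<open>The form s x_i0 - v_i0 (sum of all x_i); at a permutation
    \<open>\<sigma>\<close> of v it is s (v_\<sigma>(i0) - v_i0), which is zero only if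
    \<open>\<sigma>\<close> fixes \<open>i0\<close>.\<close>
  define a :: "real^'n" where "a = (\<chi> i. (if i = i0 then s else 0) - v $ i0)"
  have "a \<noteq> 0"
  proof
    assume "a = 0"
    then have "a $ i0 = 0" "a $ j0 = 0" by simp_all
    then show False using ij sum by (simp add: a_def s_def)
  qed
  moreover have "{\<sigma>. \<sigma> permutes UNIV \<and> (\<Sum>i\<in>UNIV. a $ i * v $ \<sigma> i) = 0} = {\<sigma>. \<sigma> permutes (UNIV - {i0})}"
  proof -
    have eq: "(\<Sum>i\<in>UNIV. a $ i * v $ \<sigma> i) = 0 \<longleftrightarrow> \<sigma> i0 = i0" if \<sigma>: "\<sigma> permutes UNIV" for \<sigma>
    proof -
      have "(\<Sum>i\<in>UNIV. a $ i * v $ \<sigma> i) = (\<Sum>i\<in>UNIV. (if i = i0 then s * v $ \<sigma> i0 else 0) - v $ i0 * v $ \<sigma> i)"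
        by (intro sum.cong) (auto simp: a_def algebra_simps)
      also have "\<dots> = s * v $ \<sigma> i0 - v $ i0 * (\<Sum>i\<in>UNIV. v $ \<sigma> i)"
        by (simp add: sum_subtractf sum_distrib_left)
      also have "(\<Sum>i\<in>UNIV. v $ \<sigma> i) = s"
        unfolding s_def by (rule sum.reindex_bij_betw[OF permutes_imp_bij[OF \<sigma>]])
      finally show ?thesis using sum inj by (auto simp: s_def inj_eq algebra_simps)
    qed
    have "\<sigma> permutes (UNIV - {i0}) \<longleftrightarrow> \<sigma> permutes UNIV \<and> \<sigma> i0 = i0" for \<sigma>
      by (auto simp: permutes_def)
    then show ?thesis using eq by auto
  qed
  ultimately show thesis
    using that card_permutations[of "UNIV - {i0}" "CARD('n) - 1"] card_hyperplane_perm_orbit[OF inj, of a] by simp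
qed

text \<open>If both permutations of v lay on the hyperplane, \<open>a\<close> would solve a system
  of two equations whose determinant is, up to sign, (v_i - v_j) (v_i + v_j), and this is
  nonzero.\<close>

lemma card_zeros_le_two:
  fixes v a :: "real^'n"
  assumes n: "CARD('n) = 2" and inj: "inj (\<lambda>i. v $ i)" and sum: "(\<Sum>i\<in>UNIV. v $ i) \<noteq> 0" and a: "a \<noteq> 0"
  shows "card {\<sigma>. \<sigma> permutes UNIV \<and> (\<Sum>i\<in>UNIV. a $ i * v $ \<sigma> i) = 0} \<le> 1"
proof (rule ccontr)
  define Z where "Z = {\<sigma>. \<sigma> permutes UNIV \<and> (\<Sum>i\<in>UNIV. a $ i * v $ \<sigma> i) = 0}"
  assume "\<not> card {\<sigma>. \<sigma> permutes UNIV \<and> (\<Sum>i\<in>UNIV. a $ i * v $ \<sigma> i) = 0} \<le> 1"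
  then have "card Z \<ge> 2" by (simp add: Z_def)
  moreover have "card {\<sigma>. \<sigma> permutes (UNIV :: 'n set)} = 2" using card_permutations[of "UNIV :: 'n set" 2] n by simp
  moreover have "Z \<subseteq> {\<sigma>. \<sigma> permutes UNIV}" by (auto simp: Z_def)
  ultimately have Z: "Z = {\<sigma>. \<sigma> permutes UNIV}" by (intro card_seteq) (auto simp: finite_permutations)
  obtain i j :: 'n where ij: "UNIV = {i, j}" "i \<noteq> j" using n by (auto simp: card_2_iff)
  have s2: "sum f UNIV = f i + f j" for f :: "'n \<Rightarrow> real"
    unfolding ij(1) using ij(2) by simp
  have "id \<in> Z" "Transposition.transpose i j \<in> Z" unfolding Z by (auto intro: permutes_id permutes_swap_id)
  then have "(\<Sum>k\<in>UNIV. a $ k * v $ id k) = 0" "(\<Sum>k\<in>UNIV. a $ k * v $ Transposition.transpose i j k) = 0"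
    unfolding Z_def by blast+
  then have "a $ i * v $ i + a $ j * v $ j = 0" "a $ i * v $ j + a $ j * v $ i = 0"
    unfolding s2 by simp_all
  then have "(a $ i + a $ j) * (v $ i + v $ j) = 0" "(a $ i - a $ j) * (v $ i - v $ j) = 0"
    by (simp_all add: algebra_simps)
  moreover have "v $ i + v $ j \<noteq> 0" using sum unfolding s2 .
  moreover have "v $ i - v $ j \<noteq> 0" using injD[OF inj, of i j] ij(2) by auto
  ultimately have "a $ i = 0" "a $ j = 0" by auto
  then have "a $ k = 0" for k using UNIV_I[of k] unfolding ij(1) by auto
  then show False using a by (simp add: vec_eq_iff)
qed

theorem theorem5p1:
  fixes v :: "real^'n" and C1 :: "(complex^'n) set"
  assumes "prime CARD('n)"
    and "inj (\<lambda>i. v $ i)"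
    and "(\<Sum>i\<in>UNIV. v $ i) \<noteq> 0"
    and "irreducible_component (esym_curve v) C1"
    and "\<not> (stab C1 \<cong> dihedral_group CARD('n))"
  shows "Max {card ({x. a \<bullet> x = 0} \<inter> perm_orbit v) | a :: real^'n. a \<noteq> 0}
           = fact (CARD('n) - 1)"
proof (rule Max_eqI)
  have "{card ({x. a \<bullet> x = 0} \<inter> perm_orbit v) | a :: real^'n. a \<noteq> 0} \<subseteq> {..card (perm_orbit v)}"
    by (auto intro: card_mono finite_perm_orbit)
  then show "finite {card ({x. a \<bullet> x = 0} \<inter> perm_orbit v) | a :: real^'n. a \<noteq> 0}"
    by (rule finite_subset) simp
next
  obtain a :: "real^'n" where "a \<noteq> 0" "card ({x. a \<bullet> x = 0} \<inter> perm_orbit v) = fact (CARD('n) - 1)"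
    using hyperplane_attaining_bound[OF assms(2,3) prime_ge_2_nat[OF assms(1)]] by blast
  then show "fact (CARD('n) - 1) \<in> {card ({x. a \<bullet> x = 0} \<inter> perm_orbit v) | a :: real^'n. a \<noteq> 0}"
    by (intro CollectI exI[of _ a]) simp
next
  fix y assume "y \<in> {card ({x. a \<bullet> x = 0} \<inter> perm_orbit v) | a :: real^'n. a \<noteq> 0}"
  then obtain a :: "real^'n" where a: "a \<noteq> 0" "y = card ({x. a \<bullet> x = 0} \<inter> perm_orbit v)" by blast
  have y: "y = card {\<sigma>. \<sigma> permutes UNIV \<and> (\<Sum>i\<in>UNIV. a $ i * v $ \<sigma> i) = 0}"
    using a(2) card_hyperplane_perm_orbit[OF assms(2)] by simp
  show "y \<le> fact (CARD('n) - 1)"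
  \<comment> \<open>The labels are symmetric around 0 and the locale \<open>real_rooted\<close> asks
    for an odd degree, so the even prime is settled by hand.\<close>
  proof (cases "CARD('n) = 2")
    case True
    then show ?thesis using card_zeros_le_two[OF True assms(2,3) a(1)] y by simp
  next
    case False
    then have p3: "CARD('n) \<ge> 3" using prime_ge_2_nat[OF assms(1)] by simp
    then have odd: "odd CARD('n)" using prime_odd_nat[OF assms(1)] by simp
    show ?thesis
    proof (rule sorted_enumeration[OF assms(2)])
      fix c e assume dec: "\<And>i j. i < j \<Longrightarrow> j < CARD('n) \<Longrightarrow> c j < c i"
        and e: "bij_betw e (UNIV::'n set) {..<CARD('n)}" and v: "\<And>i. v $ i = c (e i)"
      interpret real_rooted "CARD('n)" c by unfold_locales (use odd p3 dec in auto)
      \<comment> \<open>Here the stabilizer enters: if the critical values agreed within each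
        parity, \<open>C1\<close> would be one of the conics and its stabilizer dihedral.\<close>
      have "\<exists>i j. i \<in> {1..<CARD('n)} \<and> j \<in> {1..<CARD('n)} \<and> i mod 2 = j mod 2 \<and> cv i \<noteq> cv j"
      proof (rule ccontr)
        assume "\<not> ?thesis"
        then have "stab C1 \<cong> dihedral_group CARD('n)"
          by (intro stab_component_dihedral[OF _ e v assms(4)]) blast
        then show False using assms(5) by simp
      qed
      then obtain i j where ij: "i \<in> {1..<CARD('n)}" "j \<in> {1..<CARD('n)}" "i mod 2 = j mod 2" "cv i \<noteq> cv j"
        by blast
      have "(\<Sum>j<CARD('n). c j) \<noteq> 0"
        using assms(3) sum.reindex_bij_betw[OF e, of c] by (simp add: v)
      from card_zeros_le[OF assms(1) e this ij a(1)] show ?thesis by (simp add: y v)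
    qed
  qed
qed

end
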